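(* Consider the Poisson system of Dirac particle clusters described in the context, with $\psi:\mathbb{R}^d\to\mathbb{R}$ a bounded, compactly supported, non-negative test function, and suppose that condition (H) of the context holds with constants $\kappa,\beta>0$, where $\beta d<1$. Let $\rho_r$ be the law of $Z_r[\psi]=\sigma_r^{-1}(A_r[\psi]-\mathbb{E}[A_r[\psi]])$ and $\gamma$ the standard Gaussian law. Then there is a constant $K>0$ independent of $r$ such that for all $r>0$ $$d_W(\rho_r,\gamma)\le K\,\frac{r^{1-\beta d}}{\sigma_r}.$$
   Context: Poisson input: $\nu$ is a Radon measure on $\mathbb{R}^d$, absolutely continuous with respect to Lebesgue measure, with density bounded from above and bounded away from zero; $\eta$ is a Poisson random measure on $\mathbb{R}^d$ with intensity $\nu$. Particles: fix $m\in\mathbb{N}$ and $a_1,\dots,a_m>0$. For each $x\in\mathbb{R}^d$ let $\mathbf{X}^x=\{(X_t^{1,x},\dots,X_t^{m,x}): t\ge0\}$ be an $(\mathbb{R}^d)^m$-valued process; the processes $\{\mathbf{X}^x\}_{x\in\mathbb{R}^d}$ are independent of one another and of $\eta$, with $X_0^{i,x}=x$ and with $X_t^{i,x}$ distributed (jointly in $i,t$) as $X_t^{i,0}+x$. Put $\mu_t^x:=a_1\delta_{X_t^{1,x}}+\cdots+a_m\delta_{X_t^{m,x}}$ and $\mu_t^\eta:=\int_{\mathbb{R}^d}\mu_t^x\,\eta(dx)$. Functional: $A_r[\psi]:=\int_0^r\int_{\mathbb{R}^d}\psi\,d\mu_t^\eta\,dt$, and $\sigma_r$ is the standard deviation of $A_r[\psi]$,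 assumed to satisfy $0<\sigma_r<\infty$. Condition (H): for each multi-index $\mathbb{i}=(i_1,i_2,i_3)\in\{1,\dots,m\}^3$ and pairwise distinct positive times $s_1,s_2,s_3$, the vector $(X_{s_1}^{i_1,0},X_{s_2}^{i_2,0},X_{s_3}^{i_3,0})$ has a joint density $f^{\mathbb{i}}_{s_1,s_2,s_3}$ on $(\mathbb{R}^d)^3$; let $f^{(i_1,i_2)}_{s_1,s_2}$ be the joint density of the first two components. There are constants $\kappa,\beta>0$ such that, whenever $s_1,s_2<s_3$, the conditional density $f^{\mathbb{i}}_{s_3|s_1,s_2}(a\,|\,(b,c)):=f^{\mathbb{i}}_{s_1,s_2,s_3}(b,c,a)/f^{(i_1,i_2)}_{s_1,s_2}(b,c)$ satisfies $$\sup_{a,b,c\in\mathbb{R}^d} f^{\mathbb{i}}_{s_3|s_1,s_2}(a\,|\,(b,c))\le\kappa\,|s_3-(s_1\vee s_2)|^{-\beta d}.$$ Wasserstein distance: $d_W(\rho_1,\rho_2):=\sup\{|\int h\,d\rho_1-\int h\,d\rho_2| : h:\mathbb{R}\to\mathbb{R}\ 1\text{-Lipschitz}\}$.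
   Formalization: The stated independence over fixed x does not determine the clusters at the points of η; added: along a measurable enumeration of these points, the displacements are i.i.d. copies of X^0, independent of the points and jointly measurable in time and chance. *)

theory Defs
  imports "HOL-Probability.Probability"
begin

text \<open>
  \<open>\<real>\<^sup>d\<close> is \<open>real ^ 'n\<close> with \<open>d = CARD('n)\<close>. A family of particle processes is a function \<open>X\<close> such that
  \<open>X i t x \<omega>\<close> is the position at time \<open>t \<ge> 0\<close> of the \<open>i\<close>-th particle (\<open>1 \<le> i \<le> m\<close>) of the
  cluster started at \<open>x\<close>. Times range over the type \<open>real\<close>, but only \<open>t \<ge> 0\<close> is ever used.
\<close>

definition poisson_random_measure ::
    "'w measure \<Rightarrow> 'a measure \<Rightarrow> ('w \<Rightarrow> 'a measure) \<Rightarrow> bool" where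
  "poisson_random_measure M \<nu> \<eta> \<longleftrightarrow>
     (\<forall>\<omega>\<in>space M. sets (\<eta> \<omega>) = sets \<nu>) \<and>
     (\<forall>B\<in>sets \<nu>. (\<lambda>\<omega>. emeasure (\<eta> \<omega>) B) \<in> borel_measurable M) \<and>
     (\<forall>B\<in>sets \<nu>. emeasure \<nu> B < \<infinity> \<longrightarrow>
        (\<forall>k::nat. measure M {\<omega>\<in>space M. emeasure (\<eta> \<omega>) B = of_nat k}
                   = measure \<nu> B ^ k / fact k * exp (- measure \<nu> B))) \<and>
     (\<forall>B\<in>sets \<nu>. emeasure \<nu> B = \<infinity> \<longrightarrow> (AE \<omega> in M. emeasure (\<eta> \<omega>) B = \<infinity>)) \<and>
     (\<forall>\<B>\<subseteq>sets \<nu>. finite \<B> \<longrightarrow> disjoint \<B> \<longrightarrow>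
        prob_space.indep_vars M (\<lambda>_. borel) (\<lambda>B \<omega>. emeasure (\<eta> \<omega>) B) \<B>)"

definition cluster_paths :: "nat \<Rightarrow> (nat \<times> real \<Rightarrow> 'a::topological_space) measure" where
  "cluster_paths m = (\<Pi>\<^sub>M j\<in>{1..m} \<times> {0..}. borel)"

definition cluster_path :: "nat \<Rightarrow> (nat \<Rightarrow> real \<Rightarrow> 'w \<Rightarrow> 'a) \<Rightarrow> 'w \<Rightarrow> (nat \<times> real \<Rightarrow> 'a)" where
  "cluster_path m Y \<omega> = (\<lambda>(i, t)\<in>{1..m} \<times> {0..}. Y i t \<omega>)"

definition cluster_law ::
    "'w measure \<Rightarrow> nat \<Rightarrow> (nat \<Rightarrow> real \<Rightarrow> 'w \<Rightarrow> 'a::topological_space) \<Rightarrow> (nat \<times> real \<Rightarrow> 'a) measure"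
  where "cluster_law M m Y = distr M (cluster_paths m) (cluster_path m Y)"

definition cluster_events ::
    "'w measure \<Rightarrow> nat \<Rightarrow> (nat \<Rightarrow> real \<Rightarrow> 'w \<Rightarrow> 'a::topological_space) \<Rightarrow> 'w set set" where
  "cluster_events M m Y = sets (vimage_algebra (space M) (cluster_path m Y) (cluster_paths m))"

definition random_measure_events :: "'w measure \<Rightarrow> ('w \<Rightarrow> 'a::topological_space measure) \<Rightarrow> 'w set set"
  where
  "random_measure_events M \<eta> =
     sets (vimage_algebra (space M) (\<lambda>\<omega>. \<lambda>B\<in>sets borel. emeasure (\<eta> \<omega>) B)
             (\<Pi>\<^sub>M B\<in>sets borel. borel))"

definition sequence_events :: "'w measure \<Rightarrow> (nat \<Rightarrow> 'w \<Rightarrow> 'a::topological_space) \<Rightarrow> 'w set set" where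
  "sequence_events M \<xi> = sets (vimage_algebra (space M) (\<lambda>\<omega> n. \<xi> n \<omega>) (\<Pi>\<^sub>M n\<in>UNIV. borel))"

text \<open>
  Independence of the uncountably many clusters of one another and of \<open>\<eta>\<close> alone says nothing about
  the clusters that enter \<open>\<integral> \<mu>\<^sub>t\<^sup>x \<eta>(dx)\<close>: each fixed \<open>x\<close> is almost surely not an atom of \<open>\<eta>\<close>, so the
  clusters at the atoms could be changed arbitrarily without affecting \<open>independent\<close> below, and the
  integral need not even be measurable in \<open>\<omega>\<close>. The assumption \<open>marking\<close> expresses what
  independence is used for: along an enumeration of the atoms of \<open>\<eta>\<close>, the displacements of the attached
  clusters are independent of one another and of the atoms, and each is a copy of the cluster
  started at \<open>0\<close>. Since the intensity is infinite and diffuse, \<open>\<eta>\<close> almost surely has infinitely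
  many atoms, all simple. Joint measurability in time and \<open>\<omega>\<close> gives a meaning to the time integral.
\<close>

locale poisson_cluster_system = prob_space M
  for M :: "'w measure" +
  fixes m :: nat
    and a :: "nat \<Rightarrow> real"
    and \<nu> :: "(real ^ 'n) measure"
    and \<eta> :: "'w \<Rightarrow> (real ^ 'n) measure"
    and X :: "nat \<Rightarrow> real \<Rightarrow> real ^ 'n \<Rightarrow> 'w \<Rightarrow> real ^ 'n"
  assumes intensity: "\<exists>p c C. p \<in> borel_measurable borel \<and> 0 < c \<and>
        (\<forall>x. c \<le> p x \<and> p x \<le> C) \<and> \<nu> = density lborel (\<lambda>x. ennreal (p x))"
    and poisson: "poisson_random_measure M \<nu> \<eta>"
    and weights: "\<And>i. i \<in> {1..m} \<Longrightarrow> 0 < a i"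
    and process: "\<And>i t x. i \<in> {1..m} \<Longrightarrow> 0 \<le> t \<Longrightarrow> X i t x \<in> borel_measurable M"
    and start: "\<And>i x. i \<in> {1..m} \<Longrightarrow> AE \<omega> in M. X i 0 x \<omega> = x"
    and stationary: "\<And>x. cluster_law M m (\<lambda>i t. X i t x) = cluster_law M m (\<lambda>i t \<omega>. X i t 0 \<omega> + x)"
    and independent: "indep_sets
        (\<lambda>j. case j of None \<Rightarrow> random_measure_events M \<eta>
                     | Some x \<Rightarrow> cluster_events M m (\<lambda>i t. X i t x)) UNIV"
    and marking: "\<exists>\<xi> :: nat \<Rightarrow> 'w \<Rightarrow> real ^ 'n.
        (\<forall>n. \<xi> n \<in> borel_measurable M) \<and>
        (AE \<omega> in M. \<forall>B\<in>sets borel. emeasure (\<eta> \<omega>) B = (\<Sum>n. indicator B (\<xi> n \<omega>))) \<and>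
        (\<forall>n. \<forall>i\<in>{1..m}. (\<lambda>(t, \<omega>). X i t (\<xi> n \<omega>) \<omega>)
               \<in> borel_measurable (restrict_space borel {0..} \<Otimes>\<^sub>M M)) \<and>
        indep_sets
          (\<lambda>j. case j of None \<Rightarrow> sequence_events M \<xi>
                       | Some n \<Rightarrow> cluster_events M m (\<lambda>i t \<omega>. X i t (\<xi> n \<omega>) \<omega> - \<xi> n \<omega>)) UNIV \<and>
        (\<forall>n. cluster_law M m (\<lambda>i t \<omega>. X i t (\<xi> n \<omega>) \<omega> - \<xi> n \<omega>) = cluster_law M m (\<lambda>i t. X i t 0))"

definition cluster_measure ::
    "nat \<Rightarrow> (nat \<Rightarrow> real) \<Rightarrow> (nat \<Rightarrow> real \<Rightarrow> 'a \<Rightarrow> 'w \<Rightarrow> 'a::topological_space) \<Rightarrow>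
     real \<Rightarrow> 'a \<Rightarrow> 'w \<Rightarrow> 'a measure" where
  "cluster_measure m a X t x \<omega> = measure_of UNIV (sets borel)
     (\<lambda>B. \<Sum>i\<in>{1..m}. ennreal (a i) * emeasure (return borel (X i t x \<omega>)) B)"

text \<open>
  The integrand below need not be measurable in \<open>x\<close>. This is harmless: \<open>\<eta> \<omega>\<close> is a countable sum of
  point masses, and for such measures the nonnegative integral (a supremum over simple functions
  below the integrand) of any nonnegative function is its sum over the atoms.
\<close>

definition particle_measure ::
    "nat \<Rightarrow> (nat \<Rightarrow> real) \<Rightarrow> ('w \<Rightarrow> 'a measure) \<Rightarrow>
     (nat \<Rightarrow> real \<Rightarrow> 'a \<Rightarrow> 'w \<Rightarrow> 'a::topological_space) \<Rightarrow> real \<Rightarrow> 'w \<Rightarrow> 'a measure" where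
  "particle_measure m a \<eta> X t \<omega> = measure_of UNIV (sets borel)
     (\<lambda>B. \<integral>\<^sup>+x. emeasure (cluster_measure m a X t x \<omega>) B \<partial>\<eta> \<omega>)"

definition occupation_functional ::
    "nat \<Rightarrow> (nat \<Rightarrow> real) \<Rightarrow> ('w \<Rightarrow> 'a measure) \<Rightarrow>
     (nat \<Rightarrow> real \<Rightarrow> 'a \<Rightarrow> 'w \<Rightarrow> 'a::topological_space) \<Rightarrow> ('a \<Rightarrow> real) \<Rightarrow> real \<Rightarrow> 'w \<Rightarrow> real" where
  "occupation_functional m a \<eta> X \<psi> r \<omega> =
     (LINT t:{0..r}|lborel. (\<integral>y. \<psi> y \<partial>particle_measure m a \<eta> X t \<omega>))"

text \<open>
  Condition (H). Densities are only determined almost everywhere, so the bound is required for some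
  choice of versions; \<open>f2\<close> does not depend on the third index and time. Where \<open>f2\<close> vanishes, the
  conditional density is \<open>0\<close> by the convention \<open>x / 0 = 0\<close>.
\<close>

definition conditional_density_bound ::
    "'w measure \<Rightarrow> nat \<Rightarrow> (nat \<Rightarrow> real \<Rightarrow> real ^ 'n \<Rightarrow> 'w \<Rightarrow> real ^ 'n) \<Rightarrow> real \<Rightarrow> real \<Rightarrow> bool" where
  "conditional_density_bound M m X \<kappa> \<beta> \<longleftrightarrow>
     (\<exists>(f3 :: nat \<times> nat \<times> nat \<Rightarrow> real \<times> real \<times> real \<Rightarrow>
               (real ^ 'n) \<times> (real ^ 'n) \<times> (real ^ 'n) \<Rightarrow> real)
       (f2 :: nat \<times> nat \<Rightarrow> real \<times> real \<Rightarrow> (real ^ 'n) \<times> (real ^ 'n) \<Rightarrow> real).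
      \<forall>i1\<in>{1..m}. \<forall>i2\<in>{1..m}. \<forall>i3\<in>{1..m}. \<forall>s1>0. \<forall>s2>0. \<forall>s3>0.
        s1 \<noteq> s2 \<and> s1 \<noteq> s3 \<and> s2 \<noteq> s3 \<longrightarrow>
          (\<forall>z. 0 \<le> f3 (i1, i2, i3) (s1, s2, s3) z) \<and>
          (\<forall>z. 0 \<le> f2 (i1, i2) (s1, s2) z) \<and>
          distributed M lborel (\<lambda>\<omega>. (X i1 s1 0 \<omega>, X i2 s2 0 \<omega>, X i3 s3 0 \<omega>))
            (\<lambda>z. ennreal (f3 (i1, i2, i3) (s1, s2, s3) z)) \<and>
          distributed M lborel (\<lambda>\<omega>. (X i1 s1 0 \<omega>, X i2 s2 0 \<omega>))
            (\<lambda>z. ennreal (f2 (i1, i2) (s1, s2) z)) \<and>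
          (s1 < s3 \<and> s2 < s3 \<longrightarrow>
             (\<forall>x b c. f3 (i1, i2, i3) (s1, s2, s3) (b, c, x) / f2 (i1, i2) (s1, s2) (b, c)
                 \<le> \<kappa> * \<bar>s3 - max s1 s2\<bar> powr (- (\<beta> * real CARD('n))))))"

definition standard_deviation :: "'w measure \<Rightarrow> ('w \<Rightarrow> real) \<Rightarrow> real" where
  "standard_deviation M Y = sqrt (prob_space.variance M Y)"

definition standardized_law :: "'w measure \<Rightarrow> ('w \<Rightarrow> real) \<Rightarrow> real measure" where
  "standardized_law M Y =
     distr M borel (\<lambda>\<omega>. (Y \<omega> - prob_space.expectation M Y) / standard_deviation M Y)"

text \<open>The integrals are meaningful for laws with a finite first moment.\<close>

definition wasserstein_dist :: "real measure \<Rightarrow> real measure \<Rightarrow> ennreal" where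
  "wasserstein_dist \<rho>\<^sub>1 \<rho>\<^sub>2 =
     (SUP h\<in>{h :: real \<Rightarrow> real. 1-lipschitz_on UNIV h}. ennreal \<bar>(\<integral>x. h x \<partial>\<rho>\<^sub>1) - (\<integral>x. h x \<partial>\<rho>\<^sub>2)\<bar>)"

end

theory Submission
  imports Defs
begin

text \<open>
  Let \<open>\<xi>\<^sub>n\<close> enumerate the atoms of \<open>\<eta>\<close>. Almost surely \<open>A\<^sub>r = \<Sum>\<^sub>n W\<^sub>n\<close>, where \<open>W\<^sub>n\<close> is the \<open>\<psi>\<close>-mass
  which the cluster at \<open>\<xi>\<^sub>n\<close> collects up to time \<open>r\<close>. Given the atoms, the \<open>W\<^sub>n\<close> are independent, so the
  Laplace functional of the Poisson random measure shows that \<open>A\<^sub>r\<close> is infinitely divisible: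
  \<open>E exp (- u A\<^sub>r) = exp (- \<integral> 1 - exp (- u w) dQ)\<close>, where \<open>Q = \<nu> \<Otimes> M\<close> and \<open>w (x, \<omega>)\<close> is the mass
  collected by a cluster started at \<open>x\<close> (\<open>laplace_total_load_load\<close>).

  Differentiation in \<open>u\<close> and uniqueness of Laplace transforms turn this into the size-bias identity
  \<open>E (A f(A)) = \<integral> w E f(A + w) dQ\<close> (\<open>size_bias\<close>). It gives \<open>\<sigma>\<^sup>2 = \<integral> w\<^sup>2 dQ\<close>. Inserting the solution
  \<open>f\<close> of Stein's equation, whose derivative is Lipschitz with an absolute constant, and expanding
  \<open>f(A + w) - f(A)\<close> to first order leaves the remainder \<open>\<integral> w\<^sup>3 dQ\<close>, so the Wasserstein distance is at
  most \<open>18 \<integral> w\<^sup>3 dQ / \<sigma>\<^sup>3\<close> (\<open>wasserstein_bound\<close>).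

  Condition (H) enters only in the comparison of \<open>\<integral> w\<^sup>3 dQ\<close> with \<open>\<integral> w\<^sup>2 dQ\<close>. Write \<open>w\<^sup>3\<close> as a
  triple time integral and order the times. Given the positions at the two earlier times, the position
  at the last time \<open>s\<close> has density at most \<open>\<kappa> \<bar>s - s'\<bar> powr (- \<beta> d)\<close>, where \<open>s'\<close> is the later of those
  two times, and \<open>\<beta> d < 1\<close> makes the time integral of this bound at most a multiple of
  \<open>r powr (1 - \<beta> d)\<close>. Hence \<open>\<integral> w\<^sup>3 dQ \<le> C r powr (1 - \<beta> d) \<sigma>\<^sup>2\<close> (\<open>integral_wQ_cube_le\<close>), and
  division by \<open>\<sigma>\<^sup>3\<close> is the claim.

  One point of measure theory needs care: the path of a cluster is an element of an uncountable
  product space, and the time integral \<open>W\<^sub>n\<close> is not a measurable function of it. Independence and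
  equality in law, which are formulated for paths, therefore give information on finitely many times
  only. They are transferred to time integrals by computing moments with Fubini's theorem
  (\<open>laplace_eq_of_moments\<close>).
\<close>

section \<open>Stein's equation\<close>

text \<open>
  A growth bound for solutions of \<open>u' = x u + q\<close> that do not see the growing homogeneous solution
  \<open>exp (x\<^sup>2 / 2)\<close>. For \<open>y \<ge> x > 0\<close> one has \<open>\<bar>q y\<bar> \<le> c y\<close> with \<open>c = \<alpha> / x + b\<close>, so that
  \<open>(c \<plusminus> u y) exp (- y\<^sup>2 / 2)\<close> decreases; its limit is \<open>0\<close>, hence it is nonnegative at \<open>x\<close>.
  The two forms of forcing that matter are \<open>b = 0\<close>, where the bound says that \<open>x u\<close> stays bounded, and
  linear growth, where \<open>u\<close> itself stays bounded.
\<close>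

lemma gaussian_decay_bound_right:
  fixes u q :: "real \<Rightarrow> real"
  assumes deriv: "\<And>y. (u has_real_derivative y * u y + q y) (at y)"
    and lim: "((\<lambda>y. u y * exp (- y\<^sup>2 / 2)) \<longlongrightarrow> 0) at_top"
    and bound: "\<And>y. \<bar>q y\<bar> \<le> \<alpha> + b * \<bar>y\<bar>" and "0 \<le> \<alpha>" "0 < x"
  shows "\<bar>u x\<bar> \<le> \<alpha> / x + b"
proof -
  define c where "c = \<alpha> / x + b"
  have q_le: "\<bar>q y\<bar> \<le> c * y" if "x \<le> y" for y
  proof -
    have "\<alpha> \<le> \<alpha> / x * y"
      using that assms(4,5) by (simp add: field_simps mult_left_mono)
    then show ?thesis
      using bound[of y] that assms(5) by (simp add: c_def algebra_simps)
  qed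
  have aux: "s * u x \<le> c" if s: "s = 1 \<or> s = - 1" for s :: real
  proof -
    define D where "D y = (c - s * u y) * exp (- y\<^sup>2 / 2)" for y
    have D': "(D has_real_derivative - (c * y + s * q y) * exp (- y\<^sup>2 / 2)) (at y)" for y
      unfolding D_def
      by (auto intro!: derivative_eq_intros deriv simp: algebra_simps)
    have mono: "D z \<le> D y" if "x \<le> y" "y \<le> z" for y z
    proof (rule DERIV_nonpos_imp_nonincreasing[OF that(2)])
      fix w assume "y \<le> w" "w \<le> z"
      then have "\<bar>q w\<bar> \<le> c * w" using q_le that by auto
      then have "0 \<le> c * w + s * q w" using s by auto
      then have "- (c * w + s * q w) * exp (- w\<^sup>2 / 2) \<le> 0"
        by (intro mult_nonpos_nonneg) auto
      then show "\<exists>v. (D has_real_derivative v) (at w) \<and> v \<le> 0"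
        using D'[of w] by blast
    qed
    have "((\<lambda>y. exp (- y\<^sup>2 / 2) :: real) \<longlongrightarrow> 0) at_top"
      by real_asymp
    from tendsto_diff[OF tendsto_mult[OF tendsto_const[of c] this] tendsto_mult[OF tendsto_const[of s] lim]]
    have "(D \<longlongrightarrow> 0) at_top"
      by (simp add: D_def[abs_def] algebra_simps)
    then have "0 \<le> D x"
      by (rule tendsto_upperbound)
        (auto simp: eventually_at_top_linorder intro!: exI[of _ x] mono)
    then show ?thesis by (simp add: D_def zero_le_mult_iff)
  qed
  show ?thesis
    using aux[of 1] aux[of "-1"] by (simp add: c_def abs_le_iff)
qed

lemma gaussian_decay_bound:
  fixes u q :: "real \<Rightarrow> real"
  assumes deriv: "\<And>y. (u has_real_derivative y * u y + q y) (at y)"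
    and top: "((\<lambda>y. u y * exp (- y\<^sup>2 / 2)) \<longlongrightarrow> 0) at_top"
    and bot: "((\<lambda>y. u y * exp (- y\<^sup>2 / 2)) \<longlongrightarrow> 0) at_bot"
    and bound: "\<And>y. \<bar>q y\<bar> \<le> \<alpha> + b * \<bar>y\<bar>" and "0 \<le> \<alpha>" "x \<noteq> 0"
  shows "\<bar>u x\<bar> \<le> \<alpha> / \<bar>x\<bar> + b"
proof (cases "0 < x")
  case True
  then show ?thesis
    using gaussian_decay_bound_right[OF deriv top bound assms(5)] by simp
next
  case False
  have "((\<lambda>y. u (- y)) has_real_derivative y * u (- y) + - q (- y)) (at y)" for y
    using iffD1[OF DERIV_mirror deriv[of "- y"]] by simp
  moreover have "((\<lambda>y. u (- y) * exp (- y\<^sup>2 / 2)) \<longlongrightarrow> 0) at_top"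
    using filterlim_compose[OF bot filterlim_uminus_at_bot_at_top] by simp
  moreover have "\<bar>- q (- y)\<bar> \<le> \<alpha> + b * \<bar>y\<bar>" for y
    using bound[of "- y"] by simp
  ultimately have "\<bar>u (- (- x))\<bar> \<le> \<alpha> / (- x) + b"
    by (rule gaussian_decay_bound_right) (use False assms(5,6) in auto)
  then show ?thesis using False by simp
qed

text \<open>
  Outside \<open>[-1, 1]\<close> this is the previous bound. Inside, \<open>u y exp (- y\<^sup>2 / 2)\<close> has derivative at most
  \<open>\<alpha> + b\<close> and is controlled at the nearer of the points \<open>1\<close> and \<open>-1\<close>; multiplying by
  \<open>exp (x\<^sup>2 / 2) \<le> 2\<close> accounts for the factor \<open>4\<close>.
\<close>

lemma gaussian_decay_global_bound:
  fixes u q :: "real \<Rightarrow> real"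
  assumes deriv: "\<And>y. (u has_real_derivative y * u y + q y) (at y)"
    and top: "((\<lambda>y. u y * exp (- y\<^sup>2 / 2)) \<longlongrightarrow> 0) at_top"
    and bot: "((\<lambda>y. u y * exp (- y\<^sup>2 / 2)) \<longlongrightarrow> 0) at_bot"
    and bound: "\<And>y. \<bar>q y\<bar> \<le> \<alpha> + b * \<bar>y\<bar>" and "0 \<le> \<alpha>" "0 \<le> b"
  shows "\<bar>u x\<bar> \<le> 4 * (\<alpha> + b)"
proof (cases "1 \<le> \<bar>x\<bar>")
  case True
  then have "\<alpha> / \<bar>x\<bar> \<le> \<alpha>"
    using assms(5) divide_left_mono[of 1 "\<bar>x\<bar>" \<alpha>] by simp
  moreover have "\<bar>u x\<bar> \<le> \<alpha> / \<bar>x\<bar> + b"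
    by (rule gaussian_decay_bound[OF deriv top bot bound assms(5)]) (use True in auto)
  ultimately have "\<bar>u x\<bar> \<le> \<alpha> + b" by (meson add_right_mono order_trans)
  also have "\<dots> \<le> 4 * (\<alpha> + b)" using assms(5,6) by simp
  finally show ?thesis .
next
  case False
  define v where "v y = u y * exp (- y\<^sup>2 / 2)" for y
  define e :: real where "e = (if 0 \<le> x then 1 else - 1)"
  have v': "(v has_real_derivative q y * exp (- y\<^sup>2 / 2)) (at y)" for y
    unfolding v_def by (auto intro!: derivative_eq_intros deriv simp: algebra_simps)
  have "norm (v x - v e) \<le> (\<alpha> + b) * norm (x - e)"
  proof (rule field_differentiable_bound[of "{- 1..1}"])
    fix y :: real assume y: "y \<in> {- 1..1}"
    show "(v has_field_derivative q y * exp (- y\<^sup>2 / 2)) (at y within {- 1..1})"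
      by (rule has_field_derivative_at_within[OF v'])
    have "\<bar>q y\<bar> \<le> \<alpha> + b"
      using bound[of y] mult_left_mono[OF abs_leI[of y 1] assms(6)] y by simp
    then have "\<bar>q y\<bar> * exp (- y\<^sup>2 / 2) \<le> (\<alpha> + b) * 1"
      by (intro mult_mono) auto
    then show "norm (q y * exp (- y\<^sup>2 / 2)) \<le> \<alpha> + b"
      by (simp add: abs_mult)
  qed (use False in \<open>auto simp: e_def\<close>)
  also have "\<dots> \<le> (\<alpha> + b) * 1"
    using assms(5,6) False by (intro mult_left_mono) (auto simp: e_def)
  finally have 1: "\<bar>v x - v e\<bar> \<le> \<alpha> + b" by simp
  have "\<bar>u e\<bar> \<le> \<alpha> / \<bar>e\<bar> + b"
    by (rule gaussian_decay_bound[OF deriv top bot bound]) (auto simp: e_def assms)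
  then have "\<bar>u e\<bar> * exp (- e\<^sup>2 / 2) \<le> (\<alpha> + b) * 1"
    using assms(5,6) by (intro mult_mono) (auto simp: e_def)
  then have "\<bar>v e\<bar> \<le> \<alpha> + b" by (simp add: v_def abs_mult)
  with 1 have v: "\<bar>v x\<bar> \<le> 2 * (\<alpha> + b)"
    using abs_triangle_ineq[of "v x - v e" "v e"] by simp
  have "x\<^sup>2 \<le> 1\<^sup>2" using False by (intro power2_le_iff_abs_le[THEN iffD2]) auto
  then have "exp (x\<^sup>2 / 2) \<le> exp (1 / 2 :: real)" by simp
  also have "exp (1 / 2 :: real) \<le> 2"
    using exp_bound_half[of "1/2 :: real"] by simp
  finally have "\<bar>v x\<bar> * exp (x\<^sup>2 / 2) \<le> 2 * (\<alpha> + b) * 2"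
    using v by (intro mult_mono) auto
  moreover have "u x = v x * exp (x\<^sup>2 / 2)"
    by (simp add: v_def mult.assoc flip: exp_add)
  ultimately show ?thesis by (simp add: abs_mult)
qed

lemma lipschitz_of_derivative_bound:
  fixes h h' :: "real \<Rightarrow> real"
  assumes "\<And>x. (h has_real_derivative h' x) (at x)" "\<And>x. \<bar>h' x\<bar> \<le> 1"
  shows "1-lipschitz_on UNIV h"
proof (rule lipschitz_onI)
  fix x y :: real
  have "norm (h x - h y) \<le> 1 * norm (x - y)"
    by (rule field_differentiable_bound[of UNIV]) (use assms in auto)
  then show "dist (h x) (h y) \<le> 1 * dist x y" by (simp add: dist_real_def)
qed simp

lemma lipschitz_measurable:
  fixes h :: "real \<Rightarrow> real"
  shows "1-lipschitz_on UNIV h \<Longrightarrow> h \<in> borel_measurable borel"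
  by (intro borel_measurable_continuous_onI lipschitz_on_continuous_on)

lemma lipschitz_linear_growth:
  fixes h :: "real \<Rightarrow> real"
  assumes "1-lipschitz_on UNIV h"
  shows "\<bar>h x\<bar> \<le> \<bar>h 0\<bar> + \<bar>x\<bar>"
  using lipschitz_onD[OF assms, of x 0] by (auto simp: dist_real_def)

lemma integral_std_normal_density: "(\<integral>y. std_normal_density y \<partial>lborel) = 1"
  using integral_std_normal_moment_even[of 0] by simp

lemma integrable_lipschitz_gaussian:
  fixes h :: "real \<Rightarrow> real"
  assumes "1-lipschitz_on UNIV h"
  shows "integrable lborel (\<lambda>y. std_normal_density y * h y)"
proof (rule Bochner_Integration.integrable_bound)
  show "integrable lborel (\<lambda>y. \<bar>h 0\<bar> * std_normal_density y + std_normal_density y * \<bar>y\<bar> ^ 1)"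
    by (intro Bochner_Integration.integrable_add integrable_mult_right integrable_std_normal_moment_abs) auto
  note [measurable] = lipschitz_measurable[OF assms]
  show "(\<lambda>y. std_normal_density y * h y) \<in> borel_measurable lborel" by measurable
  have "std_normal_density y * \<bar>h y\<bar> \<le> std_normal_density y * (\<bar>h 0\<bar> + \<bar>y\<bar>)" for y
    by (intro mult_left_mono lipschitz_linear_growth assms) auto
  then show "AE y in lborel. norm (std_normal_density y * h y)
        \<le> norm (\<bar>h 0\<bar> * std_normal_density y + std_normal_density y * \<bar>y\<bar> ^ 1)"
    by (auto simp: abs_mult algebra_simps)
qed

text \<open>
  The inhomogeneity of Stein's equation grows at most linearly, since \<open>E \<bar>Z\<bar> = sqrt (2 / pi) \<le> 1\<close> for a
  standard Gaussian \<open>Z\<close>.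
\<close>

lemma lipschitz_minus_gaussian_mean:
  fixes h :: "real \<Rightarrow> real"
  assumes h: "1-lipschitz_on UNIV h"
  shows "\<bar>h x - (\<integral>y. std_normal_density y * h y \<partial>lborel)\<bar> \<le> 1 + 1 * \<bar>x\<bar>"
proof -
  note one = integral_std_normal_density
  have "h x - (\<integral>y. std_normal_density y * h y \<partial>lborel)
      = (\<integral>y. std_normal_density y * h x - std_normal_density y * h y \<partial>lborel)"
    by (subst Bochner_Integration.integral_diff)
      (auto intro: integrable_lipschitz_gaussian[OF h] simp: one)
  also have "\<bar>\<dots>\<bar> \<le> (\<integral>y. std_normal_density y * \<bar>x\<bar> + std_normal_density y * \<bar>y\<bar> ^ 1 \<partial>lborel)"
  proof (rule integral_abs_bound_integral)
    show "integrable lborel (\<lambda>y. std_normal_density y * h x - std_normal_density y * h y)"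
      by (intro Bochner_Integration.integrable_diff integrable_lipschitz_gaussian[OF h]) auto
    show "integrable lborel (\<lambda>y. std_normal_density y * \<bar>x\<bar> + std_normal_density y * \<bar>y\<bar> ^ 1)"
      by (intro Bochner_Integration.integrable_add integrable_std_normal_moment_abs) auto
    fix y
    have "\<bar>h x - h y\<bar> \<le> \<bar>x\<bar> + \<bar>y\<bar>"
      using lipschitz_onD[OF h, of x y] by (auto simp: dist_real_def)
    then have "std_normal_density y * \<bar>h x - h y\<bar> \<le> std_normal_density y * (\<bar>x\<bar> + \<bar>y\<bar>)"
      by (intro mult_left_mono) auto
    moreover have "\<bar>std_normal_density y * h x - std_normal_density y * h y\<bar>
        = std_normal_density y * \<bar>h x - h y\<bar>"
      by (simp add: abs_mult flip: right_diff_distrib)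
    ultimately show "\<bar>std_normal_density y * h x - std_normal_density y * h y\<bar>
        \<le> std_normal_density y * \<bar>x\<bar> + std_normal_density y * \<bar>y\<bar> ^ 1"
      by (simp add: algebra_simps)
  qed
  also have "\<dots> = \<bar>x\<bar> + (\<integral>y. std_normal_density y * \<bar>y\<bar> ^ 1 \<partial>lborel)"
    by (subst Bochner_Integration.integral_add)
      (auto intro: integrable_std_normal_moment_abs[of 1, simplified] simp: one)
  also have "(\<integral>y. std_normal_density y * \<bar>y\<bar> ^ 1 \<partial>lborel) = sqrt (2 / pi)"
    using integral_std_normal_moment_abs_odd[of 0] by simp
  also have "sqrt (2 / pi) \<le> 1"
    using pi_gt3 by (auto simp: real_sqrt_le_1_iff)
  finally show ?thesis by simp
qed

text \<open>
  The boundary behaviour of the Stein solution: because the forcing has Gaussian mean zero, one and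
  the same antiderivative vanishes at both ends.
\<close>

lemma indefinite_integral_of_zero_mean:
  fixes k :: "real \<Rightarrow> real"
  assumes cont: "continuous_on UNIV k" and int: "integrable lborel k" and zero: "(\<integral>y. k y \<partial>lborel) = 0"
  obtains P where "\<And>x. (P has_real_derivative k x) (at x)"
    "(P \<longlongrightarrow> 0) at_top" "(P \<longlongrightarrow> 0) at_bot"
proof -
  have isC: "isCont k x" for x
    using cont continuous_on_eq_continuous_at by blast
  obtain G where G: "\<And>x. (G has_vector_derivative k x) (at x)"
    using einterval_antiderivative[of "-\<infinity>" "\<infinity>" k] isC by auto
  have ind: "integrable lborel (\<lambda>y. indicator S y *\<^sub>R k y)" if "S \<in> sets lborel" for S
    using integrable_mult_indicator[OF that int] .
  define P where "P x = (\<integral>y. indicator {..x} y *\<^sub>R k y \<partial>lborel)" for x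
  have diff: "P y - P x = G y - G x" if "x \<le> y" for x y
  proof -
    have "P y - P x = (\<integral>z. indicator {..y} z *\<^sub>R k z - indicator {..x} z *\<^sub>R k z \<partial>lborel)"
      unfolding P_def by (subst Bochner_Integration.integral_diff) (auto intro: ind[simplified])
    also have "\<dots> = (\<integral>z. k z * indicator {x..y} z \<partial>lborel)"
    proof (rule integral_cong_AE)
      show "(\<lambda>z. indicator {..y} z *\<^sub>R k z - indicator {..x} z *\<^sub>R k z) \<in> borel_measurable lborel"
        using int by measurable
      show "(\<lambda>z. k z * indicator {x..y} z) \<in> borel_measurable lborel"
        using int by measurable
      have "AE z in lborel. z \<noteq> x" by (rule AE_lborel_singleton)
      then show "AE z in lborel. indicator {..y} z *\<^sub>R k z - indicator {..x} z *\<^sub>R k z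
          = k z * indicator {x..y} z"
        by eventually_elim (use that in \<open>auto split: split_indicator\<close>)
    qed
    also have "\<dots> = G y - G x"
      by (rule integral_FTC_Icc_real[OF that])
        (use G isC in \<open>auto simp: has_real_derivative_iff_has_vector_derivative\<close>)
    finally show ?thesis .
  qed
  define c where "c = P 0 - G 0"
  have P_eq: "P = (\<lambda>x. G x + c)"
  proof
    show "P x = G x + c" for x
      using diff[of 0 x] diff[of x 0] by (cases "0 \<le> x") (auto simp: c_def)
  qed
  have "(P has_real_derivative k x) (at x)" for x
    unfolding P_eq using G
    by (auto intro!: derivative_eq_intros simp: has_real_derivative_iff_has_vector_derivative)
  moreover have "(P \<longlongrightarrow> 0) at_top"
    using tendsto_integral_at_top[of lborel k] int zero by (simp add: P_def[abs_def])
  moreover have "(P \<longlongrightarrow> 0) at_bot"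
  proof -
    have "integrable lborel (\<lambda>y. k (- y))"
      using lborel_integrable_real_affine[OF int, of "- 1" 0] by simp
    from tendsto_integral_at_top[OF _ this]
    have "((\<lambda>x. \<integral>y. indicator {..x} y *\<^sub>R k (- y) \<partial>lborel) \<longlongrightarrow> (\<integral>y. k (- y) \<partial>lborel)) at_top"
      by simp
    moreover have "(\<integral>y. k (- y) \<partial>lborel) = 0"
      using lborel_integral_real_affine[of "- 1" k 0] zero by simp
    moreover have "(\<integral>y. indicator {..x} y *\<^sub>R k (- y) \<partial>lborel) = - P (- x)" for x
    proof -
      have "(\<integral>y. indicator {..x} y *\<^sub>R k (- y) \<partial>lborel)
          = (\<integral>y. indicator {..x} (- y) *\<^sub>R k y \<partial>lborel)"
        by (subst lborel_integral_real_affine[of "- 1" _ 0]) auto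
      also have "\<dots> = (\<integral>y. k y - indicator {..- x} y *\<^sub>R k y \<partial>lborel)"
      proof (rule integral_cong_AE)
        show "(\<lambda>y. indicator {..x} (- y) *\<^sub>R k y) \<in> borel_measurable lborel"
          using int by measurable
        show "(\<lambda>y. k y - indicator {..- x} y *\<^sub>R k y) \<in> borel_measurable lborel"
          using int by measurable
        have "AE z in lborel. z \<noteq> - x" by (rule AE_lborel_singleton)
        then show "AE y in lborel. indicator {..x} (- y) *\<^sub>R k y = k y - indicator {..- x} y *\<^sub>R k y"
          by eventually_elim (auto split: split_indicator)
      qed
      also have "\<dots> = - P (- x)"
        by (subst Bochner_Integration.integral_diff) (auto intro: ind[simplified] int simp: zero P_def)
      finally show ?thesis .
    qed
    ultimately have "((\<lambda>x. - P (- x)) \<longlongrightarrow> 0) at_top" by simp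
    then have "((\<lambda>x. P (- x)) \<longlongrightarrow> 0) at_top"
      using tendsto_minus by fastforce
    then show ?thesis
      by (simp add: at_bot_mirror filterlim_filtermap)
  qed
  ultimately show thesis by (rule that)
qed

text \<open>
  The bound on the second derivative uses the decay lemmas twice. First \<open>f\<close> solves an equation with
  linearly growing forcing, so \<open>f\<close> is bounded. Differentiating, \<open>f'\<close> solves the same equation with the
  bounded forcing \<open>f + h'\<close>, so \<open>x f'\<close> is bounded, and therefore so is \<open>f'' = x f' + f + h'\<close>.
\<close>

lemma stein_equation_solution:
  fixes h h' :: "real \<Rightarrow> real"
  assumes h': "\<And>x. (h has_real_derivative h' x) (at x)" and h'_le: "\<And>x. \<bar>h' x\<bar> \<le> 1"
  obtains f f' where "\<And>x. (f has_real_derivative f' x) (at x)"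
    "\<And>x. f' x = x * f x + (h x - (\<integral>y. std_normal_density y * h y \<partial>lborel))"
    "\<And>x. \<bar>f x\<bar> \<le> 8" "\<And>x y. \<bar>f' x - f' y\<bar> \<le> 18 * \<bar>x - y\<bar>"
proof -
  define q where "q x = h x - (\<integral>y. std_normal_density y * h y \<partial>lborel)" for x
  note lip = lipschitz_of_derivative_bound[OF h' h'_le]
  have q_le: "\<bar>q x\<bar> \<le> 1 + 1 * \<bar>x\<bar>" for x
    unfolding q_def by (rule lipschitz_minus_gaussian_mean[OF lip])
  have q': "(q has_real_derivative h' x) (at x)" for x
    unfolding q_def using h' by (auto intro!: derivative_eq_intros)
  have q_cont: "continuous_on UNIV q"
    using q' by (intro continuous_at_imp_continuous_on) (auto dest: DERIV_isCont)
  have dens: "exp (- y\<^sup>2 / 2) = sqrt (2 * pi) * std_normal_density y" for y :: real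
    by (simp add: std_normal_density_def)
  obtain P where P: "\<And>x. (P has_real_derivative q x * exp (- x\<^sup>2 / 2)) (at x)"
    "(P \<longlongrightarrow> 0) at_top" "(P \<longlongrightarrow> 0) at_bot"
  proof (rule indefinite_integral_of_zero_mean[of "\<lambda>x. q x * exp (- x\<^sup>2 / 2)"])
    have eq: "q y * exp (- y\<^sup>2 / 2) = sqrt (2 * pi) * (std_normal_density y * h y
        - (\<integral>y. std_normal_density y * h y \<partial>lborel) * std_normal_density y)" for y
      unfolding dens q_def by (simp add: algebra_simps)
    show "continuous_on UNIV (\<lambda>x. q x * exp (- x\<^sup>2 / 2))"
      by (intro continuous_intros q_cont) auto
    show "integrable lborel (\<lambda>x. q x * exp (- x\<^sup>2 / 2))"
      unfolding eq
      by (intro integrable_mult_right Bochner_Integration.integrable_diff integrable_lipschitz_gaussian[OF lip]) auto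
    show "(\<integral>x. q x * exp (- x\<^sup>2 / 2) \<partial>lborel) = 0"
      unfolding eq integral_mult_right_zero
      using integral_std_normal_moment_even[of 0]
      by (subst Bochner_Integration.integral_diff) (auto intro: integrable_lipschitz_gaussian[OF lip])
  qed blast
  define f where "f x = exp (x\<^sup>2 / 2) * P x" for x
  define f' where "f' x = x * f x + q x" for x
  have f: "(f has_real_derivative x * f x + q x) (at x)" for x
    unfolding f_def
    by (auto intro!: derivative_eq_intros P simp: algebra_simps simp flip: exp_add)
  have P_eq: "f y * exp (- y\<^sup>2 / 2) = P y" for y
    by (simp add: f_def flip: exp_add mult.assoc mult.commute[of "P y"])
  \<comment> \<open>Here \<open>8 = 4 * (1 + 1)\<close>, and \<open>9 = 8 + 1\<close> bounds the forcing of the differentiated equation below.\<close>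
  have f_bound: "\<bar>f x\<bar> \<le> 8" for x
    using gaussian_decay_global_bound[OF f _ _ q_le, of x, unfolded P_eq] P by simp
  have f': "(f' has_real_derivative x * f' x + (f x + h' x)) (at x)" for x
    unfolding f'_def by (auto intro!: derivative_eq_intros f q' simp: algebra_simps)
  have sum_le: "\<bar>f x + h' x\<bar> \<le> 9 + 0 * \<bar>x\<bar>" for x
    using f_bound[of x] h'_le[of x] by linarith
  have f'_le: "\<bar>f' x\<bar> \<le> 9 * \<bar>x\<bar> + 1" for x
  proof -
    have "\<bar>f' x\<bar> \<le> \<bar>x\<bar> * \<bar>f x\<bar> + \<bar>q x\<bar>"
      unfolding f'_def by (metis abs_mult abs_triangle_ineq)
    also have "\<dots> \<le> \<bar>x\<bar> * 8 + (1 + 1 * \<bar>x\<bar>)"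
      by (intro add_mono mult_left_mono f_bound q_le) auto
    finally show ?thesis by simp
  qed
  have lim1: "((\<lambda>x. (9 * \<bar>x\<bar> + 1) * exp (- x\<^sup>2 / 2) :: real) \<longlongrightarrow> 0) at_top"
    by real_asymp
  have lim2: "((\<lambda>x. (9 * \<bar>x\<bar> + 1) * exp (- x\<^sup>2 / 2) :: real) \<longlongrightarrow> 0) at_bot"
    by real_asymp
  have *: "\<bar>x * f' x + (f x + h' x)\<bar> \<le> 18" for x
  proof -
    have "\<bar>x * f' x\<bar> \<le> 9"
    proof (cases "x = 0")
      case False
      have "\<bar>f' x\<bar> \<le> 9 / \<bar>x\<bar> + 0"
        by (rule gaussian_decay_bound[OF f' _ _ sum_le])
          (use False in \<open>auto intro!: tendsto_0_le[where K=1, OF lim1] tendsto_0_le[where K=1, OF lim2]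
             always_eventually f'_le simp: abs_mult\<close>)
      then show ?thesis using False by (simp add: abs_mult field_simps)
    qed simp
    then show ?thesis using sum_le[of x] by linarith
  qed
  have "\<bar>f' x - f' y\<bar> \<le> 18 * \<bar>x - y\<bar>" for x y
  proof -
    have "norm (f' x - f' y) \<le> 18 * norm (x - y)"
      by (rule field_differentiable_bound[of UNIV]) (use f' * in auto)
    then show ?thesis by simp
  qed
  with f f_bound show thesis
    by (intro that[of f f']) (auto simp: f'_def q_def)
qed

text \<open>
  The average of \<open>h\<close> over \<open>[x, x + e]\<close> is differentiable with difference quotients of \<open>h\<close> as derivative.
  It reduces Lipschitz test functions to differentiable ones, for which Stein's equation can be
  differentiated.
\<close>

lemma lipschitz_smooth_approx:
  fixes h :: "real \<Rightarrow> real"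
  assumes h: "1-lipschitz_on UNIV h" and e: "0 < e"
  obtains g g' where "\<And>x. (g has_real_derivative g' x) (at x)" "\<And>x. \<bar>g' x\<bar> \<le> 1"
    "\<And>x. \<bar>g x - h x\<bar> \<le> e"
proof -
  have "isCont h x" for x
    using lipschitz_on_continuous_on[OF h] continuous_on_eq_continuous_at by blast
  then obtain G where G: "\<And>x. (G has_real_derivative h x) (at x)"
    using einterval_antiderivative[of "-\<infinity>" "\<infinity>" h]
    by (auto simp: has_real_derivative_iff_has_vector_derivative)
  define g where "g x = (G (x + e) - G x) / e" for x
  define g' where "g' x = (h (x + e) - h x) / e" for x
  have "(g has_real_derivative g' x) (at x)" for x
    unfolding g_def g'_def
    using e by (auto intro!: derivative_eq_intros DERIV_shift[THEN iffD1, OF G] G)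
  moreover have "\<bar>g' x\<bar> \<le> 1" for x
    using lipschitz_onD[OF h, of "x + e" x] e by (simp add: g'_def dist_real_def)
  moreover have "\<bar>g x - h x\<bar> \<le> e" for x
  proof -
    obtain z where z: "x < z" "z < x + e" "G (x + e) - G x = (x + e - x) * h z"
      using MVT2[of x "x + e" G h] G e by auto
    then have "g x = h z" using e by (simp add: g_def)
    then show ?thesis
      using lipschitz_onD[OF h, of z x] z by (simp add: dist_real_def)
  qed
  ultimately show thesis by (rule that)
qed

section \<open>Size biasing and normal approximation of infinitely divisible variables\<close>

lemma (in pair_sigma_finite) pair_integral_mult:
  fixes f :: "'a \<Rightarrow> real" and g :: "'b \<Rightarrow> real"
  assumes f: "integrable M1 f" and g: "integrable M2 g"
  shows "integrable (M1 \<Otimes>\<^sub>M M2) (\<lambda>z. f (fst z) * g (snd z))"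
    and "(\<integral>z. f (fst z) * g (snd z) \<partial>(M1 \<Otimes>\<^sub>M M2)) = (\<integral>x. f x \<partial>M1) * (\<integral>y. g y \<partial>M2)"
proof -
  have [measurable]: "f \<in> borel_measurable M1" "g \<in> borel_measurable M2"
    using f g by auto
  show int: "integrable (M1 \<Otimes>\<^sub>M M2) (\<lambda>z. f (fst z) * g (snd z))"
    by (rule Fubini_integrable) (use f g in \<open>auto simp: abs_mult\<close>)
  show "(\<integral>z. f (fst z) * g (snd z) \<partial>(M1 \<Otimes>\<^sub>M M2)) = (\<integral>x. f x \<partial>M1) * (\<integral>y. g y \<partial>M2)"
    unfolding integral_fst'[OF int, symmetric] by simp
qed

lemma integral_abs_le_integral:
  fixes f g :: "'a \<Rightarrow> real"
  assumes "integrable M f" "integrable M g" "\<And>x. x \<in> space M \<Longrightarrow> \<bar>f x\<bar> \<le> g x"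
  shows "\<bar>\<integral>x. f x \<partial>M\<bar> \<le> (\<integral>x. g x \<partial>M)"
proof -
  have "\<bar>\<integral>x. f x \<partial>M\<bar> \<le> (\<integral>x. \<bar>f x\<bar> \<partial>M)"
    using integral_norm_bound[of M f] by simp
  also have "\<dots> \<le> (\<integral>x. g x \<partial>M)"
    using assms by (intro integral_mono) auto
  finally show ?thesis .
qed

lemma (in prob_space) integrable_lipschitz:
  fixes h :: "real \<Rightarrow> real"
  assumes h: "1-lipschitz_on UNIV h" and F: "integrable M F"
  shows "integrable M (\<lambda>\<omega>. h (F \<omega>))"
proof (rule Bochner_Integration.integrable_bound)
  note [measurable] = lipschitz_measurable[OF h] borel_measurable_integrable[OF F]
  show "(\<lambda>\<omega>. h (F \<omega>)) \<in> borel_measurable M" by measurable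
  show "integrable M (\<lambda>\<omega>. \<bar>h 0\<bar> + \<bar>F \<omega>\<bar>)"
    using F by (intro Bochner_Integration.integrable_add integrable_abs) auto
  show "AE \<omega> in M. norm (h (F \<omega>)) \<le> norm (\<bar>h 0\<bar> + \<bar>F \<omega>\<bar>)"
    using lipschitz_linear_growth[OF h] by simp
qed

lemma one_minus_exp_bounds:
  fixes x :: real
  assumes "0 \<le> x"
  shows "0 \<le> 1 - exp (- x)" "1 - exp (- x) \<le> x"
  using assms exp_ge_add_one_self[of "- x"] by auto

text \<open>
  Differentiation under the integral; the difference quotients are dominated by \<open>w\<close>. The exponents are
  kept positive so that this bound is available.
\<close>

lemma laplace_exponent_derivative:
  fixes w :: "'a \<Rightarrow> real"
  assumes w: "integrable N w" and nonneg: "\<And>x. 0 \<le> w x" and "0 < u"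
  shows "((\<lambda>u. \<integral>x. 1 - exp (- (u * w x)) \<partial>N) has_real_derivative (\<integral>x. w x * exp (- (u * w x)) \<partial>N)) (at u)"
proof -
  have [measurable]: "w \<in> borel_measurable N" using w by auto
  have int: "integrable N (\<lambda>x. 1 - exp (- (v * w x)))" if "0 < v" for v
  proof (rule Bochner_Integration.integrable_bound)
    show "integrable N (\<lambda>x. v * w x)" using w by simp
    show "AE x in N. norm (1 - exp (- (v * w x))) \<le> norm (v * w x)"
      using one_minus_exp_bounds[of "v * w x" for x] nonneg that by simp
  qed measurable
  have "((\<lambda>v. ((\<integral>x. 1 - exp (- (v * w x)) \<partial>N) - (\<integral>x. 1 - exp (- (u * w x)) \<partial>N)) / (v - u))
      \<longlongrightarrow> (\<integral>x. w x * exp (- (u * w x)) \<partial>N)) (at u within {0<..})"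
    unfolding tendsto_at_iff_sequentially comp_def
  proof (intro allI impI)
    fix v :: "nat \<Rightarrow> real" assume v: "\<forall>i. v i \<in> {0<..} - {u}" "v \<longlonglongrightarrow> u"
    define d where "d i x = ((1 - exp (- (v i * w x))) - (1 - exp (- (u * w x)))) / (v i - u)" for i x
    have "(\<lambda>i. \<integral>x. d i x \<partial>N) \<longlonglongrightarrow> (\<integral>x. w x * exp (- (u * w x)) \<partial>N)"
    proof (rule integral_dominated_convergence[OF _ _ w])
      show "(\<lambda>x. w x * exp (- (u * w x))) \<in> borel_measurable N" by measurable
      show "d i \<in> borel_measurable N" for i unfolding d_def by measurable
      have "(\<lambda>i. d i x) \<longlonglongrightarrow> w x * exp (- (u * w x))" for x
      proof -
        have "((\<lambda>v. 1 - exp (- (v * w x))) has_real_derivative w x * exp (- (u * w x))) (at u)"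
          by (auto intro!: derivative_eq_intros)
        then have "((\<lambda>v. ((1 - exp (- (v * w x))) - (1 - exp (- (u * w x)))) / (v - u))
            \<longlongrightarrow> w x * exp (- (u * w x))) (at u)"
          by (simp add: has_field_derivative_iff)
        then show ?thesis
          using v unfolding tendsto_at_iff_sequentially comp_def d_def by auto
      qed
      then show "AE x in N. (\<lambda>i. d i x) \<longlonglongrightarrow> w x * exp (- (u * w x))" by simp
      have "norm (d i x) \<le> w x" for i x
      proof -
        have "norm ((1 - exp (- (v i * w x))) - (1 - exp (- (u * w x)))) \<le> w x * norm (v i - u)"
        proof (rule field_differentiable_bound[of "{0<..}"])
          show "((\<lambda>v. 1 - exp (- (v * w x))) has_field_derivative w x * exp (- (z * w x))) (at z within {0<..})" for z
            by (auto intro!: derivative_eq_intros)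
          show "norm (w x * exp (- (z * w x))) \<le> w x" if "z \<in> {0<..}" for z
            using that nonneg[of x] by (auto simp: abs_mult intro: mult_left_le)
        qed (use v \<open>0 < u\<close> in auto)
        then show ?thesis
          using v by (auto simp: d_def divide_le_eq)
      qed
      then show "AE x in N. norm (d i x) \<le> w x" for i by simp
    qed
    also have "(\<lambda>i. \<integral>x. d i x \<partial>N)
        = (\<lambda>i. ((\<integral>x. 1 - exp (- (v i * w x)) \<partial>N) - (\<integral>x. 1 - exp (- (u * w x)) \<partial>N)) / (v i - u))"
      unfolding d_def integral_divide_zero using v \<open>0 < u\<close>
      by (intro ext, subst Bochner_Integration.integral_diff) (auto intro!: int)
    finally show "\<dots> \<longlonglongrightarrow> (\<integral>x. w x * exp (- (u * w x)) \<partial>N)" .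
  qed
  then show ?thesis
    using at_within_open[of u "{0<..}"] \<open>0 < u\<close> by (simp add: has_field_derivative_iff)
qed

text \<open>
  Uniqueness of Laplace transforms in the form needed for size biasing, for the measures \<open>v\<^sub>i dN\<^sub>i\<close>
  transported by \<open>Y\<^sub>i\<close>. In the variable \<open>p = exp (- Y) \<in> (0, 1]\<close> the hypothesis says that all moments of
  positive order agree, so by the Weierstrass theorem \<open>p\<close> times any continuous function of \<open>p\<close> has the
  same integral on both sides. A function \<open>f(Y) = f(- ln p)\<close> need not extend continuously to \<open>p = 0\<close>, and is
  therefore cut off near \<open>0\<close>.
\<close>

lemma laplace_transform_determines_integrals:
  fixes v1 Y1 :: "'a \<Rightarrow> real" and v2 Y2 :: "'b \<Rightarrow> real" and f :: "real \<Rightarrow> real"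
  assumes v1: "integrable N1 v1" "\<And>x. 0 \<le> v1 x" and v2: "integrable N2 v2" "\<And>x. 0 \<le> v2 x"
    and Y1: "Y1 \<in> borel_measurable N1" "\<And>x. 0 \<le> Y1 x"
    and Y2: "Y2 \<in> borel_measurable N2" "\<And>x. 0 \<le> Y2 x"
    and laplace: "\<And>k. (\<integral>x. v1 x * exp (- (real (Suc k) * Y1 x)) \<partial>N1)
        = (\<integral>x. v2 x * exp (- (real (Suc k) * Y2 x)) \<partial>N2)"
    and f: "continuous_on UNIV f" "\<And>y. \<bar>f y\<bar> \<le> B"
  shows "(\<integral>x. v1 x * f (Y1 x) \<partial>N1) = (\<integral>x. v2 x * f (Y2 x) \<partial>N2)"
proof -
  have [measurable]: "v1 \<in> borel_measurable N1" "v2 \<in> borel_measurable N2"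
    "Y1 \<in> borel_measurable N1" "Y2 \<in> borel_measurable N2" "f \<in> borel_measurable borel"
    using v1 v2 Y1 Y2 f by (auto intro: borel_measurable_continuous_onI)
  have int: "integrable N (\<lambda>x. v x * h (Y x))"
    if "integrable N v" "Y \<in> borel_measurable N" "\<And>x. 0 \<le> Y x"
      "h \<in> borel_measurable borel" "\<And>y. 0 \<le> y \<Longrightarrow> \<bar>h y\<bar> \<le> c"
    for N :: "'c measure" and v Y :: "'c \<Rightarrow> real" and h :: "real \<Rightarrow> real" and c
  proof (rule Bochner_Integration.integrable_bound[of _ "\<lambda>x. c * v x"])
    have [measurable]: "v \<in> borel_measurable N" "Y \<in> borel_measurable N" "h \<in> borel_measurable borel"
      using that by auto
    show "(\<lambda>x. v x * h (Y x)) \<in> borel_measurable N" by measurable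
    have "\<bar>v x\<bar> * \<bar>h (Y x)\<bar> \<le> \<bar>v x\<bar> * \<bar>c\<bar>" for x
      using that(5)[OF that(3)[of x]] by (intro mult_left_mono) auto
    then show "AE x in N. norm (v x * h (Y x)) \<le> norm (c * v x)"
      by (simp add: abs_mult mult.commute)
  qed (use that in simp)
  have poly: "(\<integral>x. v1 x * (exp (- Y1 x) * p (exp (- Y1 x))) \<partial>N1)
      = (\<integral>x. v2 x * (exp (- Y2 x) * p (exp (- Y2 x))) \<partial>N2)"
    if "real_polynomial_function p" for p :: "real \<Rightarrow> real"
  proof -
    obtain a n where p: "p = (\<lambda>x. \<Sum>i\<le>n. a i * x ^ i)"
      using \<open>real_polynomial_function p\<close> by (auto simp: real_polynomial_function_iff_sum)
    have eq: "v x * (exp (- Y x) * p (exp (- Y x)))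
        = (\<Sum>i\<le>n. a i * (v x * exp (- (real (Suc i) * Y x))))" for v Y :: "'c \<Rightarrow> real" and x
      unfolding p sum_distrib_left
    proof (intro sum.cong refl)
      fix i
      have "exp (- Y x) * exp (- Y x) ^ i = exp (- (real (Suc i) * Y x))"
        by (simp add: algebra_simps flip: exp_of_nat_mult exp_add)
      then show "v x * (exp (- Y x) * (a i * exp (- Y x) ^ i))
          = a i * (v x * exp (- (real (Suc i) * Y x)))"
        by (metis mult.assoc mult.left_commute)
    qed
    have int_exp: "integrable N (\<lambda>x. v x * exp (- (real (Suc i) * Y x)))"
      if "integrable N v" "Y \<in> borel_measurable N" "\<And>x. 0 \<le> Y x"
      for N :: "'c measure" and v Y :: "'c \<Rightarrow> real" and i
      by (rule int[of N v Y "\<lambda>y. exp (- (real (Suc i) * y))" 1])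
        (use that in \<open>auto intro!: mult_nonneg_nonneg simp del: of_nat_Suc\<close>)
    have "(\<integral>x. v1 x * (exp (- Y1 x) * p (exp (- Y1 x))) \<partial>N1)
        = (\<Sum>i\<le>n. a i * (\<integral>x. v1 x * exp (- (real (Suc i) * Y1 x)) \<partial>N1))"
      unfolding eq
      by (subst Bochner_Integration.integral_sum)
        (auto intro!: integrable_mult_right int_exp v1 Y1 simp del: of_nat_Suc)
    also have "\<dots> = (\<Sum>i\<le>n. a i * (\<integral>x. v2 x * exp (- (real (Suc i) * Y2 x)) \<partial>N2))"
      unfolding laplace ..
    also have "\<dots> = (\<integral>x. v2 x * (exp (- Y2 x) * p (exp (- Y2 x))) \<partial>N2)"
      unfolding eq
      by (subst Bochner_Integration.integral_sum)
        (auto intro!: integrable_mult_right int_exp v2 Y2 simp del: of_nat_Suc)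
    finally show ?thesis .
  qed
  have cont: "(\<integral>x. v1 x * (exp (- Y1 x) * g (exp (- Y1 x))) \<partial>N1)
      = (\<integral>x. v2 x * (exp (- Y2 x) * g (exp (- Y2 x))) \<partial>N2)"
    if g: "continuous_on UNIV g" for g :: "real \<Rightarrow> real"
  proof (rule ccontr)
    define I1 where "I1 g = (\<integral>x. v1 x * (exp (- Y1 x) * g (exp (- Y1 x))) \<partial>N1)" for g
    define I2 where "I2 g = (\<integral>x. v2 x * (exp (- Y2 x) * g (exp (- Y2 x))) \<partial>N2)" for g
    define V where "V = (\<integral>x. v1 x \<partial>N1) + (\<integral>x. v2 x \<partial>N2)"
    assume "\<not> ?thesis"
    then have neq: "\<bar>I1 g - I2 g\<bar> > 0" by (simp add: I1_def I2_def)
    have V: "0 \<le> V" unfolding V_def using v1 v2 by (intro add_nonneg_nonneg integral_nonneg) auto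
    define e where "e = \<bar>I1 g - I2 g\<bar> / (V + 1)"
    have e: "0 < e" using neq V by (simp add: e_def)
    obtain p where p: "real_polynomial_function p" "\<And>x. x \<in> {0..1} \<Longrightarrow> \<bar>g x - p x\<bar> < e"
      using Stone_Weierstrass_real_polynomial_function[of "{0..1}" g e] e g
      by (metis compact_Icc continuous_on_subset subset_UNIV)
    have meas: "h \<in> borel_measurable borel" if "continuous_on UNIV h" for h :: "real \<Rightarrow> real"
      using that by (rule borel_measurable_continuous_onI)
    have pc: "continuous_on UNIV p"
      using p(1) by (simp add: continuous_on_polymonial_function real_polynomial_function_eq)
    have close: "\<bar>(\<integral>x. v x * (exp (- Y x) * g (exp (- Y x))) \<partial>N)
        - (\<integral>x. v x * (exp (- Y x) * p (exp (- Y x))) \<partial>N)\<bar> \<le> e * (\<integral>x. v x \<partial>N)"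
      if v: "integrable N v" "\<And>x. 0 \<le> v x" and Y: "Y \<in> borel_measurable N" "\<And>x. 0 \<le> Y x"
      for N :: "'c measure" and v Y :: "'c \<Rightarrow> real"
    proof -
      have i: "integrable N (\<lambda>x. v x * (exp (- Y x) * h (exp (- Y x))))" if h: "continuous_on UNIV h" for h
      proof -
        obtain c where c: "\<forall>y\<in>h ` {0..1}. norm y \<le> c"
          using compact_imp_bounded[OF compact_continuous_image[OF continuous_on_subset[OF h subset_UNIV] compact_Icc[of 0 1]]]
          unfolding bounded_iff by blast
        have "\<bar>exp (- y) * h (exp (- y))\<bar> \<le> 1 * c" if "0 \<le> y" for y
          unfolding abs_mult using c that by (intro mult_mono) auto
        then show ?thesis
          using meas[OF h] by (intro int[of N v Y "\<lambda>y. exp (- y) * h (exp (- y))" c] v Y) auto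
      qed
      have "\<bar>(\<integral>x. v x * (exp (- Y x) * g (exp (- Y x))) - v x * (exp (- Y x) * p (exp (- Y x))) \<partial>N)\<bar>
          \<le> (\<integral>x. e * v x \<partial>N)"
      proof (rule integral_abs_le_integral)
        show "integrable N (\<lambda>x. v x * (exp (- Y x) * g (exp (- Y x))) - v x * (exp (- Y x) * p (exp (- Y x))))"
          by (intro Bochner_Integration.integrable_diff i g pc)
        show "integrable N (\<lambda>x. e * v x)" using v by simp
        fix x
        have "\<bar>exp (- Y x) * (g (exp (- Y x)) - p (exp (- Y x)))\<bar> \<le> 1 * e"
          unfolding abs_mult using p(2)[of "exp (- Y x)"] Y(2)[of x] by (intro mult_mono) auto
        then have "v x * \<bar>exp (- Y x) * (g (exp (- Y x)) - p (exp (- Y x)))\<bar> \<le> v x * (1 * e)"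
          using v(2) by (rule mult_left_mono)
        moreover have "v x * (exp (- Y x) * g (exp (- Y x))) - v x * (exp (- Y x) * p (exp (- Y x)))
            = v x * (exp (- Y x) * (g (exp (- Y x)) - p (exp (- Y x))))"
          by (simp add: algebra_simps)
        ultimately show "\<bar>v x * (exp (- Y x) * g (exp (- Y x))) - v x * (exp (- Y x) * p (exp (- Y x)))\<bar> \<le> e * v x"
          using v(2)[of x] by (simp add: abs_mult mult.commute)
      qed
      then show ?thesis by (simp add: i[OF g] i[OF pc])
    qed
    have "\<bar>I1 g - I1 p\<bar> \<le> e * (\<integral>x. v1 x \<partial>N1)" "\<bar>I2 g - I2 p\<bar> \<le> e * (\<integral>x. v2 x \<partial>N2)"
      unfolding I1_def I2_def by (intro close v1 v2 Y1 Y2)+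
    moreover have "I1 p = I2 p"
      unfolding I1_def I2_def by (rule poly[OF p(1)])
    ultimately have "\<bar>I1 g - I2 g\<bar> \<le> e * V"
      by (simp add: V_def distrib_left)
    also have "e * V < e * (V + 1)" using e by simp
    also have "\<dots> = \<bar>I1 g - I2 g\<bar>" using V by (simp add: e_def)
    finally show False by simp
  qed
  \<comment> \<open>\<open>g n\<close> represents \<open>f Y * cut n p\<close> as \<open>p\<close> times a continuous function of \<open>p\<close>. The truncation \<open>c\<close> only changes \<open>p\<close> where \<open>cut\<close> vanishes.\<close>
  define c where "c n p = max (1 / real (Suc n)) p" for n p
  define cut where "cut n p = max 0 (min 1 (real (Suc n) * p - 1))" for n p
  define g where "g n p = f (- ln (c n p)) / c n p * cut n p" for n p
  have c_pos: "0 < c n p" for n p by (simp add: c_def less_max_iff_disj)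
  have g_cont: "continuous_on UNIV (g n)" for n
    unfolding g_def
  proof (intro continuous_intros continuous_on_compose2[OF f(1)])
    show "continuous_on UNIV (c n)" unfolding c_def by (intro continuous_intros)
    then show "continuous_on UNIV (\<lambda>p. c n p)" .
    show "continuous_on UNIV (cut n)" unfolding cut_def by (intro continuous_intros)
  qed (use c_pos in \<open>auto simp: less_imp_neq[THEN not_sym]\<close>)
  have g_eq: "exp (- y) * g n (exp (- y)) = f y * cut n (exp (- y))" for n and y :: real
  proof (cases "1 / real (Suc n) \<le> exp (- y)")
    case True
    then have "c n (exp (- y)) = exp (- y)" by (simp add: c_def)
    then show ?thesis by (simp add: g_def)
  next
    case False
    then have "cut n (exp (- y)) = 0" by (simp add: cut_def field_simps)
    then show ?thesis by (simp add: g_def)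
  qed
  have cut_lim: "(\<lambda>n. cut n p) \<longlonglongrightarrow> 1" if "0 < p" for p
  proof (rule tendsto_eventually)
    obtain k :: nat where k: "2 / p < real k" using reals_Archimedean2 by blast
    have "cut n p = 1" if "k \<le> n" for n
    proof -
      have "2 / p < real (Suc n)" using k that by linarith
      then have "2 \<le> real (Suc n) * p" using \<open>0 < p\<close> by (simp add: field_simps)
      then show ?thesis by (simp add: cut_def)
    qed
    then show "\<forall>\<^sub>F n in sequentially. cut n p = 1"
      by (auto simp: eventually_sequentially)
  qed
  have lim: "(\<lambda>n. \<integral>x. v x * (exp (- Y x) * g n (exp (- Y x))) \<partial>N) \<longlonglongrightarrow> (\<integral>x. v x * f (Y x) \<partial>N)"
    if v: "integrable N v" and Y: "Y \<in> borel_measurable N"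
    for N :: "'c measure" and v Y :: "'c \<Rightarrow> real"
  proof (rule integral_dominated_convergence[where w="\<lambda>x. norm (B * v x)"])
    have [measurable]: "v \<in> borel_measurable N" "Y \<in> borel_measurable N" "g n \<in> borel_measurable borel" for n
      using v Y g_cont by (auto intro: borel_measurable_continuous_onI)
    show "(\<lambda>x. v x * f (Y x)) \<in> borel_measurable N" by measurable
    show "(\<lambda>x. v x * (exp (- Y x) * g n (exp (- Y x)))) \<in> borel_measurable N" for n by measurable
    show "integrable N (\<lambda>x. norm (B * v x))" using v by (intro integrable_norm) simp
    have "(\<lambda>n. v x * (f (Y x) * cut n (exp (- Y x)))) \<longlonglongrightarrow> v x * (f (Y x) * 1)" for x
      by (intro tendsto_intros cut_lim) simp
    then show "AE x in N. (\<lambda>n. v x * (exp (- Y x) * g n (exp (- Y x)))) \<longlonglongrightarrow> v x * f (Y x)"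
      by (simp add: g_eq)
    have "\<bar>f y * cut n p\<bar> \<le> \<bar>B\<bar> * 1" for n y p
      unfolding abs_mult using f(2)[of y] by (intro mult_mono) (auto simp: cut_def)
    then have "\<bar>v x\<bar> * \<bar>f (Y x) * cut n (exp (- Y x))\<bar> \<le> \<bar>v x\<bar> * \<bar>B\<bar>" for n x
      by (intro mult_left_mono) (auto simp: mult.commute)
    then show "AE x in N. norm (v x * (exp (- Y x) * g n (exp (- Y x)))) \<le> norm (B * v x)" for n
      by (simp add: g_eq abs_mult mult.commute)
  qed
  show ?thesis
    using LIMSEQ_unique[OF lim[OF v1(1) Y1(1)]] lim[OF v2(1) Y2(1)] cont[OF g_cont] by simp
qed

text \<open>
  A nonnegative random variable without drift whose Levy measure is, off \<open>0\<close>, the image of \<open>Q\<close> under \<open>w\<close>. Keeping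
  \<open>Q\<close> and \<open>w\<close> apart avoids a Levy measure on the half-line, which may be infinite near \<open>0\<close>.
\<close>

locale infinitely_divisible_variable = prob_space M + Q: sigma_finite_measure Q
  for M :: "'w measure" and Q :: "'q measure" +
  fixes A :: "'w \<Rightarrow> real" and w :: "'q \<Rightarrow> real"
  assumes A_nonneg: "\<And>\<omega>. 0 \<le> A \<omega>" and A_square: "integrable M (\<lambda>\<omega>. (A \<omega>)\<^sup>2)"
    and A_measurable: "A \<in> borel_measurable M"
    and w_nonneg: "\<And>q. 0 \<le> w q" and w_integrable: "integrable Q w"
    and w_square: "integrable Q (\<lambda>q. (w q)\<^sup>2)" and w_cube: "integrable Q (\<lambda>q. (w q) ^ 3)"
    and laplace: "\<And>u. 0 < u \<Longrightarrow>
      (\<integral>\<omega>. exp (- (u * A \<omega>)) \<partial>M) = exp (- (\<integral>q. 1 - exp (- (u * w q)) \<partial>Q))"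
begin

sublocale MQ: pair_sigma_finite M Q ..

lemma A_integrable: "integrable M A"
  using A_measurable A_square by (rule square_integrable_imp_integrable)

lemma measurable_A_w [measurable]: "A \<in> borel_measurable M" "w \<in> borel_measurable Q"
  using A_measurable w_integrable by auto

lemma MQ_integrable_w: "integrable (M \<Otimes>\<^sub>M Q) (\<lambda>z. w (snd z))"
  using MQ.pair_integral_mult(1)[of "\<lambda>_. 1" w] w_integrable by simp

text \<open>
  The derivative in \<open>u\<close> of both sides of the Laplace identity. On the right it produces the product of
  \<open>E exp (- u A)\<close> and \<open>\<integral> w exp (- u w) dQ\<close>, which is an integral over \<open>M \<Otimes> Q\<close>.
\<close>

lemma size_bias_laplace:
  assumes "0 < u"
  shows "(\<integral>\<omega>. A \<omega> * exp (- (u * A \<omega>)) \<partial>M)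
    = (\<integral>z. w (snd z) * exp (- (u * (A (fst z) + w (snd z)))) \<partial>(M \<Otimes>\<^sub>M Q))"
proof -
  have int: "integrable M (\<lambda>\<omega>. exp (- (v * A \<omega>)))" if "0 < v" for v
    by (rule integrable_const_bound[where B=1]) (use that A_nonneg in \<open>auto intro!: mult_nonneg_nonneg\<close>)
  have "((\<lambda>u. 1 - (\<integral>\<omega>. 1 - exp (- (u * A \<omega>)) \<partial>M)) has_real_derivative
      - (\<integral>\<omega>. A \<omega> * exp (- (u * A \<omega>)) \<partial>M)) (at u)"
    using laplace_exponent_derivative[OF A_integrable A_nonneg assms]
    by (auto intro!: derivative_eq_intros)
  moreover have "1 - (\<integral>\<omega>. 1 - exp (- (v * A \<omega>)) \<partial>M) = exp (- (\<integral>q. 1 - exp (- (v * w q)) \<partial>Q))"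
    if "0 < v" for v
    using laplace[OF that] int[OF that] by (simp add: prob_space)
  then have "\<forall>\<^sub>F v in nhds u. 1 - (\<integral>\<omega>. 1 - exp (- (v * A \<omega>)) \<partial>M)
      = exp (- (\<integral>q. 1 - exp (- (v * w q)) \<partial>Q))"
    using assms by (auto simp: eventually_nhds intro!: exI[of _ "{0<..}"])
  ultimately have 1: "((\<lambda>u. exp (- (\<integral>q. 1 - exp (- (u * w q)) \<partial>Q))) has_real_derivative
      - (\<integral>\<omega>. A \<omega> * exp (- (u * A \<omega>)) \<partial>M)) (at u)"
    by (subst (asm) DERIV_cong_ev) auto
  have 2: "((\<lambda>u. exp (- (\<integral>q. 1 - exp (- (u * w q)) \<partial>Q))) has_real_derivative
      - (exp (- (\<integral>q. 1 - exp (- (u * w q)) \<partial>Q)) * (\<integral>q. w q * exp (- (u * w q)) \<partial>Q))) (at u)"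
    using laplace_exponent_derivative[OF w_integrable w_nonneg assms]
    by (auto intro!: derivative_eq_intros)
  have wint: "integrable Q (\<lambda>q. w q * exp (- (u * w q)))"
    by (rule Bochner_Integration.integrable_bound[OF w_integrable])
      (use assms w_nonneg in \<open>auto simp: abs_mult intro!: mult_left_le mult_nonneg_nonneg\<close>)
  have "(\<integral>\<omega>. A \<omega> * exp (- (u * A \<omega>)) \<partial>M)
      = (\<integral>\<omega>. exp (- (u * A \<omega>)) \<partial>M) * (\<integral>q. w q * exp (- (u * w q)) \<partial>Q)"
    using DERIV_unique[OF 1 2] by (simp add: laplace assms)
  also have "\<dots> = (\<integral>z. exp (- (u * A (fst z))) * (w (snd z) * exp (- (u * w (snd z)))) \<partial>(M \<Otimes>\<^sub>M Q))"
    by (rule MQ.pair_integral_mult(2)[OF int[OF assms] wint, symmetric])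
  also have "\<dots> = (\<integral>z. w (snd z) * exp (- (u * (A (fst z) + w (snd z)))) \<partial>(M \<Otimes>\<^sub>M Q))"
    by (intro Bochner_Integration.integral_cong refl) (simp add: algebra_simps exp_add[symmetric])
  finally show ?thesis .
qed

text \<open>
  Uniqueness of Laplace transforms extends the previous identity from exponentials to bounded continuous
  functions. For integrals against a Poisson random measure this is Mecke's formula.
\<close>

lemma size_bias:
  assumes "continuous_on UNIV f" "\<And>y. \<bar>f y\<bar> \<le> B"
  shows "(\<integral>\<omega>. A \<omega> * f (A \<omega>) \<partial>M) = (\<integral>z. w (snd z) * f (A (fst z) + w (snd z)) \<partial>(M \<Otimes>\<^sub>M Q))"
proof (rule laplace_transform_determines_integrals[OF A_integrable A_nonneg MQ_integrable_w w_nonneg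
      A_measurable A_nonneg _ _ _ assms])
  show "(\<integral>\<omega>. A \<omega> * exp (- (real (Suc k) * A \<omega>)) \<partial>M)
      = (\<integral>z. w (snd z) * exp (- (real (Suc k) * (A (fst z) + w (snd z)))) \<partial>(M \<Otimes>\<^sub>M Q))" for k
    by (rule size_bias_laplace) simp
qed (use A_nonneg w_nonneg in auto)

lemma mean_eq_integral: "expectation A = (\<integral>q. w q \<partial>Q)"
proof -
  have "expectation A = (\<integral>z. w (snd z) \<partial>(M \<Otimes>\<^sub>M Q))"
    using size_bias[of "\<lambda>_. 1" 1] by simp
  then show ?thesis
    using MQ.pair_integral_mult(2)[of "\<lambda>_. 1" w] w_integrable by (simp add: prob_space)
qed

text \<open>
  The size-bias identity for \<open>f(x) = x\<close>, approximated by bounded truncations, reads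
  \<open>E A\<^sup>2 = E A \<integral> w dQ + \<integral> w\<^sup>2 dQ\<close>.
\<close>

lemma variance_eq_integral_square: "variance A = (\<integral>q. (w q)\<^sup>2 \<partial>Q)"
proof -
  have int1: "integrable (M \<Otimes>\<^sub>M Q) (\<lambda>z. w (snd z) * A (fst z))"
    and eq1: "(\<integral>z. w (snd z) * A (fst z) \<partial>(M \<Otimes>\<^sub>M Q)) = expectation A * (\<integral>q. w q \<partial>Q)"
    using MQ.pair_integral_mult[OF A_integrable w_integrable] by (simp_all add: mult.commute)
  have int2: "integrable (M \<Otimes>\<^sub>M Q) (\<lambda>z. (w (snd z))\<^sup>2)"
    and eq2: "(\<integral>z. (w (snd z))\<^sup>2 \<partial>(M \<Otimes>\<^sub>M Q)) = (\<integral>q. (w q)\<^sup>2 \<partial>Q)"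
    using MQ.pair_integral_mult[of "\<lambda>_. 1" "\<lambda>q. (w q)\<^sup>2"] w_square by (simp_all add: prob_space)
  have int: "integrable (M \<Otimes>\<^sub>M Q) (\<lambda>z. w (snd z) * (A (fst z) + w (snd z)))"
    using Bochner_Integration.integrable_add[OF int1 int2] by (simp add: algebra_simps power2_eq_square)
  \<comment> \<open>Size biasing is available for bounded test functions only.\<close>
  define t where "t n x = max (- real n) (min (real n) x)" for n and x :: real
  have t_lim: "(\<lambda>n. t n x) \<longlonglongrightarrow> x" for x
  proof (rule tendsto_eventually)
    obtain k :: nat where k: "\<bar>x\<bar> < real k" using reals_Archimedean2 by blast
    have "t n x = x" if "k \<le> n" for n
      using k that by (auto simp: t_def min_def max_def)
    then show "\<forall>\<^sub>F n in sequentially. t n x = x" by (auto simp: eventually_sequentially)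
  qed
  have t_le: "\<bar>t n x\<bar> \<le> \<bar>x\<bar>" for n x by (auto simp: t_def min_def max_def)
  have t_cont: "continuous_on UNIV (t n)" for n unfolding t_def by (intro continuous_intros)
  have [measurable]: "t n \<in> borel_measurable borel" for n
    using t_cont by (rule borel_measurable_continuous_onI)
  have t_mult: "v * t n x \<le> v * x" "\<bar>v * t n x\<bar> \<le> v * x" if "0 \<le> v" "0 \<le> x" for v x n
    using that t_le[of n x] by (auto simp: abs_mult intro: mult_left_mono)
  have lim1: "(\<lambda>n. \<integral>\<omega>. A \<omega> * t n (A \<omega>) \<partial>M) \<longlonglongrightarrow> (\<integral>\<omega>. (A \<omega>)\<^sup>2 \<partial>M)"
    by (rule integral_dominated_convergence[OF _ _ A_square])
      (auto intro!: tendsto_mult t_lim t_mult A_nonneg simp: power2_eq_square)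
  have lim2: "(\<lambda>n. \<integral>z. w (snd z) * t n (A (fst z) + w (snd z)) \<partial>(M \<Otimes>\<^sub>M Q))
      \<longlonglongrightarrow> (\<integral>z. w (snd z) * (A (fst z) + w (snd z)) \<partial>(M \<Otimes>\<^sub>M Q))"
    by (rule integral_dominated_convergence[OF _ _ int])
      (auto intro!: tendsto_mult t_lim t_mult A_nonneg w_nonneg add_nonneg_nonneg)
  have "(\<integral>\<omega>. A \<omega> * t n (A \<omega>) \<partial>M) = (\<integral>z. w (snd z) * t n (A (fst z) + w (snd z)) \<partial>(M \<Otimes>\<^sub>M Q))" for n
    by (rule size_bias[OF t_cont, of _ "real n"]) (auto simp: t_def)
  then have "(\<integral>\<omega>. (A \<omega>)\<^sup>2 \<partial>M) = (\<integral>z. w (snd z) * (A (fst z) + w (snd z)) \<partial>(M \<Otimes>\<^sub>M Q))"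
    using LIMSEQ_unique[OF lim1] lim2 by simp
  also have "\<dots> = expectation A * (\<integral>q. w q \<partial>Q) + (\<integral>q. (w q)\<^sup>2 \<partial>Q)"
    by (subst Bochner_Integration.integral_add[OF int1 int2, unfolded eq1 eq2, symmetric])
      (simp add: algebra_simps power2_eq_square)
  finally show ?thesis
    using variance_eq[OF A_integrable A_square] by (simp add: mean_eq_integral power2_eq_square)
qed

text \<open>
  By the size-bias identity and the formula for the mean,
  \<open>\<sigma> E (F f(F)) = \<integral> w E (f(F + w / \<sigma>) - f(F)) dQ\<close> for the standardized variable \<open>F\<close>. The first
  order term of the difference integrates to \<open>\<sigma> E f'(F)\<close>, because \<open>\<integral> w\<^sup>2 dQ = \<sigma>\<^sup>2\<close>; what is left is at
  most \<open>18 \<integral> w\<^sup>3 dQ / \<sigma>\<^sup>2\<close> by the Lipschitz bound on \<open>f'\<close>.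
\<close>

lemma stein_bound_smooth:
  assumes h': "\<And>x. (h has_real_derivative h' x) (at x)" and h'_le: "\<And>x. \<bar>h' x\<bar> \<le> 1"
    and \<sigma>: "0 < standard_deviation M A"
  shows "\<bar>(\<integral>\<omega>. h ((A \<omega> - expectation A) / standard_deviation M A) \<partial>M)
      - (\<integral>y. std_normal_density y * h y \<partial>lborel)\<bar>
    \<le> 18 * (\<integral>q. (w q) ^ 3 \<partial>Q) / standard_deviation M A ^ 3"
proof -
  define \<mu> where "\<mu> = expectation A"
  define \<sigma> where "\<sigma> = standard_deviation M A"
  define \<gamma> where "\<gamma> = (\<integral>y. std_normal_density y * h y \<partial>lborel)"
  define F where "F \<omega> = (A \<omega> - \<mu>) / \<sigma>" for \<omega>
  have \<sigma>_pos: "0 < \<sigma>" using \<sigma> by (simp add: \<sigma>_def)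
  have \<sigma>2: "\<sigma>\<^sup>2 = (\<integral>q. (w q)\<^sup>2 \<partial>Q)"
    using \<sigma> variance_eq_integral_square by (simp add: \<sigma>_def standard_deviation_def)
  have \<mu>_eq: "\<mu> = (\<integral>q. w q \<partial>Q)" by (simp add: \<mu>_def mean_eq_integral)
  obtain f f' where f: "\<And>x. (f has_real_derivative f' x) (at x)"
    and f'_eq: "\<And>x. f' x = x * f x + (h x - \<gamma>)"
    and f_le: "\<And>x. \<bar>f x\<bar> \<le> 8" and f'_lip: "\<And>x y. \<bar>f' x - f' y\<bar> \<le> 18 * \<bar>x - y\<bar>"
    by (rule stein_equation_solution[OF h' h'_le, folded \<gamma>_def]) (rule that)
  have f_cont: "continuous_on UNIV f"
    using f by (intro continuous_at_imp_continuous_on) (auto dest: DERIV_isCont)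
  have h_cont: "continuous_on UNIV h"
    using h' by (intro continuous_at_imp_continuous_on) (auto dest: DERIV_isCont)
  have [measurable]: "f \<in> borel_measurable borel" "h \<in> borel_measurable borel"
    using f_cont h_cont by (auto intro: borel_measurable_continuous_onI)
  have [measurable]: "f' \<in> borel_measurable borel"
    unfolding f'_eq[abs_def] by measurable
  have [measurable]: "F \<in> borel_measurable M" unfolding F_def by measurable
  have F_int: "integrable M F"
    unfolding F_def using A_integrable by auto
  have Ff_int: "integrable M (\<lambda>\<omega>. F \<omega> * f (F \<omega>))"
    by (rule Bochner_Integration.integrable_bound[of _ "\<lambda>\<omega>. F \<omega> * 8"])
      (use F_int f_le in \<open>auto simp: abs_mult intro!: mult_left_mono\<close>)
  have hF_int: "integrable M (\<lambda>\<omega>. h (F \<omega>))"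
    by (rule integrable_lipschitz[OF lipschitz_of_derivative_bound[OF h' h'_le] F_int])
  have f'F_int: "integrable M (\<lambda>\<omega>. f' (F \<omega>))"
    unfolding f'_eq using Ff_int hF_int by auto
  have stein: "(\<integral>\<omega>. f' (F \<omega>) \<partial>M) = (\<integral>\<omega>. F \<omega> * f (F \<omega>) \<partial>M) + ((\<integral>\<omega>. h (F \<omega>) \<partial>M) - \<gamma>)"
    unfolding f'_eq using Ff_int hF_int by (simp add: prob_space)
  define \<phi> where "\<phi> x = f ((x - \<mu>) / \<sigma>)" for x
  have \<phi>_le: "\<bar>\<phi> x\<bar> \<le> 8" for x unfolding \<phi>_def by (rule f_le)
  have \<phi>_cont: "continuous_on UNIV \<phi>"
    unfolding \<phi>_def by (rule continuous_on_compose2[OF f_cont]) (auto intro!: continuous_intros simp: \<sigma>_pos[THEN less_imp_neq, symmetric])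
  have [measurable]: "\<phi> \<in> borel_measurable borel"
    using \<phi>_cont by (rule borel_measurable_continuous_onI)
  have \<phi>F: "f (F \<omega>) = \<phi> (A \<omega>)" for \<omega> by (simp add: \<phi>_def F_def)
  have \<phi>A_int: "integrable M (\<lambda>\<omega>. \<phi> (A \<omega>))"
    by (rule integrable_const_bound[where B=8]) (use \<phi>_le in auto)
  have A\<phi>_int: "integrable M (\<lambda>\<omega>. A \<omega> * \<phi> (A \<omega>))"
    by (rule Bochner_Integration.integrable_bound[of _ "\<lambda>\<omega>. A \<omega> * 8"])
      (use A_integrable \<phi>_le in \<open>auto simp: abs_mult intro!: mult_left_mono\<close>)
  have i1: "integrable (M \<Otimes>\<^sub>M Q) (\<lambda>z. w (snd z) * \<phi> (A (fst z) + w (snd z)))"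
    by (rule Bochner_Integration.integrable_bound[of _ "\<lambda>z. w (snd z) * 8"])
      (use MQ_integrable_w \<phi>_le in \<open>auto simp: abs_mult intro!: mult_left_mono\<close>)
  have i2: "integrable (M \<Otimes>\<^sub>M Q) (\<lambda>z. \<phi> (A (fst z)) * w (snd z))"
    and e2: "(\<integral>z. \<phi> (A (fst z)) * w (snd z) \<partial>(M \<Otimes>\<^sub>M Q)) = (\<integral>\<omega>. \<phi> (A \<omega>) \<partial>M) * \<mu>"
    using MQ.pair_integral_mult[OF \<phi>A_int w_integrable] by (simp_all add: \<mu>_eq)
  have i3: "integrable (M \<Otimes>\<^sub>M Q) (\<lambda>z. f' (F (fst z)) * (w (snd z))\<^sup>2)"
    and e3: "(\<integral>z. f' (F (fst z)) * (w (snd z))\<^sup>2 \<partial>(M \<Otimes>\<^sub>M Q)) = (\<integral>\<omega>. f' (F \<omega>) \<partial>M) * \<sigma>\<^sup>2"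
    using MQ.pair_integral_mult[OF f'F_int w_square] by (simp_all add: \<sigma>2)
  have i4: "integrable (M \<Otimes>\<^sub>M Q) (\<lambda>z. (w (snd z)) ^ 3)"
    and e4: "(\<integral>z. (w (snd z)) ^ 3 \<partial>(M \<Otimes>\<^sub>M Q)) = (\<integral>q. (w q) ^ 3 \<partial>Q)"
    using MQ.pair_integral_mult[of "\<lambda>_. 1" "\<lambda>q. (w q) ^ 3"] w_cube by (simp_all add: prob_space)
  have taylor: "\<bar>f (x + t) - f x - t * f' x\<bar> \<le> 18 * t\<^sup>2" if "0 \<le> t" for x t
  proof (cases "t = 0")
    case False
    then have "x < x + t" using that by simp
    then obtain z where z: "x < z" "z < x + t" "f (x + t) - f x = (x + t - x) * f' z"
      using MVT2[of x "x + t" f f'] f by blast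
    then have "f (x + t) - f x - t * f' x = t * (f' z - f' x)" by (simp add: algebra_simps)
    then have "\<bar>f (x + t) - f x - t * f' x\<bar> = t * \<bar>f' z - f' x\<bar>"
      using that by (simp add: abs_mult)
    also have "\<dots> \<le> t * (18 * t)"
      using f'_lip[of z x] z that by (intro mult_left_mono) auto
    finally show ?thesis by (simp add: power2_eq_square algebra_simps)
  qed simp
  have "\<sigma> * (\<integral>\<omega>. F \<omega> * f (F \<omega>) \<partial>M) = (\<integral>\<omega>. A \<omega> * \<phi> (A \<omega>) - \<mu> * \<phi> (A \<omega>) \<partial>M)"
    unfolding integral_mult_right_zero[symmetric]
    using \<sigma>_pos by (intro Bochner_Integration.integral_cong refl) (simp add: \<phi>F, simp add: F_def field_simps)
  also have "\<dots> = (\<integral>\<omega>. A \<omega> * \<phi> (A \<omega>) \<partial>M) - \<mu> * (\<integral>\<omega>. \<phi> (A \<omega>) \<partial>M)"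
    using A\<phi>_int \<phi>A_int by simp
  also have "\<dots> = (\<integral>z. w (snd z) * \<phi> (A (fst z) + w (snd z)) - \<phi> (A (fst z)) * w (snd z) \<partial>(M \<Otimes>\<^sub>M Q))"
    unfolding size_bias[OF \<phi>_cont \<phi>_le] using i1 i2 e2 by simp
  finally have Ff: "\<sigma> * (\<integral>\<omega>. F \<omega> * f (F \<omega>) \<partial>M)
    = (\<integral>z. w (snd z) * \<phi> (A (fst z) + w (snd z)) - \<phi> (A (fst z)) * w (snd z) \<partial>(M \<Otimes>\<^sub>M Q))" .
  have f'F: "\<sigma> * (\<integral>\<omega>. f' (F \<omega>) \<partial>M) = (\<integral>z. f' (F (fst z)) * (w (snd z))\<^sup>2 / \<sigma> \<partial>(M \<Otimes>\<^sub>M Q))"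
    using e3 \<sigma>_pos by (simp add: field_simps power2_eq_square)
  have "\<bar>\<sigma> * (\<integral>\<omega>. F \<omega> * f (F \<omega>) \<partial>M) - \<sigma> * (\<integral>\<omega>. f' (F \<omega>) \<partial>M)\<bar>
    = \<bar>\<integral>z. (w (snd z) * \<phi> (A (fst z) + w (snd z)) - \<phi> (A (fst z)) * w (snd z))
          - f' (F (fst z)) * (w (snd z))\<^sup>2 / \<sigma> \<partial>(M \<Otimes>\<^sub>M Q)\<bar>"
    unfolding Ff f'F using i1 i2 i3 by simp
  also have "\<dots> \<le> (\<integral>z. 18 / \<sigma>\<^sup>2 * (w (snd z)) ^ 3 \<partial>(M \<Otimes>\<^sub>M Q))"
  proof (rule integral_abs_le_integral)
    show "integrable (M \<Otimes>\<^sub>M Q) (\<lambda>z. (w (snd z) * \<phi> (A (fst z) + w (snd z)) - \<phi> (A (fst z)) * w (snd z))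
          - f' (F (fst z)) * (w (snd z))\<^sup>2 / \<sigma>)"
      using i1 i2 i3 by auto
    show "integrable (M \<Otimes>\<^sub>M Q) (\<lambda>z. 18 / \<sigma>\<^sup>2 * (w (snd z)) ^ 3)" using i4 by simp
    fix z
    define x t where "x = F (fst z)" and "t = w (snd z) / \<sigma>"
    have t: "0 \<le> t" using w_nonneg \<sigma>_pos by (simp add: t_def)
    have eq: "w (snd z) * \<phi> (A (fst z) + w (snd z)) - \<phi> (A (fst z)) * w (snd z) - f' (F (fst z)) * (w (snd z))\<^sup>2 / \<sigma>
        = w (snd z) * (f (x + t) - f x - t * f' x)"
      unfolding \<phi>_def x_def t_def F_def by (simp add: algebra_simps power2_eq_square add_divide_distrib diff_divide_distrib)
    have "\<bar>w (snd z) * (f (x + t) - f x - t * f' x)\<bar> \<le> w (snd z) * (18 * t\<^sup>2)"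
      unfolding abs_mult using taylor[OF t] w_nonneg[of "snd z"] by (simp add: mult_left_mono)
    also have "\<dots> = 18 / \<sigma>\<^sup>2 * (w (snd z)) ^ 3"
      by (simp add: t_def power_divide power2_eq_square power3_eq_cube)
    finally show "\<bar>w (snd z) * \<phi> (A (fst z) + w (snd z)) - \<phi> (A (fst z)) * w (snd z) - f' (F (fst z)) * (w (snd z))\<^sup>2 / \<sigma>\<bar>
        \<le> 18 / \<sigma>\<^sup>2 * (w (snd z)) ^ 3" unfolding eq .
  qed
  also have "\<dots> = 18 / \<sigma>\<^sup>2 * (\<integral>q. (w q) ^ 3 \<partial>Q)" by (simp add: e4)
  also have "\<bar>\<sigma> * (\<integral>\<omega>. F \<omega> * f (F \<omega>) \<partial>M) - \<sigma> * (\<integral>\<omega>. f' (F \<omega>) \<partial>M)\<bar>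
      = \<sigma> * \<bar>(\<integral>\<omega>. h (F \<omega>) \<partial>M) - \<gamma>\<bar>"
    unfolding stein using \<sigma>_pos by (simp add: abs_mult flip: right_diff_distrib)
  finally have "\<bar>(\<integral>\<omega>. h (F \<omega>) \<partial>M) - \<gamma>\<bar> \<le> 18 * (\<integral>q. (w q) ^ 3 \<partial>Q) / \<sigma> ^ 3"
    using \<sigma>_pos by (simp add: field_simps power2_eq_square power3_eq_cube)
  then show ?thesis by (simp add: F_def \<mu>_def \<sigma>_def \<gamma>_def)
qed

text \<open>
  Approximation of Lipschitz test functions by differentiable ones, with an error that is uniform on the
  line.
\<close>

lemma wasserstein_bound:
  assumes \<sigma>: "0 < standard_deviation M A"
  shows "wasserstein_dist (standardized_law M A) std_normal_distribution
    \<le> ennreal (18 * (\<integral>q. (w q) ^ 3 \<partial>Q) / standard_deviation M A ^ 3)"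
  unfolding wasserstein_dist_def
proof (rule SUP_least)
  fix h :: "real \<Rightarrow> real" assume "h \<in> {h. 1-lipschitz_on UNIV h}"
  then have h: "1-lipschitz_on UNIV h" by simp
  define F where "F \<omega> = (A \<omega> - expectation A) / standard_deviation M A" for \<omega>
  have [measurable]: "F \<in> borel_measurable M" unfolding F_def by measurable
  note [measurable] = lipschitz_measurable[OF h]
  have law: "(\<integral>x. h x \<partial>standardized_law M A) = (\<integral>\<omega>. h (F \<omega>) \<partial>M)"
    unfolding standardized_law_def F_def by (subst integral_distr) auto
  have normal: "(\<integral>x. h x \<partial>std_normal_distribution) = (\<integral>y. std_normal_density y * h y \<partial>lborel)"
    by (subst integral_density) auto
  have F_int: "integrable M F" unfolding F_def using A_integrable by auto
  note lip_int = integrable_lipschitz[OF _ F_int]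
  have "\<bar>(\<integral>\<omega>. h (F \<omega>) \<partial>M) - (\<integral>y. std_normal_density y * h y \<partial>lborel)\<bar>
      \<le> 18 * (\<integral>q. (w q) ^ 3 \<partial>Q) / standard_deviation M A ^ 3"
  proof (rule field_le_epsilon)
    fix e :: real assume "0 < e"
    then have "0 < e / 2" by simp
    from lipschitz_smooth_approx[OF h this] obtain g g' where
      g: "\<And>x. (g has_real_derivative g' x) (at x)" "\<And>x. \<bar>g' x\<bar> \<le> 1" "\<And>x. \<bar>g x - h x\<bar> \<le> e / 2"
      by blast
    note glip = lipschitz_of_derivative_bound[OF g(1,2)]
    note one = integral_std_normal_density
    have "\<bar>(\<integral>\<omega>. g (F \<omega>) - h (F \<omega>) \<partial>M)\<bar> \<le> (\<integral>\<omega>. e / 2 \<partial>M)"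
      by (rule integral_abs_le_integral) (use lip_int[OF glip] lip_int[OF h] g(3) in auto)
    then have 1: "\<bar>(\<integral>\<omega>. g (F \<omega>) \<partial>M) - (\<integral>\<omega>. h (F \<omega>) \<partial>M)\<bar> \<le> e / 2"
      using lip_int[OF glip] lip_int[OF h] by (simp add: prob_space)
    have "\<bar>(\<integral>y. std_normal_density y * g y - std_normal_density y * h y \<partial>lborel)\<bar>
        \<le> (\<integral>y. std_normal_density y * (e / 2) \<partial>lborel)"
    proof (rule integral_abs_le_integral)
      fix y
      have "std_normal_density y * \<bar>g y - h y\<bar> \<le> std_normal_density y * (e / 2)"
        using g(3) by (intro mult_left_mono) auto
      then show "\<bar>std_normal_density y * g y - std_normal_density y * h y\<bar> \<le> std_normal_density y * (e / 2)"
        by (simp add: abs_mult flip: right_diff_distrib)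
    qed (use integrable_lipschitz_gaussian[OF glip] integrable_lipschitz_gaussian[OF h] in auto)
    then have 2: "\<bar>(\<integral>y. std_normal_density y * g y \<partial>lborel) - (\<integral>y. std_normal_density y * h y \<partial>lborel)\<bar> \<le> e / 2"
      using integrable_lipschitz_gaussian[OF glip] integrable_lipschitz_gaussian[OF h] by (simp add: one)
    show "\<bar>(\<integral>\<omega>. h (F \<omega>) \<partial>M) - (\<integral>y. std_normal_density y * h y \<partial>lborel)\<bar>
        \<le> 18 * (\<integral>q. (w q) ^ 3 \<partial>Q) / standard_deviation M A ^ 3 + e"
      using 1 2 stein_bound_smooth[OF g(1,2) \<sigma>] unfolding F_def by linarith
  qed
  then show "ennreal \<bar>(\<integral>x. h x \<partial>standardized_law M A) - (\<integral>x. h x \<partial>std_normal_distribution)\<bar>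
      \<le> ennreal (18 * (\<integral>q. (w q) ^ 3 \<partial>Q) / standard_deviation M A ^ 3)"
    unfolding law normal by (rule ennreal_leI)
qed

end

section \<open>The Laplace functional of a Poisson random measure\<close>

text \<open>
  The function \<open>exp (- x)\<close> on \<open>[0, \<infinity>]\<close>. With the value \<open>0\<close> at \<open>\<infinity>\<close> it is continuous, so that
  Laplace functionals can be handled before finiteness of the sums involved is known.
\<close>

definition neg_exp :: "ennreal \<Rightarrow> real" where
  "neg_exp x = (if x = \<top> then 0 else exp (- enn2real x))"

lemma neg_exp_bounds [simp]: "0 \<le> neg_exp x" "neg_exp x \<le> 1"
  by (auto simp: neg_exp_def)

lemma neg_exp_simps [simp]: "neg_exp 0 = 1" "neg_exp \<top> = 0" "0 \<le> r \<Longrightarrow> neg_exp (ennreal r) = exp (- r)"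
  by (auto simp: neg_exp_def)

lemma neg_exp_add: "neg_exp (x + y) = neg_exp x * neg_exp y"
  by (cases x; cases y) (auto simp: neg_exp_def mult_exp_exp simp flip: ennreal_plus)

lemma neg_exp_sum: "neg_exp (sum f S) = (\<Prod>i\<in>S. neg_exp (f i))"
  by (induction S rule: infinite_finite_induct) (auto simp: neg_exp_add)

lemma neg_exp_antimono: "x \<le> y \<Longrightarrow> neg_exp y \<le> neg_exp x"
  by (cases x; cases y) (auto simp: neg_exp_def top_unique)

lemma measurable_neg_exp [measurable]: "neg_exp \<in> borel_measurable borel"
  unfolding neg_exp_def[abs_def] by measurable

lemma tendsto_neg_exp:
  assumes "(f \<longlongrightarrow> L) F"
  shows "((\<lambda>x. neg_exp (f x)) \<longlongrightarrow> neg_exp L) F"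
proof (cases L)
  case (real r)
  then have "\<forall>\<^sub>F x in F. f x < \<top>"
    using assms by (intro order_tendstoD) auto
  then have "\<forall>\<^sub>F x in F. exp (- enn2real (f x)) = neg_exp (f x)"
    by eventually_elim (auto simp: neg_exp_def)
  moreover have "((\<lambda>x. exp (- enn2real (f x))) \<longlongrightarrow> exp (- enn2real L)) F"
    using assms real by (intro tendsto_intros tendsto_enn2real) auto
  ultimately show ?thesis
    using real by (simp add: neg_exp_def tendsto_cong)
next
  case top
  show ?thesis
  proof (rule order_tendstoI)
    fix e assume e: "neg_exp L < e"
    then have "0 < e" using top by simp
    define K where "K = max 0 (1 - ln e)"
    have "\<forall>\<^sub>F x in F. ennreal K < f x"
      using assms top by (intro order_tendstoD) auto
    then show "\<forall>\<^sub>F x in F. neg_exp (f x) < e"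
    proof eventually_elim
      case (elim x)
      have "neg_exp (f x) \<le> neg_exp (ennreal K)"
        using elim by (intro neg_exp_antimono) auto
      also have "\<dots> = exp (- K)" by (rule neg_exp_simps) (simp add: K_def)
      also have "\<dots> < exp (ln e)" by (simp add: K_def)
      finally show ?case using \<open>0 < e\<close> by simp
    qed
  next
    fix e assume "e < neg_exp L"
    then have "e < 0" using top by simp
    then show "\<forall>\<^sub>F x in F. e < neg_exp (f x)"
      by (intro always_eventually allI) (meson neg_exp_bounds(1) less_le_trans)
  qed
qed

context prob_space
begin

text \<open>
  The prescribed probabilities already sum to \<open>1\<close>, which forces \<open>N\<close> to be almost surely a natural number.
\<close>

lemma poisson_count_laplace:
  assumes N[measurable]: "N \<in> borel_measurable M" and l: "0 \<le> l" and c: "c < \<top>"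
    and law: "\<And>k::nat. measure M {\<omega>\<in>space M. N \<omega> = of_nat k} = l ^ k / fact k * exp (- l)"
  shows "(\<integral>\<omega>. neg_exp (c * N \<omega>) \<partial>M) = neg_exp (ennreal (1 - neg_exp c) * ennreal l)"
proof -
  define E where "E k = {\<omega>\<in>space M. N \<omega> = of_nat k}" for k :: nat
  have E_meas [measurable]: "E k \<in> sets M" for k unfolding E_def by measurable
  have disj: "disjoint_family E"
    by (auto simp: disjoint_family_on_def E_def)
  have E_law: "emeasure M (E k) = ennreal (l ^ k / fact k * exp (- l))" for k
    unfolding E_def by (simp add: emeasure_eq_measure law)
  have sums: "(\<lambda>k. x ^ k * (l ^ k / fact k * exp (- l))) sums (exp (- ((1 - x) * l)))" for x :: real
  proof -
    have "(\<lambda>k. (x * l) ^ k /\<^sub>R fact k * exp (- l)) sums (exp (x * l) * exp (- l))"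
      by (intro sums_mult2 exp_converges)
    moreover have "exp (x * l) * exp (- l) = exp (- ((1 - x) * l))"
      by (simp add: algebra_simps flip: exp_add)
    ultimately show ?thesis
      by (simp add: power_mult_distrib field_simps)
  qed
  have "emeasure M (\<Union>k. E k) = (\<Sum>k. ennreal (l ^ k / fact k * exp (- l)))"
    using disj by (subst suminf_emeasure[symmetric]) (auto simp: E_law)
  also have "\<dots> = 1"
    using sums[of 1] l by (subst suminf_ennreal_eq) auto
  finally have "AE \<omega> in M. \<omega> \<in> (\<Union>k. E k)"
    by (intro AE_prob_1) (simp add: measure_def)
  moreover have E_val: "(\<Sum>k. ennreal (neg_exp c ^ k) * indicator (E k) \<omega>) = ennreal (neg_exp (c * N \<omega>))"
    if "\<omega> \<in> (\<Union>k. E k)" for \<omega>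
  proof -
    from that obtain j where j: "\<omega> \<in> E j" by auto
    then have "indicator (E k) \<omega> = (if k = j then 1 else 0 :: ennreal)" for k
      using disj by (auto simp: disjoint_family_on_def split: split_indicator)
    then have "(\<Sum>k. ennreal (neg_exp c ^ k) * indicator (E k) \<omega>) = ennreal (neg_exp c ^ j)"
      by (subst suminf_finite[of "{j}"]) auto
    moreover have "neg_exp c ^ j = neg_exp (c * N \<omega>)"
    proof -
      have "neg_exp (\<Sum>i<j. c) = neg_exp c ^ j" by (simp only: neg_exp_sum) simp
      then show ?thesis using j by (simp add: E_def mult.commute)
    qed
    ultimately show ?thesis by simp
  qed
  ultimately have "(\<integral>\<^sup>+\<omega>. ennreal (neg_exp (c * N \<omega>)) \<partial>M)
      = (\<integral>\<^sup>+\<omega>. (\<Sum>k. ennreal (neg_exp c ^ k) * indicator (E k) \<omega>) \<partial>M)"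
    by (intro nn_integral_cong_AE) (erule eventually_mono, simp)
  also have "\<dots> = (\<Sum>k. ennreal (neg_exp c ^ k) * ennreal (l ^ k / fact k * exp (- l)))"
    by (subst nn_integral_suminf) (auto simp: nn_integral_cmult_indicator E_law)
  also have "\<dots> = (\<Sum>k. ennreal (neg_exp c ^ k * (l ^ k / fact k * exp (- l))))"
    using l by (intro arg_cong[where f=suminf] ext ennreal_mult[symmetric]) auto
  also have "\<dots> = ennreal (exp (- ((1 - neg_exp c) * l)))"
    using l by (intro suminf_ennreal_eq sums) auto
  finally have "(\<integral>\<omega>. neg_exp (c * N \<omega>) \<partial>M) = exp (- ((1 - neg_exp c) * l))"
    by (subst integral_eq_nn_integral) auto
  then show ?thesis using l by (simp add: ennreal_mult[symmetric])
qed

text \<open>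
  For a simple function the integral is a finite combination of counts of disjoint sets, which are
  independent Poisson variables. The independence in \<open>poisson_random_measure\<close> is indexed by the sets
  themselves, whence \<open>val\<close>, which recovers the value of \<open>g\<close> from a level set.
\<close>

lemma poisson_laplace_simple:
  assumes prm: "poisson_random_measure M \<nu> \<eta>"
    and g: "simple_function \<nu> g" and fin: "\<And>x. g x < \<top>"
    and supp: "emeasure \<nu> {x\<in>space \<nu>. g x \<noteq> 0} < \<infinity>"
  shows "(\<lambda>\<omega>. \<integral>\<^sup>+x. g x \<partial>\<eta> \<omega>) \<in> borel_measurable M"
    and "(\<integral>\<omega>. neg_exp (\<integral>\<^sup>+x. g x \<partial>\<eta> \<omega>) \<partial>M) = neg_exp (\<integral>\<^sup>+x. ennreal (1 - neg_exp (g x)) \<partial>\<nu>)"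
proof -
  define S where "S = g ` space \<nu> - {0}"
  define B where "B y = g -` {y} \<inter> space \<nu>" for y
  have S: "finite S" using g by (simp add: S_def simple_function_def)
  have B_meas [measurable]: "B y \<in> sets \<nu>" for y
    using simple_functionD(2)[OF g] by (simp add: B_def)
  have B_fin: "emeasure \<nu> (B y) < \<infinity>" if "y \<in> S" for y
  proof -
    have "B y \<subseteq> {x\<in>space \<nu>. g x \<noteq> 0}" using that by (auto simp: B_def S_def)
    moreover have "{x\<in>space \<nu>. g x \<noteq> 0} \<in> sets \<nu>"
      using borel_measurable_simple_function[OF g] by measurable
    ultimately show ?thesis using supp by (meson emeasure_mono le_less_trans)
  qed
  have repr: "h (g x) = (\<Sum>y\<in>S. h y * indicator (B y) x)"
    if "h 0 = 0" "x \<in> space \<nu>" for h :: "ennreal \<Rightarrow> ennreal" and x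
  proof -
    have "(\<Sum>y\<in>S. h y * indicator (B y) x) = (\<Sum>y\<in>S. if y = g x then h y else 0)"
      using that by (intro sum.cong) (auto simp: B_def split: split_indicator)
    also have "\<dots> = h (g x)"
      using S that by (auto simp: sum.delta S_def)
    finally show ?thesis by simp
  qed
  have sets_\<eta>: "sets (\<eta> \<omega>) = sets \<nu>" if "\<omega> \<in> space M" for \<omega>
    using prm that by (simp add: poisson_random_measure_def)
  have N [measurable]: "(\<lambda>\<omega>. emeasure (\<eta> \<omega>) (B y)) \<in> borel_measurable M" for y
    using prm by (simp add: poisson_random_measure_def)
  have int_eq: "(\<integral>\<^sup>+x. g x \<partial>\<eta> \<omega>) = (\<Sum>y\<in>S. y * emeasure (\<eta> \<omega>) (B y))" if "\<omega> \<in> space M" for \<omega>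
  proof -
    note s = sets_\<eta>[OF that] sets_eq_imp_space_eq[OF sets_\<eta>[OF that]]
    have [measurable]: "B y \<in> sets (\<eta> \<omega>)" for y by (simp add: s)
    have "(\<integral>\<^sup>+x. g x \<partial>\<eta> \<omega>) = (\<integral>\<^sup>+x. (\<Sum>y\<in>S. y * indicator (B y) x) \<partial>\<eta> \<omega>)"
      using repr[of "\<lambda>y. y"] by (intro nn_integral_cong) (auto simp: s)
    also have "\<dots> = (\<Sum>y\<in>S. y * emeasure (\<eta> \<omega>) (B y))"
      by (subst nn_integral_sum) (auto simp: s nn_integral_cmult_indicator)
    finally show ?thesis .
  qed
  show "(\<lambda>\<omega>. \<integral>\<^sup>+x. g x \<partial>\<eta> \<omega>) \<in> borel_measurable M"
    by (subst measurable_cong[OF int_eq]) auto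
  have inj: "inj_on B S"
    by (auto simp: inj_on_def B_def S_def)
  define val where "val C = g (SOME x. x \<in> C)" for C
  have val: "val (B y) = y" if "y \<in> S" for y
  proof -
    have "\<exists>x. x \<in> B y" using that by (auto simp: B_def S_def)
    then have "(SOME x. x \<in> B y) \<in> B y" by (rule someI_ex)
    then show ?thesis by (simp add: val_def B_def)
  qed
  have "indep_vars (\<lambda>_. borel) (\<lambda>C \<omega>. emeasure (\<eta> \<omega>) C) (B ` S)"
  proof -
    have "B ` S \<subseteq> sets \<nu>" "finite (B ` S)" using S by auto
    moreover have "disjoint (B ` S)" by (auto simp: disjoint_def B_def)
    ultimately show ?thesis using prm unfolding poisson_random_measure_def by blast
  qed
  then have indep: "indep_vars (\<lambda>_. borel) (\<lambda>C \<omega>. neg_exp (val C * emeasure (\<eta> \<omega>) C)) (B ` S)"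
    by (rule indep_vars_compose2[where Y="\<lambda>C t. neg_exp (val C * t)"]) measurable
  have "(\<integral>\<omega>. neg_exp (\<integral>\<^sup>+x. g x \<partial>\<eta> \<omega>) \<partial>M)
      = (\<integral>\<omega>. (\<Prod>C\<in>B ` S. neg_exp (val C * emeasure (\<eta> \<omega>) C)) \<partial>M)"
    by (intro Bochner_Integration.integral_cong refl)
      (simp add: int_eq neg_exp_sum prod.reindex[OF inj] val)
  also have "\<dots> = (\<Prod>C\<in>B ` S. \<integral>\<omega>. neg_exp (val C * emeasure (\<eta> \<omega>) C) \<partial>M)"
    using S by (intro indep_vars_lebesgue_integral indep)
      (auto intro!: integrable_const_bound[where B=1])
  also have "\<dots> = (\<Prod>y\<in>S. \<integral>\<omega>. neg_exp (y * emeasure (\<eta> \<omega>) (B y)) \<partial>M)"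
    by (simp add: prod.reindex[OF inj] val)
  also have "\<dots> = (\<Prod>y\<in>S. neg_exp (ennreal (1 - neg_exp y) * emeasure \<nu> (B y)))"
  proof (rule prod.cong[OF refl])
    fix y assume y: "y \<in> S"
    have "y < \<top>" using y fin by (auto simp: S_def)
    moreover have "measure M {\<omega>\<in>space M. emeasure (\<eta> \<omega>) (B y) = of_nat k}
        = measure \<nu> (B y) ^ k / fact k * exp (- measure \<nu> (B y))" for k :: nat
      using prm B_fin[OF y] B_meas unfolding poisson_random_measure_def by blast
    moreover have "emeasure \<nu> (B y) = ennreal (measure \<nu> (B y))"
      using B_fin[OF y] by (simp add: emeasure_eq_ennreal_measure)
    ultimately show "(\<integral>\<omega>. neg_exp (y * emeasure (\<eta> \<omega>) (B y)) \<partial>M)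
        = neg_exp (ennreal (1 - neg_exp y) * emeasure \<nu> (B y))"
      using poisson_count_laplace[of "\<lambda>\<omega>. emeasure (\<eta> \<omega>) (B y)" "measure \<nu> (B y)" y] by simp
  qed
  also have "\<dots> = neg_exp (\<Sum>y\<in>S. ennreal (1 - neg_exp y) * emeasure \<nu> (B y))"
    by (simp add: neg_exp_sum)
  also have "(\<Sum>y\<in>S. ennreal (1 - neg_exp y) * emeasure \<nu> (B y)) = (\<integral>\<^sup>+x. ennreal (1 - neg_exp (g x)) \<partial>\<nu>)"
  proof -
    have "(\<integral>\<^sup>+x. ennreal (1 - neg_exp (g x)) \<partial>\<nu>)
        = (\<integral>\<^sup>+x. (\<Sum>y\<in>S. ennreal (1 - neg_exp y) * indicator (B y) x) \<partial>\<nu>)"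
      using repr[of "\<lambda>y. ennreal (1 - neg_exp y)"] by (intro nn_integral_cong) auto
    also have "\<dots> = (\<Sum>y\<in>S. ennreal (1 - neg_exp y) * emeasure \<nu> (B y))"
      by (subst nn_integral_sum) (auto simp: nn_integral_cmult_indicator)
    finally show ?thesis by simp
  qed
  finally show "(\<integral>\<omega>. neg_exp (\<integral>\<^sup>+x. g x \<partial>\<eta> \<omega>) \<partial>M) = neg_exp (\<integral>\<^sup>+x. ennreal (1 - neg_exp (g x)) \<partial>\<nu>)" .
qed

text \<open>
  Monotone limits of simple functions supported in sets of finite intensity.
\<close>

theorem poisson_laplace_functional:
  assumes prm: "poisson_random_measure M \<nu> \<eta>" and "sigma_finite_measure \<nu>"
    and g: "g \<in> borel_measurable \<nu>"
  shows "(\<lambda>\<omega>. \<integral>\<^sup>+x. g x \<partial>\<eta> \<omega>) \<in> borel_measurable M"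
    and "(\<integral>\<omega>. neg_exp (\<integral>\<^sup>+x. g x \<partial>\<eta> \<omega>) \<partial>M) = neg_exp (\<integral>\<^sup>+x. ennreal (1 - neg_exp (g x)) \<partial>\<nu>)"
proof -
  interpret \<nu>: sigma_finite_measure \<nu> by fact
  obtain C :: "nat \<Rightarrow> _" where C: "range C \<subseteq> sets \<nu>" "(\<Union>i. C i) = space \<nu>"
    "\<And>i. emeasure \<nu> (C i) \<noteq> \<infinity>" "incseq C"
    by (rule \<nu>.sigma_finite_incseq) blast
  obtain s where s: "\<And>i. simple_function \<nu> (s i)" "incseq s" "\<And>i x. s i x < \<top>"
    "\<And>x. (SUP i. s i x) = g x"
    using borel_measurable_implies_simple_function_sequence'[OF g] by blast
  define t where "t i x = s i x * indicator (C i) x" for i x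
  have [measurable]: "C i \<in> sets \<nu>" for i using C(1) by auto
  have t_simple: "simple_function \<nu> (t i)" for i
    unfolding t_def by (intro simple_function_mult s simple_function_indicator) auto
  have t_meas: "t i \<in> borel_measurable \<nu>" for i
    using t_simple by (rule borel_measurable_simple_function)
  have t_fin: "t i x < \<top>" for i x
    using s(3)[of i x] by (auto simp: t_def split: split_indicator)
  have t_supp: "emeasure \<nu> {x\<in>space \<nu>. t i x \<noteq> 0} < \<infinity>" for i
  proof -
    have "emeasure \<nu> {x\<in>space \<nu>. t i x \<noteq> 0} \<le> emeasure \<nu> (C i)"
      by (intro emeasure_mono) (auto simp: t_def split: split_indicator_asm)
    then show ?thesis using C(3)[of i] by (simp add: less_top order_le_less_trans)
  qed
  have t_inc: "incseq t"
    using s(2) C(4)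
    by (auto simp: t_def incseq_def le_fun_def split: split_indicator) (meson subsetD)
  have t_sup: "(SUP i. t i x) = g x" if x: "x \<in> space \<nu>" for x
  proof (rule antisym)
    show "(SUP i. t i x) \<le> g x"
      unfolding s(4)[of x, symmetric] t_def
      by (intro SUP_mono) (auto split: split_indicator)
    obtain k where k: "x \<in> C k" using x C(2) by blast
    have "s i x \<le> t (max i k) x" for i
    proof -
      have "x \<in> C (max i k)" using k C(4) by (meson incseqD max.cobounded2 subsetD)
      then show ?thesis using s(2) by (auto simp: t_def incseq_def le_fun_def)
    qed
    then show "g x \<le> (SUP i. t i x)"
      unfolding s(4)[of x, symmetric] by (intro SUP_least) (meson SUP_upper2 UNIV_I)
  qed
  have t_lim: "(\<lambda>i. \<integral>\<^sup>+x. t i x \<partial>\<eta> \<omega>) \<longlonglongrightarrow> (\<integral>\<^sup>+x. g x \<partial>\<eta> \<omega>)" if \<omega>: "\<omega> \<in> space M" for \<omega>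
  proof -
    have st: "sets (\<eta> \<omega>) = sets \<nu>" using prm \<omega> by (simp add: poisson_random_measure_def)
    note sp = sets_eq_imp_space_eq[OF st]
    have m: "t i \<in> borel_measurable (\<eta> \<omega>)" for i
      using t_meas measurable_cong_sets[OF st refl] by blast
    have "(\<integral>\<^sup>+x. g x \<partial>\<eta> \<omega>) = (\<integral>\<^sup>+x. (SUP i. t i x) \<partial>\<eta> \<omega>)"
      by (intro nn_integral_cong) (simp add: sp t_sup)
    also have "\<dots> = (SUP i. \<integral>\<^sup>+x. t i x \<partial>\<eta> \<omega>)"
      by (rule nn_integral_monotone_convergence_SUP[OF t_inc m])
    finally show ?thesis
      using t_inc by (auto intro!: LIMSEQ_SUP incseq_SucI nn_integral_mono simp: incseq_Suc_iff le_fun_def)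
  qed
  have t_int_meas [measurable]: "(\<lambda>\<omega>. \<integral>\<^sup>+x. t i x \<partial>\<eta> \<omega>) \<in> borel_measurable M" for i
    by (rule poisson_laplace_simple[OF prm t_simple t_fin t_supp])
  show g_int_meas [measurable]: "(\<lambda>\<omega>. \<integral>\<^sup>+x. g x \<partial>\<eta> \<omega>) \<in> borel_measurable M"
    by (rule borel_measurable_LIMSEQ_order[OF t_lim]) measurable
  have lim1: "(\<lambda>i. \<integral>\<omega>. neg_exp (\<integral>\<^sup>+x. t i x \<partial>\<eta> \<omega>) \<partial>M) \<longlonglongrightarrow> (\<integral>\<omega>. neg_exp (\<integral>\<^sup>+x. g x \<partial>\<eta> \<omega>) \<partial>M)"
  proof (rule integral_dominated_convergence[where w="\<lambda>_. 1"])
    show "(\<lambda>\<omega>. neg_exp (\<integral>\<^sup>+x. g x \<partial>\<eta> \<omega>)) \<in> borel_measurable M" by measurable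
    show "(\<lambda>\<omega>. neg_exp (\<integral>\<^sup>+x. t i x \<partial>\<eta> \<omega>)) \<in> borel_measurable M" for i by measurable
  qed (auto intro!: tendsto_neg_exp t_lim)
  have "(\<lambda>i. \<integral>\<^sup>+x. ennreal (1 - neg_exp (t i x)) \<partial>\<nu>)
      \<longlonglongrightarrow> (\<integral>\<^sup>+x. ennreal (1 - neg_exp (SUP i. t i x)) \<partial>\<nu>)"
  proof (rule nn_integral_LIMSEQ)
    show "incseq (\<lambda>i x. ennreal (1 - neg_exp (t i x)))"
      using t_inc by (auto simp: incseq_def le_fun_def intro!: ennreal_leI neg_exp_antimono)
    have [measurable]: "t i \<in> borel_measurable \<nu>" for i by (rule t_meas)
    show "(\<lambda>x. ennreal (1 - neg_exp (t i x))) \<in> borel_measurable \<nu>" for i by measurable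
    show "(\<lambda>i. ennreal (1 - neg_exp (t i x))) \<longlonglongrightarrow> ennreal (1 - neg_exp (SUP i. t i x))" for x
    proof -
      have "(\<lambda>i. t i x) \<longlonglongrightarrow> (SUP i. t i x)"
        using LIMSEQ_SUP[of "\<lambda>i. t i x"] t_inc by (auto simp: incseq_def le_fun_def)
      then show ?thesis by (intro tendsto_intros tendsto_neg_exp tendsto_ennrealI)
    qed
  qed
  also have "(\<integral>\<^sup>+x. ennreal (1 - neg_exp (SUP i. t i x)) \<partial>\<nu>) = (\<integral>\<^sup>+x. ennreal (1 - neg_exp (g x)) \<partial>\<nu>)"
    by (intro nn_integral_cong) (simp add: t_sup)
  finally have lim2: "(\<lambda>i. neg_exp (\<integral>\<^sup>+x. ennreal (1 - neg_exp (t i x)) \<partial>\<nu>))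
      \<longlonglongrightarrow> neg_exp (\<integral>\<^sup>+x. ennreal (1 - neg_exp (g x)) \<partial>\<nu>)"
    by (rule tendsto_neg_exp)
  show "(\<integral>\<omega>. neg_exp (\<integral>\<^sup>+x. g x \<partial>\<eta> \<omega>) \<partial>M) = neg_exp (\<integral>\<^sup>+x. ennreal (1 - neg_exp (g x)) \<partial>\<nu>)"
    using LIMSEQ_unique[OF lim1] lim2 poisson_laplace_simple(2)[OF prm t_simple t_fin t_supp] by simp
qed

end

section \<open>Time integrals of bounded processes\<close>

lemma borel_measurable_prod_list:
  fixes f :: "'i \<Rightarrow> 'a \<Rightarrow> real"
  assumes "\<And>t. t \<in> set ts \<Longrightarrow> f t \<in> borel_measurable N"
  shows "(\<lambda>z. \<Prod>t\<leftarrow>ts. f t z) \<in> borel_measurable N"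
  using assms by (induction ts) (auto intro!: borel_measurable_times)

lemma (in prob_space) integrable_bounded_real:
  fixes f :: "'a \<Rightarrow> real"
  assumes "f \<in> borel_measurable M" "\<And>\<omega>. \<bar>f \<omega>\<bar> \<le> B"
  shows "integrable M f"
  using assms by (intro integrable_const_bound[where B=B]) auto

text \<open>
  Processes are given by their values at each time and sample point and need not have regular paths.
  Joint measurability and boundedness are what make the time integral \<open>W\<close> and all its moments finite and
  accessible to Fubini's theorem.
\<close>

locale bounded_process = prob_space M + T: finite_measure T
  for M :: "'w measure" and T :: "'t measure" +
  fixes Z :: "'t \<Rightarrow> 'w \<Rightarrow> real" and C :: real
  assumes Z_measurable: "case_prod Z \<in> borel_measurable (T \<Otimes>\<^sub>M M)"
    and Z_nonneg: "\<And>t \<omega>. 0 \<le> Z t \<omega>" and Z_le: "\<And>t \<omega>. Z t \<omega> \<le> C"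
begin

sublocale TM: pair_sigma_finite T M ..

lemma measurable_Z [measurable (raw)]:
  "f \<in> measurable N T \<Longrightarrow> g \<in> measurable N M \<Longrightarrow> (\<lambda>x. Z (f x) (g x)) \<in> borel_measurable N"
  using measurable_compose[OF measurable_Pair Z_measurable, of f N g] by simp

definition W :: "'w \<Rightarrow> real" where "W \<omega> = (\<integral>t. Z t \<omega> \<partial>T)"

lemma measurable_W [measurable]: "W \<in> borel_measurable M"
  unfolding W_def by measurable

lemma C_nonneg: "0 \<le> C"
  using Z_nonneg Z_le order_trans by blast

lemma W_nonneg: "0 \<le> W \<omega>"
  unfolding W_def using Z_nonneg by (intro Bochner_Integration.integral_nonneg) auto

lemma integrable_Z: "\<omega> \<in> space M \<Longrightarrow> integrable T (\<lambda>t. Z t \<omega>)"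
  by (rule T.integrable_const_bound[where B=C]) (use Z_nonneg Z_le in auto)

lemma W_nn: "\<omega> \<in> space M \<Longrightarrow> ennreal (W \<omega>) = (\<integral>\<^sup>+t. ennreal (Z t \<omega>) \<partial>T)"
  unfolding W_def using integrable_Z Z_nonneg by (intro nn_integral_eq_integral[symmetric]) auto

lemma W_le: "W \<omega> \<le> C * measure T (space T)"
proof (cases "integrable T (\<lambda>t. Z t \<omega>)")
  case True
  then have "W \<omega> \<le> (\<integral>t. C \<partial>T)"
    unfolding W_def by (intro integral_mono) (auto intro: Z_le)
  then show ?thesis by (simp add: mult.commute)
next
  case False
  then show ?thesis using C_nonneg by (simp add: W_def not_integrable_integral_eq)
qed

lemma power_W_bound: "\<bar>W \<omega> ^ k\<bar> \<le> (C * measure T (space T)) ^ k"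
  using W_nonneg W_le by (simp add: power_abs power_mono)

text \<open>
  One factor \<open>W\<close> is written as a time integral and pulled out. Iterating expresses the moments of \<open>W\<close> by
  joint moments of the process at finitely many times.
\<close>

lemma moment_Suc:
  fixes P :: "'w \<Rightarrow> real"
  assumes [measurable]: "P \<in> borel_measurable M" and P: "\<And>\<omega>. \<bar>P \<omega>\<bar> \<le> B"
  shows "(\<integral>\<omega>. W \<omega> ^ Suc k * P \<omega> \<partial>M) = (\<integral>t. (\<integral>\<omega>. W \<omega> ^ k * (Z t \<omega> * P \<omega>) \<partial>M) \<partial>T)"
proof -
  let ?D = "(C * measure T (space T)) ^ k"
  interpret TM': finite_measure "T \<Otimes>\<^sub>M M"
    by (rule finite_measure_pair_measure) unfold_locales
  have "(\<integral>\<omega>. W \<omega> ^ Suc k * P \<omega> \<partial>M) = (\<integral>\<omega>. (\<integral>t. W \<omega> ^ k * (Z t \<omega> * P \<omega>) \<partial>T) \<partial>M)"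
    by (intro Bochner_Integration.integral_cong refl) (simp add: W_def algebra_simps)
  also have "\<dots> = (\<integral>t. (\<integral>\<omega>. W \<omega> ^ k * (Z t \<omega> * P \<omega>) \<partial>M) \<partial>T)"
  proof (rule TM.Fubini_integral)
    show "integrable (T \<Otimes>\<^sub>M M) (\<lambda>(t, \<omega>). W \<omega> ^ k * (Z t \<omega> * P \<omega>))"
    proof (rule TM'.integrable_const_bound[where B="?D * (C * B)"])
      have "\<bar>W \<omega> ^ k\<bar> * (\<bar>Z t \<omega>\<bar> * \<bar>P \<omega>\<bar>) \<le> ?D * (C * B)" for t \<omega>
        using Z_nonneg Z_le C_nonneg P
        by (intro mult_mono power_W_bound) (auto intro!: zero_le_power mult_nonneg_nonneg)
      then show "AE x in T \<Otimes>\<^sub>M M. norm (case x of (t, \<omega>) \<Rightarrow> W \<omega> ^ k * (Z t \<omega> * P \<omega>)) \<le> ?D * (C * B)"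
        by (auto simp: abs_mult)
      show "(\<lambda>(t, \<omega>). W \<omega> ^ k * (Z t \<omega> * P \<omega>)) \<in> borel_measurable (T \<Otimes>\<^sub>M M)"
        by measurable
    qed
  qed
  finally show ?thesis .
qed

lemma prod_list_bounds: "0 \<le> (\<Prod>t\<leftarrow>ts. Z t \<omega>)" "(\<Prod>t\<leftarrow>ts. Z t \<omega>) \<le> C ^ length ts"
  using Z_nonneg Z_le C_nonneg by (induction ts) (auto intro!: mult_mono)

lemma measurable_prod_list [measurable]:
  "set ts \<subseteq> space T \<Longrightarrow> (\<lambda>\<omega>. \<Prod>t\<leftarrow>ts. Z t \<omega>) \<in> borel_measurable M"
  by (intro borel_measurable_prod_list) auto

lemma laplace_series:
  "(\<lambda>k. (- u) ^ k / fact k * (\<integral>\<omega>. W \<omega> ^ k \<partial>M)) sums (\<integral>\<omega>. exp (- (u * W \<omega>)) \<partial>M)"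
proof -
  let ?D = "C * measure T (space T)"
  have D: "0 \<le> ?D" using C_nonneg by simp
  have int: "integrable M (\<lambda>\<omega>. W \<omega> ^ k)" for k
    by (rule integrable_bounded_real[OF _ power_W_bound]) measurable
  have "(\<lambda>n. \<integral>\<omega>. (\<Sum>k<n. (- u) ^ k / fact k * W \<omega> ^ k) \<partial>M) \<longlonglongrightarrow> (\<integral>\<omega>. exp (- (u * W \<omega>)) \<partial>M)"
  proof (rule integral_dominated_convergence[where w="\<lambda>_. exp (\<bar>u\<bar> * ?D)"])
    have eq: "(- u) ^ k / fact k * W \<omega> ^ k = (- (u * W \<omega>)) ^ k /\<^sub>R fact k" for k \<omega>
      by (simp add: field_simps flip: power_mult_distrib)
    show "AE \<omega> in M. (\<lambda>n. \<Sum>k<n. (- u) ^ k / fact k * W \<omega> ^ k) \<longlonglongrightarrow> exp (- (u * W \<omega>))"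
      unfolding eq by (intro AE_I2 exp_converges[unfolded sums_def])
    have "\<bar>\<Sum>k<n. (- u) ^ k / fact k * W \<omega> ^ k\<bar> \<le> exp (\<bar>u\<bar> * ?D)" for n \<omega>
    proof -
      have "\<bar>\<Sum>k<n. (- u) ^ k / fact k * W \<omega> ^ k\<bar> \<le> (\<Sum>k<n. (\<bar>u\<bar> * ?D) ^ k /\<^sub>R fact k)"
      proof (rule order_trans[OF sum_abs sum_mono])
        fix k
        have "\<bar>u\<bar> ^ k * \<bar>W \<omega> ^ k\<bar> \<le> \<bar>u\<bar> ^ k * ?D ^ k"
          by (intro mult_left_mono power_W_bound) auto
        then show "\<bar>(- u) ^ k / fact k * W \<omega> ^ k\<bar> \<le> (\<bar>u\<bar> * ?D) ^ k /\<^sub>R fact k"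
          by (simp add: abs_mult power_abs power_mult_distrib divide_simps)
      qed
      also have "\<dots> \<le> (\<Sum>k. (\<bar>u\<bar> * ?D) ^ k /\<^sub>R fact k)"
        using D by (intro sum_le_suminf summable_exp_generic) auto
      finally show ?thesis by (simp add: exp_def)
    qed
    then show "AE \<omega> in M. norm (\<Sum>k<n. (- u) ^ k / fact k * W \<omega> ^ k) \<le> exp (\<bar>u\<bar> * ?D)" for n by simp
  qed auto
  also have "(\<lambda>n. \<integral>\<omega>. (\<Sum>k<n. (- u) ^ k / fact k * W \<omega> ^ k) \<partial>M)
      = (\<lambda>n. \<Sum>k<n. (- u) ^ k / fact k * (\<integral>\<omega>. W \<omega> ^ k \<partial>M))"
    by (subst Bochner_Integration.integral_sum) (auto intro!: integrable_mult_right int)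
  finally show ?thesis by (simp add: sums_def)
qed

end

text \<open>
  The law of a time integral depends on the finite-dimensional laws of the process only, although the time
  integral is not a function of the path that is measurable for the product sigma-algebra. The
  induction must carry along a product over finitely many additional times.
\<close>

lemma laplace_eq_of_moments:
  assumes "bounded_process M1 T Z1 C1" "bounded_process M2 T Z2 C2"
    and moments: "\<And>ts. set ts \<subseteq> space T \<Longrightarrow>
      (\<integral>\<omega>. (\<Prod>t\<leftarrow>ts. Z1 t \<omega>) \<partial>M1) = (\<integral>\<omega>. (\<Prod>t\<leftarrow>ts. Z2 t \<omega>) \<partial>M2)"
  shows "(\<integral>\<omega>. exp (- (u * (\<integral>t. Z1 t \<omega> \<partial>T))) \<partial>M1) = (\<integral>\<omega>. exp (- (u * (\<integral>t. Z2 t \<omega> \<partial>T))) \<partial>M2)"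
proof -
  interpret P1: bounded_process M1 T Z1 C1 by fact
  interpret P2: bounded_process M2 T Z2 C2 by fact
  have eq: "(\<integral>\<omega>. P1.W \<omega> ^ k * (\<Prod>t\<leftarrow>ts. Z1 t \<omega>) \<partial>M1) = (\<integral>\<omega>. P2.W \<omega> ^ k * (\<Prod>t\<leftarrow>ts. Z2 t \<omega>) \<partial>M2)"
    if "set ts \<subseteq> space T" for k ts
    using that
  proof (induction k arbitrary: ts)
    case 0
    then show ?case using moments by simp
  next
    case (Suc k)
    have "(\<integral>\<omega>. P1.W \<omega> ^ Suc k * (\<Prod>t\<leftarrow>ts. Z1 t \<omega>) \<partial>M1)
        = (\<integral>s. (\<integral>\<omega>. P1.W \<omega> ^ k * (\<Prod>t\<leftarrow>s # ts. Z1 t \<omega>) \<partial>M1) \<partial>T)"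
      using Suc.prems P1.prod_list_bounds
      by (subst P1.moment_Suc[where B="C1 ^ length ts"]) auto
    also have "\<dots> = (\<integral>s. (\<integral>\<omega>. P2.W \<omega> ^ k * (\<Prod>t\<leftarrow>s # ts. Z2 t \<omega>) \<partial>M2) \<partial>T)"
      using Suc.prems by (intro Bochner_Integration.integral_cong refl Suc.IH) auto
    also have "\<dots> = (\<integral>\<omega>. P2.W \<omega> ^ Suc k * (\<Prod>t\<leftarrow>ts. Z2 t \<omega>) \<partial>M2)"
      using Suc.prems P2.prod_list_bounds
      by (subst P2.moment_Suc[where B="C2 ^ length ts"]) auto
    finally show ?case .
  qed
  show ?thesis
    using P1.laplace_series[of u] P2.laplace_series[of u] eq[of "[]"]
    by (simp add: sums_unique2 P1.W_def P2.W_def)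
qed

text \<open>
  Up to ties, which are null sets for a diffuse \<open>T\<close>, one of the three times exceeds the other two. By
  symmetry each of the three cases contributes the same amount.
\<close>

lemma nn_integral_cube_le:
  fixes T :: "real measure" and v :: "real \<Rightarrow> ennreal"
  assumes "sigma_finite_measure T" and T: "(\<lambda>s. s) \<in> borel_measurable T"
    and diffuse: "\<And>c. AE s in T. s \<noteq> c" and v: "v \<in> borel_measurable T"
  shows "(\<integral>\<^sup>+s. v s \<partial>T) ^ 3
    \<le> 3 * (\<integral>\<^sup>+s1. (\<integral>\<^sup>+s2. (\<integral>\<^sup>+s3. (if s1 < s3 \<and> s2 < s3 then v s1 * v s2 * v s3 else 0) \<partial>T) \<partial>T) \<partial>T)"
proof -
  interpret T: sigma_finite_measure T by fact
  interpret TT: pair_sigma_finite T T ..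
  note T[measurable] v[measurable]
  have [measurable]: "(\<lambda>x. f x) \<in> borel_measurable N" if "f \<in> measurable N T" for f and N :: "'c measure"
    using measurable_compose[OF that T] .
  define g where "g s1 s2 s3 = (if s1 < s3 \<and> s2 < s3 then v s1 * v s2 * v s3 else 0)" for s1 s2 s3
  have [measurable]: "(\<lambda>x. g (f1 x) (f2 x) (f3 x)) \<in> borel_measurable N"
    if [measurable]: "f1 \<in> measurable N T" "f2 \<in> measurable N T" "f3 \<in> measurable N T" for f1 f2 f3 and N :: "'c measure"
    unfolding g_def by measurable
  define J where "J = (\<integral>\<^sup>+s1. (\<integral>\<^sup>+s2. (\<integral>\<^sup>+s3. g s1 s2 s3 \<partial>T) \<partial>T) \<partial>T)"
  have "(\<integral>\<^sup>+s. v s \<partial>T) ^ 3 = (\<integral>\<^sup>+s1. (\<integral>\<^sup>+s2. (\<integral>\<^sup>+s3. v s1 * v s2 * v s3 \<partial>T) \<partial>T) \<partial>T)"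
    by (simp add: nn_integral_cmult nn_integral_multc power3_eq_cube)
  also have "\<dots> \<le> (\<integral>\<^sup>+s1. (\<integral>\<^sup>+s2. (\<integral>\<^sup>+s3. g s1 s2 s3 + g s1 s3 s2 + g s2 s3 s1 \<partial>T) \<partial>T) \<partial>T)"
  proof (rule nn_integral_mono, rule nn_integral_mono_AE)
    fix s1
    show "AE s2 in T. (\<integral>\<^sup>+s3. v s1 * v s2 * v s3 \<partial>T) \<le> (\<integral>\<^sup>+s3. g s1 s2 s3 + g s1 s3 s2 + g s2 s3 s1 \<partial>T)"
      using diffuse[of s1]
    proof eventually_elim
      case (elim s2)
      show ?case
      proof (rule nn_integral_mono_AE)
        show "AE s3 in T. v s1 * v s2 * v s3 \<le> g s1 s2 s3 + g s1 s3 s2 + g s2 s3 s1"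
          using diffuse[of s1] diffuse[of s2]
        proof eventually_elim
          case (elim s3)
          consider "s1 < s3 \<and> s2 < s3" | "s1 < s2 \<and> s3 < s2" | "s2 < s1 \<and> s3 < s1"
            using elim \<open>s2 \<noteq> s1\<close> by linarith
          then show ?case
            by cases (auto simp: g_def mult_ac add_increasing add_increasing2)
        qed
      qed
    qed
  qed
  also have "\<dots> = J + (\<integral>\<^sup>+s1. (\<integral>\<^sup>+s2. (\<integral>\<^sup>+s3. g s1 s3 s2 \<partial>T) \<partial>T) \<partial>T)
      + (\<integral>\<^sup>+s1. (\<integral>\<^sup>+s2. (\<integral>\<^sup>+s3. g s2 s3 s1 \<partial>T) \<partial>T) \<partial>T)"
  proof -
    have "(\<integral>\<^sup>+s3. g s1 s2 s3 + g s1 s3 s2 + g s2 s3 s1 \<partial>T)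
        = (\<integral>\<^sup>+s3. g s1 s2 s3 \<partial>T) + (\<integral>\<^sup>+s3. g s1 s3 s2 \<partial>T) + (\<integral>\<^sup>+s3. g s2 s3 s1 \<partial>T)"
      if [measurable]: "s1 \<in> space T" "s2 \<in> space T" for s1 s2
      by (subst nn_integral_add, measurable)+
    then have "(\<integral>\<^sup>+s1. (\<integral>\<^sup>+s2. (\<integral>\<^sup>+s3. g s1 s2 s3 + g s1 s3 s2 + g s2 s3 s1 \<partial>T) \<partial>T) \<partial>T)
        = (\<integral>\<^sup>+s1. (\<integral>\<^sup>+s2. (\<integral>\<^sup>+s3. g s1 s2 s3 \<partial>T) + (\<integral>\<^sup>+s3. g s1 s3 s2 \<partial>T)
            + (\<integral>\<^sup>+s3. g s2 s3 s1 \<partial>T) \<partial>T) \<partial>T)"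
      by (intro nn_integral_cong) simp
    also have "\<dots> = (\<integral>\<^sup>+s1. (\<integral>\<^sup>+s2. (\<integral>\<^sup>+s3. g s1 s2 s3 \<partial>T) \<partial>T) + (\<integral>\<^sup>+s2. (\<integral>\<^sup>+s3. g s1 s3 s2 \<partial>T) \<partial>T)
            + (\<integral>\<^sup>+s2. (\<integral>\<^sup>+s3. g s2 s3 s1 \<partial>T) \<partial>T) \<partial>T)"
      by (intro nn_integral_cong) (subst nn_integral_add, measurable)+
    also have "\<dots> = J + (\<integral>\<^sup>+s1. (\<integral>\<^sup>+s2. (\<integral>\<^sup>+s3. g s1 s3 s2 \<partial>T) \<partial>T) \<partial>T)
      + (\<integral>\<^sup>+s1. (\<integral>\<^sup>+s2. (\<integral>\<^sup>+s3. g s2 s3 s1 \<partial>T) \<partial>T) \<partial>T)"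
      unfolding J_def by (subst nn_integral_add, measurable)+
    finally show ?thesis .
  qed
  also have "(\<integral>\<^sup>+s1. (\<integral>\<^sup>+s2. (\<integral>\<^sup>+s3. g s1 s3 s2 \<partial>T) \<partial>T) \<partial>T) = J"
    unfolding J_def by (intro nn_integral_cong TT.Fubini') measurable
  also have "(\<integral>\<^sup>+s1. (\<integral>\<^sup>+s2. (\<integral>\<^sup>+s3. g s2 s3 s1 \<partial>T) \<partial>T) \<partial>T)
      = (\<integral>\<^sup>+s2. (\<integral>\<^sup>+s1. (\<integral>\<^sup>+s3. g s2 s3 s1 \<partial>T) \<partial>T) \<partial>T)"
    by (intro TT.Fubini') measurable
  also have "\<dots> = J"
    unfolding J_def by (intro nn_integral_cong TT.Fubini') measurable
  also have "J + J + J = 3 * J"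
  proof -
    have "(3 :: ennreal) = 1 + 1 + 1" by simp
    then show ?thesis by (simp only: distrib_right mult_1)
  qed
  finally show ?thesis by (simp add: J_def g_def)
qed

text \<open>
  The singularity at \<open>c\<close> is integrable since \<open>\<gamma> < 1\<close>.
\<close>

lemma nn_integral_powr_after:
  fixes c r \<gamma> :: real
  assumes "0 \<le> c" "\<gamma> < 1"
  shows "(\<integral>\<^sup>+s\<in>{0..r}. (if c < s then ennreal ((s - c) powr (- \<gamma>)) else 0) \<partial>lborel)
    \<le> ennreal (r powr (1 - \<gamma>) / (1 - \<gamma>))"
proof (cases "c < r")
  case False
  then have "(\<integral>\<^sup>+s\<in>{0..r}. (if c < s then ennreal ((s - c) powr (- \<gamma>)) else 0) \<partial>lborel) = (\<integral>\<^sup>+(s::real). 0 \<partial>lborel)"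
    by (intro nn_integral_cong) (auto split: split_indicator)
  then show ?thesis by simp
next
  case True
  have "(\<integral>\<^sup>+s\<in>{0..r}. (if c < s then ennreal ((s - c) powr (- \<gamma>)) else 0) \<partial>lborel)
      \<le> (\<integral>\<^sup>+s. ennreal (indicator {0..r - c} (s - c) * (s - c) powr (- \<gamma>)) \<partial>lborel)"
    by (intro nn_integral_mono) (auto split: split_indicator)
  also have "\<dots> = (\<integral>\<^sup>+s. ennreal (indicator {0..r - c} s * s powr (- \<gamma>)) \<partial>lborel)"
    using nn_integral_real_affine[of "\<lambda>s. ennreal (indicator {0..r - c} s * s powr (- \<gamma>))" 1 "- c"]
    by (simp add: ac_simps)
  also have "\<dots> = ennreal ((r - c) powr (- \<gamma> + 1) / (- \<gamma> + 1))"
  proof (rule nn_integral_has_integral_lborel)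
    have "((\<lambda>s. s powr (- \<gamma>)) has_integral ((r - c) powr (- \<gamma> + 1) / (- \<gamma> + 1))) {0..r - c}"
      using True assms by (intro has_integral_powr_from_0) auto
    then show "((\<lambda>s. indicator {0..r - c} s * s powr (- \<gamma>)) has_integral ((r - c) powr (- \<gamma> + 1) / (- \<gamma> + 1))) UNIV"
      by (subst (asm) has_integral_restrict_UNIV[symmetric])
        (auto elim!: has_integral_eq_rhs has_integral_spike_eq[THEN iffD1, rotated -1] simp: indicator_def if_distrib cong: if_cong)
  qed auto
  also have "\<dots> \<le> ennreal (r powr (1 - \<gamma>) / (1 - \<gamma>))"
    using True assms by (intro ennreal_leI) (auto intro!: divide_right_mono powr_mono2 simp: add.commute)
  finally show ?thesis .
qed

text \<open>
  The abstract form of the use of condition (H): if the latest of three times can be removed from a mixed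
  moment at the cost of an integrable singularity, then the third moment of the time integral is bounded
  by its second moment times \<open>r powr (1 - \<gamma>)\<close>.
\<close>

lemma third_moment_time_integral:
  fixes r \<gamma> b C :: real and V :: "real \<Rightarrow> 'w \<Rightarrow> real"
  assumes "bounded_process M (restrict_space lborel {0..r}) V C"
    and \<gamma>: "\<gamma> < 1" and b: "0 \<le> b"
    and bound: "\<And>s1 s2 s3. \<lbrakk>0 < s1; 0 < s2; s1 < s3; s2 < s3; s3 \<le> r; s1 \<noteq> s2\<rbrakk> \<Longrightarrow>
      (\<integral>\<^sup>+\<omega>. ennreal (V s1 \<omega> * V s2 \<omega> * V s3 \<omega>) \<partial>M)
        \<le> ennreal (b * (s3 - max s1 s2) powr (- \<gamma>)) * (\<integral>\<^sup>+\<omega>. ennreal (V s1 \<omega> * V s2 \<omega>) \<partial>M)"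
  shows "(\<integral>\<^sup>+\<omega>. ennreal ((\<integral>t. V t \<omega> \<partial>restrict_space lborel {0..r}) ^ 3) \<partial>M)
    \<le> ennreal (3 * b * (r powr (1 - \<gamma>) / (1 - \<gamma>)))
      * (\<integral>\<^sup>+\<omega>. ennreal ((\<integral>t. V t \<omega> \<partial>restrict_space lborel {0..r})\<^sup>2) \<partial>M)"
proof -
  define T :: "real measure" where "T = restrict_space lborel {0..r}"
  interpret bounded_process M T V C using assms(1) by (simp add: T_def)
  have spT: "space T = {0..r}" by (simp add: T_def space_restrict_space)
  have T_id [measurable]: "(\<lambda>s. s) \<in> borel_measurable T"
    unfolding T_def by (intro measurable_restrict_space1) simp
  have [measurable]: "(\<lambda>x. f x) \<in> borel_measurable N" if "f \<in> measurable N T" for f and N :: "'c measure"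
    using measurable_compose[OF that T_id] .
  have diffuse: "AE s in T. s \<noteq> c" for c
    unfolding T_def using AE_lborel_singleton[of c] by (subst AE_restrict_space_iff) auto
  define v where "v t \<omega> = ennreal (V t \<omega>)" for t \<omega>
  have v_meas [measurable (raw)]: "(\<lambda>x. v (f x) (g x)) \<in> borel_measurable N"
    if [measurable]: "f \<in> measurable N T" "g \<in> measurable N M" for f g and N :: "'c measure"
    unfolding v_def by measurable
  define K where "K s1 s2 = (\<integral>\<^sup>+\<omega>. v s1 \<omega> * v s2 \<omega> \<partial>M)" for s1 s2
  define G where "G s1 s2 s3 \<omega> = (if s1 < s3 \<and> s2 < s3 then v s1 \<omega> * v s2 \<omega> * v s3 \<omega> else 0)" for s1 s2 s3 \<omega>
  have G_meas [measurable (raw)]: "(\<lambda>x. G (f1 x) (f2 x) (f3 x) (g x)) \<in> borel_measurable N"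
    if [measurable]: "f1 \<in> measurable N T" "f2 \<in> measurable N T" "f3 \<in> measurable N T" "g \<in> measurable N M"
    for f1 f2 f3 g and N :: "'c measure"
    unfolding G_def by measurable
  define B where "B = ennreal b * ennreal (r powr (1 - \<gamma>) / (1 - \<gamma>))"
  have "(\<integral>\<^sup>+\<omega>. ennreal (W \<omega> ^ 3) \<partial>M) = (\<integral>\<^sup>+\<omega>. (\<integral>\<^sup>+t. v t \<omega> \<partial>T) ^ 3 \<partial>M)"
    by (intro nn_integral_cong) (simp add: v_def W_nn[symmetric] W_nonneg ennreal_power)
  also have "\<dots> \<le> (\<integral>\<^sup>+\<omega>. 3 * (\<integral>\<^sup>+s1. (\<integral>\<^sup>+s2. (\<integral>\<^sup>+s3. G s1 s2 s3 \<omega> \<partial>T) \<partial>T) \<partial>T) \<partial>M)"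
    unfolding G_def
    by (intro nn_integral_mono nn_integral_cube_le diffuse T_id T.sigma_finite_measure_axioms) measurable
  also have "\<dots> = 3 * (\<integral>\<^sup>+\<omega>. (\<integral>\<^sup>+s1. (\<integral>\<^sup>+s2. (\<integral>\<^sup>+s3. G s1 s2 s3 \<omega> \<partial>T) \<partial>T) \<partial>T) \<partial>M)"
    by (rule nn_integral_cmult) measurable
  also have "(\<integral>\<^sup>+\<omega>. (\<integral>\<^sup>+s1. (\<integral>\<^sup>+s2. (\<integral>\<^sup>+s3. G s1 s2 s3 \<omega> \<partial>T) \<partial>T) \<partial>T) \<partial>M)
      = (\<integral>\<^sup>+s1. (\<integral>\<^sup>+\<omega>. (\<integral>\<^sup>+s2. (\<integral>\<^sup>+s3. G s1 s2 s3 \<omega> \<partial>T) \<partial>T) \<partial>M) \<partial>T)"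
    by (rule TM.Fubini') measurable
  also have "\<dots> = (\<integral>\<^sup>+s1. (\<integral>\<^sup>+s2. (\<integral>\<^sup>+\<omega>. (\<integral>\<^sup>+s3. G s1 s2 s3 \<omega> \<partial>T) \<partial>M) \<partial>T) \<partial>T)"
    by (intro nn_integral_cong TM.Fubini') measurable
  also have "\<dots> = (\<integral>\<^sup>+s1. (\<integral>\<^sup>+s2. (\<integral>\<^sup>+s3. (\<integral>\<^sup>+\<omega>. G s1 s2 s3 \<omega> \<partial>M) \<partial>T) \<partial>T) \<partial>T)"
    by (intro nn_integral_cong TM.Fubini') measurable
  also have "\<dots> \<le> (\<integral>\<^sup>+s1. (\<integral>\<^sup>+s2. B * K s1 s2 \<partial>T) \<partial>T)"
  proof (rule nn_integral_mono_AE)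
    show "AE s1 in T. (\<integral>\<^sup>+s2. (\<integral>\<^sup>+s3. (\<integral>\<^sup>+\<omega>. G s1 s2 s3 \<omega> \<partial>M) \<partial>T) \<partial>T) \<le> (\<integral>\<^sup>+s2. B * K s1 s2 \<partial>T)"
      using diffuse[of 0] AE_space
    proof eventually_elim
      case (elim s1)
      show ?case
      proof (rule nn_integral_mono_AE)
        show "AE s2 in T. (\<integral>\<^sup>+s3. (\<integral>\<^sup>+\<omega>. G s1 s2 s3 \<omega> \<partial>M) \<partial>T) \<le> B * K s1 s2"
          using diffuse[of 0] diffuse[of s1] AE_space
        proof eventually_elim
          case s2: (elim s2)
          define c where "c = max s1 s2"
          have pos: "0 < s1" "0 < s2" using elim s2 by (auto simp: spT)
          have "(\<integral>\<^sup>+s3. (\<integral>\<^sup>+\<omega>. G s1 s2 s3 \<omega> \<partial>M) \<partial>T)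
              \<le> (\<integral>\<^sup>+s3. (ennreal b * K s1 s2) * (if c < s3 then ennreal ((s3 - c) powr (- \<gamma>)) else 0) \<partial>T)"
          proof (rule nn_integral_mono)
            fix s3 assume s3: "s3 \<in> space T"
            show "(\<integral>\<^sup>+\<omega>. G s1 s2 s3 \<omega> \<partial>M) \<le> (ennreal b * K s1 s2) * (if c < s3 then ennreal ((s3 - c) powr (- \<gamma>)) else 0)"
            proof (cases "c < s3")
              case True
              then have "(\<integral>\<^sup>+\<omega>. G s1 s2 s3 \<omega> \<partial>M) = (\<integral>\<^sup>+\<omega>. ennreal (V s1 \<omega> * V s2 \<omega> * V s3 \<omega>) \<partial>M)"
                by (simp add: G_def v_def c_def ennreal_mult Z_nonneg)
              also have "\<dots> \<le> ennreal (b * (s3 - c) powr (- \<gamma>)) * (\<integral>\<^sup>+\<omega>. ennreal (V s1 \<omega> * V s2 \<omega>) \<partial>M)"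
                using True pos s3 s2 unfolding c_def by (intro bound) (auto simp: spT)
              also have "\<dots> = (ennreal b * K s1 s2) * ennreal ((s3 - c) powr (- \<gamma>))"
                using b by (simp add: K_def v_def ennreal_mult Z_nonneg mult_ac)
              finally show ?thesis using True by simp
            next
              case False
              then have "G s1 s2 s3 \<omega> = 0" for \<omega> by (auto simp: G_def c_def)
              then show ?thesis by simp
            qed
          qed
          also have "\<dots> = (ennreal b * K s1 s2) * (\<integral>\<^sup>+s3. (if c < s3 then ennreal ((s3 - c) powr (- \<gamma>)) else 0) \<partial>T)"
            by (rule nn_integral_cmult) measurable
          also have "\<dots> \<le> (ennreal b * K s1 s2) * ennreal (r powr (1 - \<gamma>) / (1 - \<gamma>))"
            unfolding T_def using pos \<gamma> nn_integral_powr_after[of c \<gamma> r]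
            by (intro mult_left_mono, subst nn_integral_restrict_space) (auto simp: c_def)
          finally show ?case by (simp add: B_def mult_ac)
        qed
      qed
    qed
  qed
  also have "\<dots> = (\<integral>\<^sup>+s1. B * (\<integral>\<^sup>+s2. K s1 s2 \<partial>T) \<partial>T)"
    unfolding K_def by (intro nn_integral_cong nn_integral_cmult) measurable
  also have "\<dots> = B * (\<integral>\<^sup>+s1. (\<integral>\<^sup>+s2. K s1 s2 \<partial>T) \<partial>T)"
    unfolding K_def by (rule nn_integral_cmult) measurable
  also have "(\<integral>\<^sup>+s1. (\<integral>\<^sup>+s2. K s1 s2 \<partial>T) \<partial>T) = (\<integral>\<^sup>+\<omega>. ennreal ((W \<omega>)\<^sup>2) \<partial>M)"
  proof -
    have "(\<integral>\<^sup>+\<omega>. ennreal ((W \<omega>)\<^sup>2) \<partial>M) = (\<integral>\<^sup>+\<omega>. (\<integral>\<^sup>+s1. (\<integral>\<^sup>+s2. v s1 \<omega> * v s2 \<omega> \<partial>T) \<partial>T) \<partial>M)"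
      by (intro nn_integral_cong)
        (simp add: nn_integral_cmult nn_integral_multc power2_eq_square ennreal_mult W_nonneg W_nn v_def)
    also have "\<dots> = (\<integral>\<^sup>+s1. (\<integral>\<^sup>+\<omega>. (\<integral>\<^sup>+s2. v s1 \<omega> * v s2 \<omega> \<partial>T) \<partial>M) \<partial>T)"
      by (rule TM.Fubini') measurable
    also have "\<dots> = (\<integral>\<^sup>+s1. (\<integral>\<^sup>+s2. K s1 s2 \<partial>T) \<partial>T)"
      unfolding K_def by (intro nn_integral_cong TM.Fubini') measurable
    finally show ?thesis by simp
  qed
  finally have "(\<integral>\<^sup>+\<omega>. ennreal (W \<omega> ^ 3) \<partial>M) \<le> 3 * (B * (\<integral>\<^sup>+\<omega>. ennreal ((W \<omega>)\<^sup>2) \<partial>M))"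
    by (simp add: mult_left_mono)
  also have "3 * (B * (\<integral>\<^sup>+\<omega>. ennreal ((W \<omega>)\<^sup>2) \<partial>M))
      = ennreal (3 * b * (r powr (1 - \<gamma>) / (1 - \<gamma>))) * (\<integral>\<^sup>+\<omega>. ennreal ((W \<omega>)\<^sup>2) \<partial>M)"
  proof -
    have "0 \<le> r powr (1 - \<gamma>) / (1 - \<gamma>)" using \<gamma> by simp
    then have "ennreal (3 * b * (r powr (1 - \<gamma>) / (1 - \<gamma>))) = ennreal 3 * ennreal b * ennreal (r powr (1 - \<gamma>) / (1 - \<gamma>))"
      using b by (simp only: ennreal_mult mult_nonneg_nonneg zero_le_numeral)
    then show ?thesis by (simp add: B_def mult.assoc)
  qed
  finally show ?thesis unfolding W_def unfolding T_def .
qed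

section \<open>Densities and integrals over point measures\<close>

lemma sum_ennreal_mult:
  assumes "\<And>i. i \<in> I \<Longrightarrow> 0 \<le> a i" "\<And>i. i \<in> I \<Longrightarrow> 0 \<le> z i"
  shows "(\<Sum>i\<in>I. ennreal (a i) * ennreal (z i)) = ennreal (\<Sum>i\<in>I. a i * z i)"
  using assms by (subst sum_ennreal[symmetric]) (auto intro!: sum.cong simp: ennreal_mult)

lemma nn_integral_lborel_prod:
  fixes f :: "'a::euclidean_space \<times> 'b::euclidean_space \<Rightarrow> ennreal"
  assumes "f \<in> borel_measurable borel"
  shows "(\<integral>\<^sup>+z. f z \<partial>lborel) = (\<integral>\<^sup>+x. (\<integral>\<^sup>+y. f (x, y) \<partial>lborel) \<partial>lborel)"
  using lborel.nn_integral_fst[of f lborel] assms by (simp add: lborel_prod)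

text \<open>
  The ratio bound carries no information where \<open>f2\<close> vanishes, because \<open>x / 0 = 0\<close>. But \<open>f2\<close> is the density
  of the marginal, so \<open>f3\<close> vanishes almost everywhere on that set; this is the role of \<open>N\<close>. Thus
  \<open>f3 \<le> K f2\<close> almost everywhere, and the last variable is integrated out.
\<close>

lemma (in prob_space) nn_integral_conditional_density_bound:
  fixes Y1 Y2 Y3 :: "'a \<Rightarrow> 'b::euclidean_space"
  assumes f3: "distributed M lborel (\<lambda>\<omega>. (Y1 \<omega>, Y2 \<omega>, Y3 \<omega>)) (\<lambda>z. ennreal (f3 z))"
    and f2: "distributed M lborel (\<lambda>\<omega>. (Y1 \<omega>, Y2 \<omega>)) (\<lambda>z. ennreal (f2 z))"
    and nonneg: "\<And>z. 0 \<le> f3 z" "\<And>z. 0 \<le> f2 z" and K: "0 \<le> K"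
    and ratio: "\<And>x b c. f3 (b, c, x) / f2 (b, c) \<le> K"
    and g [measurable]: "g1 \<in> borel_measurable borel" "g2 \<in> borel_measurable borel" "g3 \<in> borel_measurable borel"
  shows "(\<integral>\<^sup>+\<omega>. g1 (Y1 \<omega>) * g2 (Y2 \<omega>) * g3 (Y3 \<omega>) \<partial>M)
    \<le> ennreal K * (\<integral>\<^sup>+x. g3 x \<partial>lborel) * (\<integral>\<^sup>+\<omega>. g1 (Y1 \<omega>) * g2 (Y2 \<omega>) \<partial>M)"
proof -
  have F3 [measurable]: "(\<lambda>z. ennreal (f3 z)) \<in> borel_measurable borel"
    using distributed_borel_measurable[OF f3] by simp
  have F2 [measurable]: "(\<lambda>z. ennreal (f2 z)) \<in> borel_measurable borel"
    using distributed_borel_measurable[OF f2] by simp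
  define N where "N z = (if ennreal (f2 z) = 0 then 1 else 0 :: ennreal)" for z
  have [measurable]: "N \<in> borel_measurable borel" unfolding N_def by measurable
  have pair12: "(\<lambda>z :: 'b \<times> 'b \<times> 'b. (fst z, fst (snd z))) \<in> borel_measurable borel"
    by (intro borel_measurable_continuous_onI continuous_intros)
  from measurable_compose[OF pair12, of N borel]
  have [measurable]: "(\<lambda>z :: 'b \<times> 'b \<times> 'b. N (fst z, fst (snd z))) \<in> borel_measurable borel"
    by measurable
  have "(\<integral>\<^sup>+z. ennreal (f3 z) * N (fst z, fst (snd z)) \<partial>lborel) = (\<integral>\<^sup>+\<omega>. N (Y1 \<omega>, Y2 \<omega>) \<partial>M)"
    using distributed_nn_integral[OF f3, of "\<lambda>z. N (fst z, fst (snd z))"] by simp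
  also have "\<dots> = (\<integral>\<^sup>+z. ennreal (f2 z) * N z \<partial>lborel)"
    using distributed_nn_integral[OF f2, of N] by simp
  also have "\<dots> = 0" by (simp add: N_def if_distrib cong: if_cong)
  finally have "AE z in lborel. ennreal (f3 z) * N (fst z, fst (snd z)) = 0"
    by (subst (asm) nn_integral_0_iff_AE) auto
  then have dom: "AE z in lborel. ennreal (f3 z) \<le> ennreal K * ennreal (f2 (fst z, fst (snd z)))"
  proof eventually_elim
    case (elim z)
    obtain b c x where z: "z = (b, c, x)" by (cases z)
    show ?case
    proof (cases "f2 (b, c) = 0")
      case True
      then show ?thesis using elim by (simp add: z N_def)
    next
      case False
      then have "f3 (b, c, x) \<le> K * f2 (b, c)"
        using ratio[of b c x] nonneg(2)[of "(b, c)"] by (simp add: divide_le_eq)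
      then show ?thesis using K by (simp add: z ennreal_mult[symmetric] nonneg ennreal_leI)
    qed
  qed
  have [measurable]: "(\<lambda>z :: 'b \<times> 'b \<times> 'b. g1 (fst z)) \<in> borel_measurable borel"
    "(\<lambda>z :: 'b \<times> 'b \<times> 'b. g2 (fst (snd z))) \<in> borel_measurable borel"
    "(\<lambda>z :: 'b \<times> 'b \<times> 'b. g3 (snd (snd z))) \<in> borel_measurable borel"
    "(\<lambda>z :: 'b \<times> 'b. g1 (fst z)) \<in> borel_measurable borel"
    "(\<lambda>z :: 'b \<times> 'b. g2 (snd z)) \<in> borel_measurable borel"
    by (rule measurable_compose[rotated, OF g(1)] measurable_compose[rotated, OF g(2)]
        measurable_compose[rotated, OF g(3)], intro borel_measurable_continuous_onI continuous_intros)+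
  have "(\<integral>\<^sup>+\<omega>. g1 (Y1 \<omega>) * g2 (Y2 \<omega>) * g3 (Y3 \<omega>) \<partial>M)
      = (\<integral>\<^sup>+z. ennreal (f3 z) * (g1 (fst z) * g2 (fst (snd z)) * g3 (snd (snd z))) \<partial>lborel)"
    using distributed_nn_integral[OF f3, of "\<lambda>z. g1 (fst z) * g2 (fst (snd z)) * g3 (snd (snd z))"] by simp
  also have "\<dots> \<le> (\<integral>\<^sup>+z. ennreal K * ennreal (f2 (fst z, fst (snd z))) * (g1 (fst z) * g2 (fst (snd z)) * g3 (snd (snd z))) \<partial>lborel)"
    using dom by (intro nn_integral_mono_AE) (auto elim!: eventually_mono intro: mult_right_mono)
  also have "\<dots> = (\<integral>\<^sup>+b. (\<integral>\<^sup>+c. (\<integral>\<^sup>+x. ennreal K * ennreal (f2 (b, c)) * (g1 b * g2 c * g3 x) \<partial>lborel) \<partial>lborel) \<partial>lborel)"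
  proof -
    define F where "F z = ennreal K * ennreal (f2 (fst z, fst (snd z))) * (g1 (fst z) * g2 (fst (snd z)) * g3 (snd (snd z)))" for z
    have f2': "(\<lambda>z :: 'b \<times> 'b \<times> 'b. ennreal (f2 (fst z, fst (snd z)))) \<in> borel_measurable borel"
      using measurable_compose[OF pair12 F2] .
    have F: "F \<in> borel_measurable borel"
      unfolding F_def using f2' by measurable
    have "(\<lambda>p. F (b, p)) \<in> borel_measurable borel" for b
      by (rule measurable_compose[OF _ F]) (intro borel_measurable_continuous_onI continuous_intros)
    then show ?thesis
      using nn_integral_lborel_prod[OF F] by (simp add: nn_integral_lborel_prod) (simp add: F_def)
  qed
  also have "\<dots> = (\<integral>\<^sup>+b. (\<integral>\<^sup>+c. (ennreal K * (\<integral>\<^sup>+x. g3 x \<partial>lborel)) * (ennreal (f2 (b, c)) * (g1 b * g2 c)) \<partial>lborel) \<partial>lborel)"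
  proof (intro nn_integral_cong)
    fix b c
    have "(\<integral>\<^sup>+x. ennreal K * ennreal (f2 (b, c)) * (g1 b * g2 c * g3 x) \<partial>lborel)
        = (\<integral>\<^sup>+x. (ennreal K * ennreal (f2 (b, c)) * (g1 b * g2 c)) * g3 x \<partial>lborel)"
      by (simp add: mult_ac)
    also have "\<dots> = (ennreal K * ennreal (f2 (b, c)) * (g1 b * g2 c)) * (\<integral>\<^sup>+x. g3 x \<partial>lborel)"
      by (rule nn_integral_cmult) simp
    finally show "(\<integral>\<^sup>+x. ennreal K * ennreal (f2 (b, c)) * (g1 b * g2 c * g3 x) \<partial>lborel)
        = (ennreal K * (\<integral>\<^sup>+x. g3 x \<partial>lborel)) * (ennreal (f2 (b, c)) * (g1 b * g2 c))"
      by (simp add: mult_ac)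
  qed
  also have "\<dots> = (\<integral>\<^sup>+z. (ennreal K * (\<integral>\<^sup>+x. g3 x \<partial>lborel)) * (ennreal (f2 z) * (g1 (fst z) * g2 (snd z))) \<partial>lborel)"
    by (subst nn_integral_lborel_prod) auto
  also have "\<dots> = ennreal K * (\<integral>\<^sup>+x. g3 x \<partial>lborel) * (\<integral>\<^sup>+z. ennreal (f2 z) * (g1 (fst z) * g2 (snd z)) \<partial>lborel)"
    by (rule nn_integral_cmult) simp
  also have "(\<integral>\<^sup>+z. ennreal (f2 z) * (g1 (fst z) * g2 (snd z)) \<partial>lborel) = (\<integral>\<^sup>+\<omega>. g1 (Y1 \<omega>) * g2 (Y2 \<omega>) \<partial>M)"
    using distributed_nn_integral[OF f2, of "\<lambda>z. g1 (fst z) * g2 (snd z)"] by simp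
  finally show ?thesis .
qed

lemma nn_integral_lborel_translate:
  fixes f :: "'a::euclidean_space \<Rightarrow> ennreal"
  assumes "f \<in> borel_measurable borel"
  shows "(\<integral>\<^sup>+x. f (x + c) \<partial>lborel) = (\<integral>\<^sup>+x. f x \<partial>lborel)"
proof -
  have "(\<integral>\<^sup>+x. f x \<partial>lborel) = (\<integral>\<^sup>+x. f x \<partial>distr lborel borel ((+) c))"
    by (simp add: lborel_distr_plus)
  also have "\<dots> = (\<integral>\<^sup>+x. f (c + x) \<partial>lborel)"
    using assms by (subst nn_integral_distr) auto
  finally show ?thesis by (simp add: add.commute)
qed

lemma nn_integral_weighted_pair:
  fixes F1 F2 :: "'i \<Rightarrow> 'a \<Rightarrow> ennreal"
  assumes [measurable]: "\<And>i. i \<in> I \<Longrightarrow> F1 i \<in> borel_measurable M"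
      "\<And>i. i \<in> I \<Longrightarrow> F2 i \<in> borel_measurable M" "G \<in> borel_measurable M"
  shows "(\<integral>\<^sup>+\<omega>. (\<Sum>i\<in>I. \<alpha> i * F1 i \<omega>) * (\<Sum>j\<in>I. \<alpha> j * F2 j \<omega>) * G \<omega> \<partial>M)
    = (\<Sum>i\<in>I. \<Sum>j\<in>I. (\<alpha> i * \<alpha> j) * (\<integral>\<^sup>+\<omega>. F1 i \<omega> * F2 j \<omega> * G \<omega> \<partial>M))"
proof -
  have "(\<integral>\<^sup>+\<omega>. (\<Sum>i\<in>I. \<alpha> i * F1 i \<omega>) * (\<Sum>j\<in>I. \<alpha> j * F2 j \<omega>) * G \<omega> \<partial>M)
      = (\<integral>\<^sup>+\<omega>. (\<Sum>i\<in>I. \<Sum>j\<in>I. (\<alpha> i * \<alpha> j) * (F1 i \<omega> * F2 j \<omega> * G \<omega>)) \<partial>M)"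
    unfolding sum_product unfolding sum_distrib_right by (simp only: mult_ac)
  also have "\<dots> = (\<Sum>i\<in>I. \<integral>\<^sup>+\<omega>. (\<Sum>j\<in>I. (\<alpha> i * \<alpha> j) * (F1 i \<omega> * F2 j \<omega> * G \<omega>)) \<partial>M)"
    by (rule nn_integral_sum) measurable
  also have "\<dots> = (\<Sum>i\<in>I. \<Sum>j\<in>I. \<integral>\<^sup>+\<omega>. (\<alpha> i * \<alpha> j) * (F1 i \<omega> * F2 j \<omega> * G \<omega>) \<partial>M)"
    by (intro sum.cong refl nn_integral_sum) measurable
  also have "\<dots> = (\<Sum>i\<in>I. \<Sum>j\<in>I. (\<alpha> i * \<alpha> j) * (\<integral>\<^sup>+\<omega>. F1 i \<omega> * F2 j \<omega> * G \<omega> \<partial>M))"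
    by (intro sum.cong refl nn_integral_cmult) measurable
  finally show ?thesis .
qed

lemma nn_integral_weighted_triple_le:
  fixes F1 F2 F3 :: "'i \<Rightarrow> 'a \<Rightarrow> ennreal"
  assumes meas [measurable]: "\<And>i. i \<in> I \<Longrightarrow> F1 i \<in> borel_measurable M"
      "\<And>i. i \<in> I \<Longrightarrow> F2 i \<in> borel_measurable M" "\<And>i. i \<in> I \<Longrightarrow> F3 i \<in> borel_measurable M"
    and bound: "\<And>i j k. i \<in> I \<Longrightarrow> j \<in> I \<Longrightarrow> k \<in> I \<Longrightarrow>
      (\<integral>\<^sup>+\<omega>. F1 i \<omega> * F2 j \<omega> * F3 k \<omega> \<partial>M) \<le> c * (\<integral>\<^sup>+\<omega>. F1 i \<omega> * F2 j \<omega> \<partial>M)"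
  shows "(\<integral>\<^sup>+\<omega>. (\<Sum>i\<in>I. \<alpha> i * F1 i \<omega>) * (\<Sum>i\<in>I. \<alpha> i * F2 i \<omega>) * (\<Sum>i\<in>I. \<alpha> i * F3 i \<omega>) \<partial>M)
    \<le> c * (\<Sum>i\<in>I. \<alpha> i) * (\<integral>\<^sup>+\<omega>. (\<Sum>i\<in>I. \<alpha> i * F1 i \<omega>) * (\<Sum>i\<in>I. \<alpha> i * F2 i \<omega>) \<partial>M)"
proof -
  define S where "S \<omega> = (\<Sum>i\<in>I. \<alpha> i * F1 i \<omega>) * (\<Sum>i\<in>I. \<alpha> i * F2 i \<omega>)" for \<omega>
  have [measurable]: "S \<in> borel_measurable M" unfolding S_def by measurable
  have S_le: "(\<integral>\<^sup>+\<omega>. S \<omega> * F3 k \<omega> \<partial>M) \<le> c * (\<integral>\<^sup>+\<omega>. S \<omega> \<partial>M)" if k: "k \<in> I" for k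
  proof -
    have "(\<integral>\<^sup>+\<omega>. S \<omega> * F3 k \<omega> \<partial>M) = (\<Sum>i\<in>I. \<Sum>j\<in>I. (\<alpha> i * \<alpha> j) * (\<integral>\<^sup>+\<omega>. F1 i \<omega> * F2 j \<omega> * F3 k \<omega> \<partial>M))"
      unfolding S_def by (rule nn_integral_weighted_pair) (use k in measurable)
    also have "\<dots> \<le> (\<Sum>i\<in>I. \<Sum>j\<in>I. (\<alpha> i * \<alpha> j) * (c * (\<integral>\<^sup>+\<omega>. F1 i \<omega> * F2 j \<omega> \<partial>M)))"
      using k by (intro sum_mono mult_left_mono bound) auto
    also have "\<dots> = c * (\<integral>\<^sup>+\<omega>. S \<omega> \<partial>M)"
      using nn_integral_weighted_pair[of I F1 M F2 "\<lambda>_. 1" \<alpha>] meas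
      by (simp add: S_def sum_distrib_left mult_ac)
    finally show ?thesis .
  qed
  have "(\<integral>\<^sup>+\<omega>. S \<omega> * (\<Sum>k\<in>I. \<alpha> k * F3 k \<omega>) \<partial>M) = (\<Sum>k\<in>I. \<alpha> k * (\<integral>\<^sup>+\<omega>. S \<omega> * F3 k \<omega> \<partial>M))"
    by (simp add: sum_distrib_left mult.left_commute[of "S _"] nn_integral_sum nn_integral_cmult)
  also have "\<dots> \<le> (\<Sum>k\<in>I. \<alpha> k * (c * (\<integral>\<^sup>+\<omega>. S \<omega> \<partial>M)))"
    by (intro sum_mono mult_left_mono S_le) auto
  also have "\<dots> = c * (\<Sum>k\<in>I. \<alpha> k) * (\<integral>\<^sup>+\<omega>. S \<omega> \<partial>M)"
    by (subst sum_distrib_right[symmetric]) (simp only: mult_ac)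
  finally show ?thesis unfolding S_def .
qed

text \<open>
  Off the countable set of atoms \<open>f\<close> may be replaced by \<open>0\<close>, and a function with countable support is
  Borel measurable. The generality in \<open>f\<close> matters because cluster positions at an uncountable family of
  starting points carry no joint measurability.
\<close>

lemma nn_integral_point_measure_sum:
  fixes f :: "'a::{t1_space, topological_space} \<Rightarrow> ennreal" and p :: "nat \<Rightarrow> 'a"
  assumes sets: "sets N = sets borel"
    and N: "\<And>B. B \<in> sets borel \<Longrightarrow> emeasure N B = (\<Sum>n. indicator B (p n))"
  shows "(\<integral>\<^sup>+x. f x \<partial>N) = (\<Sum>n. f (p n))"
proof -
  define g where "g x = f x * indicator (range p) x" for x
  have N_eq: "N = distr (count_space UNIV) borel p"
  proof (rule measure_eqI)
    fix B assume "B \<in> sets N"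
    then have B: "B \<in> sets borel" by (simp add: sets)
    have "emeasure (distr (count_space UNIV) borel p) B = (\<integral>\<^sup>+n. indicator (p -` B) n \<partial>count_space UNIV)"
      using B by (simp add: emeasure_distr)
    then show "emeasure N B = emeasure (distr (count_space UNIV) borel p) B"
      using B by (simp add: N nn_integral_count_space_nat indicator_def)
  qed (simp add: sets)
  have sing: "S \<in> sets (borel :: 'a measure)" if "countable S" for S
    using that by (rule sets.countable[rotated]) auto
  have g_meas: "g \<in> borel_measurable borel"
  proof (rule borel_measurableI_greater)
    fix y
    have "{x \<in> space borel. y < g x} = {x. y < g x \<and> x \<in> range p}"
      by (auto simp: g_def split: split_indicator_asm)
    also have "\<dots> \<in> sets borel"
      by (rule sing, rule countable_subset[of _ "range p"]) auto
    finally show "{x \<in> space borel. y < g x} \<in> sets borel" .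
  qed
  have "emeasure N (- range p) = 0"
    using sing[of "range p"] by (subst N) (auto simp: sets.compl_sets[of _ borel, simplified])
  then have "AE x in N. x \<in> range p"
    using sing[of "range p"] by (intro AE_I'[of "- range p"]) (auto simp: sets sets_eq_imp_space_eq[OF sets])
  then have "(\<integral>\<^sup>+x. f x \<partial>N) = (\<integral>\<^sup>+x. g x \<partial>N)"
    by (intro nn_integral_cong_AE) (auto elim!: eventually_mono simp: g_def)
  also have "\<dots> = (\<Sum>n. g (p n))"
    unfolding N_eq using g_meas by (subst nn_integral_distr) (auto simp: nn_integral_count_space_nat)
  finally show ?thesis by (simp add: g_def)
qed

lemma emeasure_cluster_measure:
  fixes X :: "nat \<Rightarrow> real \<Rightarrow> 'a \<Rightarrow> 'w \<Rightarrow> 'a::topological_space"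
  assumes "B \<in> sets borel"
  shows "emeasure (cluster_measure m a X t x \<omega>) B = (\<Sum>i\<in>{1..m}. ennreal (a i) * indicator B (X i t x \<omega>))"
proof -
  define K where "K = distr (density (count_space {1..m}) (\<lambda>i. ennreal (a i))) borel (\<lambda>i. X i t x \<omega>)"
  have K: "emeasure K C = (\<Sum>i\<in>{1..m}. ennreal (a i) * indicator C (X i t x \<omega>))" if "C \<in> sets borel" for C
  proof -
    have "emeasure K C = (\<integral>\<^sup>+i. ennreal (a i) * indicator ((\<lambda>i. X i t x \<omega>) -` C \<inter> {1..m}) i \<partial>count_space {1..m})"
      unfolding K_def using that by (subst emeasure_distr) (auto simp: emeasure_density)
    also have "\<dots> = (\<Sum>i\<in>{1..m}. ennreal (a i) * indicator C (X i t x \<omega>))"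
      by (subst nn_integral_count_space_finite) (auto intro!: sum.cong split: split_indicator)
    finally show ?thesis .
  qed
  have sp: "space K = UNIV" "sets K = sets borel" by (simp_all add: K_def)
  have "cluster_measure m a X t x \<omega> = measure_of UNIV (sets borel) (emeasure K)"
    unfolding cluster_measure_def
  proof (rule measure_of_eq)
    fix C assume "C \<in> sigma_sets UNIV (sets (borel :: 'a measure))"
    then have "C \<in> sets borel" using sets.sigma_sets_eq[of "borel :: 'a measure"] by simp
    then show "(\<Sum>i\<in>{1..m}. ennreal (a i) * emeasure (return borel (X i t x \<omega>)) C) = emeasure K C"
      by (simp add: K)
  qed simp
  also have "\<dots> = K" using measure_of_of_measure[of K] by (simp add: sp)
  finally show ?thesis using K[OF assms] by simp
qed

text \<open>
  Both sides are \<open>0\<close> when the sum diverges: a nonintegrable function has Bochner integral \<open>0\<close>, and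
  \<open>enn2real \<infinity> = 0\<close>.
\<close>

lemma integral_particle_measure:
  fixes X :: "nat \<Rightarrow> real \<Rightarrow> 'a \<Rightarrow> 'w \<Rightarrow> 'a::{t1_space, topological_space}" and p :: "nat \<Rightarrow> 'a"
  assumes sets: "sets (\<eta> \<omega>) = sets borel"
    and \<eta>: "\<And>B. B \<in> sets borel \<Longrightarrow> emeasure (\<eta> \<omega>) B = (\<Sum>n. indicator B (p n))"
    and \<psi>: "\<psi> \<in> borel_measurable borel" "\<And>y. 0 \<le> \<psi> y" and a: "\<And>i. i \<in> {1..m} \<Longrightarrow> 0 \<le> a i"
  shows "(\<integral>y. \<psi> y \<partial>particle_measure m a \<eta> X t \<omega>)
    = enn2real (\<Sum>n. ennreal (\<Sum>i\<in>{1..m}. a i * \<psi> (X i t (p n) \<omega>)))"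
proof -
  note \<psi>(1)[measurable]
  let ?I = "count_space (UNIV :: nat set) \<Otimes>\<^sub>M count_space {1..m}"
  have I: "?I = count_space (UNIV \<times> {1..m})" by (intro pair_measure_countable) auto
  interpret C: sigma_finite_measure "count_space {1..m}"
    by (rule sigma_finite_measure_count_space_finite) simp
  \<comment> \<open>The particle measure is exhibited as an image of a weighted counting measure, so that it is a measure.\<close>
  define K where "K = distr (density ?I (\<lambda>(n, i). ennreal (a i))) borel (\<lambda>(n, i). X i t (p n) \<omega>)"
  have meas: "h \<in> borel_measurable ?I" for h :: "_ \<Rightarrow> ennreal" unfolding I by simp
  have measX: "(\<lambda>(n, i). X i t (p n) \<omega>) \<in> measurable (density ?I (\<lambda>(n, i). ennreal (a i))) borel"
    unfolding I by simp
  have K_int: "(\<integral>\<^sup>+y. f y \<partial>K) = (\<Sum>n. \<Sum>i\<in>{1..m}. ennreal (a i) * f (X i t (p n) \<omega>))"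
    if "f \<in> borel_measurable borel" for f
  proof -
    have "(\<integral>\<^sup>+y. f y \<partial>K) = (\<integral>\<^sup>+z. (case z of (n, i) \<Rightarrow> ennreal (a i) * f (X i t (p n) \<omega>)) \<partial>?I)"
      unfolding K_def using that measX meas
      by (subst nn_integral_distr, simp, simp, subst nn_integral_density) (auto intro!: nn_integral_cong split: prod.split)
    also have "\<dots> = (\<integral>\<^sup>+n. (\<integral>\<^sup>+i. ennreal (a i) * f (X i t (p n) \<omega>) \<partial>count_space {1..m}) \<partial>count_space UNIV)"
      using C.nn_integral_fst[OF meas, of "\<lambda>(n, i). ennreal (a i) * f (X i t (p n) \<omega>)"] by simp
    also have "\<dots> = (\<Sum>n. \<Sum>i\<in>{1..m}. ennreal (a i) * f (X i t (p n) \<omega>))"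
      by (simp add: nn_integral_count_space_finite nn_integral_count_space_nat)
    finally show ?thesis .
  qed
  have "(\<integral>\<^sup>+x. emeasure (cluster_measure m a X t x \<omega>) B \<partial>\<eta> \<omega>) = emeasure K B" if B: "B \<in> sets borel" for B
  proof -
    have "(\<integral>\<^sup>+x. emeasure (cluster_measure m a X t x \<omega>) B \<partial>\<eta> \<omega>)
        = (\<Sum>n. \<Sum>i\<in>{1..m}. ennreal (a i) * indicator B (X i t (p n) \<omega>))"
      using nn_integral_point_measure_sum[of "\<eta> \<omega>" p, OF sets \<eta>] by (simp add: emeasure_cluster_measure[OF B])
    also have "\<dots> = (\<integral>\<^sup>+y. indicator B y \<partial>K)" using B by (subst K_int) auto
    also have "\<dots> = emeasure K B" using B by (simp add: K_def)
    finally show ?thesis .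
  qed
  note K_emeasure = this
  have sp: "space K = UNIV" "sets K = sets borel" by (simp_all add: K_def)
  have "particle_measure m a \<eta> X t \<omega> = measure_of UNIV (sets borel) (emeasure K)"
    unfolding particle_measure_def
  proof (rule measure_of_eq)
    fix B assume "B \<in> sigma_sets UNIV (sets (borel :: 'a measure))"
    then have "B \<in> sets borel" using sets.sigma_sets_eq[of "borel :: 'a measure"] by simp
    then show "(\<integral>\<^sup>+x. emeasure (cluster_measure m a X t x \<omega>) B \<partial>\<eta> \<omega>) = emeasure K B"
      by (rule K_emeasure)
  qed simp
  also have "\<dots> = K" using measure_of_of_measure[of K] by (simp add: sp)
  finally have "(\<integral>y. \<psi> y \<partial>particle_measure m a \<eta> X t \<omega>) = (\<integral>y. \<psi> y \<partial>K)" by simp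
  also have "\<dots> = enn2real (\<integral>\<^sup>+y. ennreal (\<psi> y) \<partial>K)"
    using \<psi> by (intro integral_eq_nn_integral) (auto simp: K_def)
  also have "(\<integral>\<^sup>+y. ennreal (\<psi> y) \<partial>K) = (\<Sum>n. ennreal (\<Sum>i\<in>{1..m}. a i * \<psi> (X i t (p n) \<omega>)))"
    by (simp only: K_int sum_ennreal_mult[OF a \<psi>(2)] measurable_compose[OF \<psi>(1) measurable_ennreal])
  finally show ?thesis .
qed

section \<open>Laplace transform of the occupation functional\<close>

text \<open>
  A Poisson cluster system with a chosen enumeration \<open>\<xi>\<close> of the atoms, a test function and a time horizon.
  The law of the marks is compared with the cluster started at \<open>0\<close> only through finite-dimensional
  distributions, as the latter is not assumed to be jointly measurable in time. The mark with index \<open>0\<close> serves as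
  the jointly measurable representative of a cluster.
\<close>

locale marked_cluster_system = poisson_cluster_system M m a \<nu> \<eta> X
  for M :: "'w measure" and m a \<nu> \<eta> and X :: "nat \<Rightarrow> real \<Rightarrow> real ^ 'n \<Rightarrow> 'w \<Rightarrow> real ^ 'n" +
  fixes \<xi> :: "nat \<Rightarrow> 'w \<Rightarrow> real ^ 'n" and \<psi> :: "real ^ 'n \<Rightarrow> real" and r b :: real
  assumes \<xi>_measurable [measurable]: "\<And>n. \<xi> n \<in> borel_measurable M"
    and atoms: "AE \<omega> in M. \<forall>B\<in>sets borel. emeasure (\<eta> \<omega>) B = (\<Sum>n. indicator B (\<xi> n \<omega>))"
    and joint: "\<And>n i. i \<in> {1..m} \<Longrightarrow> (\<lambda>(t, \<omega>). X i t (\<xi> n \<omega>) \<omega>)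
               \<in> borel_measurable (restrict_space borel {0..} \<Otimes>\<^sub>M M)"
    and marks_indep: "indep_sets
          (\<lambda>j. case j of None \<Rightarrow> sequence_events M \<xi>
                       | Some n \<Rightarrow> cluster_events M m (\<lambda>i t \<omega>. X i t (\<xi> n \<omega>) \<omega> - \<xi> n \<omega>)) UNIV"
    and marks_law: "\<And>n. cluster_law M m (\<lambda>i t \<omega>. X i t (\<xi> n \<omega>) \<omega> - \<xi> n \<omega>) = cluster_law M m (\<lambda>i t. X i t 0)"
    and \<psi>_measurable [measurable]: "\<psi> \<in> borel_measurable borel"
    and \<psi>_nonneg: "\<And>y. 0 \<le> \<psi> y" and \<psi>_le: "\<And>y. \<psi> y \<le> b"
    and \<psi>_integrable: "(\<integral>\<^sup>+y. ennreal (\<psi> y) \<partial>lborel) < \<infinity>"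
    and r_pos: "0 < r"
begin

definition T :: "real measure" where "T = restrict_space lborel {0..r}"

lemma space_T [simp]: "space T = {0..r}"
  by (simp add: T_def space_restrict_space)

sublocale T: finite_measure T
  by standard (use r_pos in \<open>simp add: T_def emeasure_restrict_space space_restrict_space\<close>)

lemma T_measurable_nonneg: "(\<lambda>t. t) \<in> measurable T (restrict_space borel {0..})"
  unfolding T_def by (intro measurable_restrict_space2 measurable_restrict_space1) (auto simp: space_restrict_space)

lemma measurable_marked_path [measurable (raw)]:
  assumes "i \<in> {1..m}" "f \<in> measurable N T" "g \<in> measurable N M"
  shows "(\<lambda>x. X i (f x) (\<xi> n (g x)) (g x)) \<in> borel_measurable N"
proof -
  have "(\<lambda>x. (f x, g x)) \<in> measurable N (restrict_space borel {0..} \<Otimes>\<^sub>M M)"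
    using measurable_compose[OF assms(2) T_measurable_nonneg] assms(3) by (rule measurable_Pair)
  from measurable_compose[OF this joint[OF assms(1), of n]] show ?thesis by simp
qed

definition displacement :: "nat \<Rightarrow> 'w \<Rightarrow> (nat \<times> real \<Rightarrow> real ^ 'n)" where
  "displacement n = cluster_path m (\<lambda>i t \<omega>. X i t (\<xi> n \<omega>) \<omega> - \<xi> n \<omega>)"

text \<open>
  The \<open>\<psi>\<close>-mass at time \<open>t\<close> of a cluster that starts at \<open>x\<close> and follows the displacement path \<open>y\<close>. For fixed
  \<open>t\<close> it is a measurable function of the path.
\<close>

definition load :: "real \<Rightarrow> real ^ 'n \<Rightarrow> (nat \<times> real \<Rightarrow> real ^ 'n) \<Rightarrow> real" where
  "load t x y = (\<Sum>i\<in>{1..m}. a i * \<psi> (x + y (i, t)))"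

text \<open>
  The load when the displacements of the \<open>n\<close>-th cluster are attached to an arbitrary point \<open>x\<close>, written
  in terms of the sample point rather than the path: in this form it is jointly measurable in \<open>t\<close>, \<open>x\<close>
  and \<open>\<omega>\<close>. At \<open>x = \<xi> n \<omega>\<close> it is the contribution of the \<open>n\<close>-th atom.
\<close>

definition V :: "nat \<Rightarrow> real \<Rightarrow> real ^ 'n \<Rightarrow> 'w \<Rightarrow> real" where
  "V n t x \<omega> = (\<Sum>i\<in>{1..m}. a i * \<psi> (x + (X i t (\<xi> n \<omega>) \<omega> - \<xi> n \<omega>)))"

definition w :: "nat \<Rightarrow> real ^ 'n \<Rightarrow> 'w \<Rightarrow> real" where
  "w n x \<omega> = (\<integral>t. V n t x \<omega> \<partial>T)"

definition load_cap :: real where "load_cap = (\<Sum>i\<in>{1..m}. a i) * b"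

lemma V_eq_load: "t \<in> {0..r} \<Longrightarrow> V n t x \<omega> = load t x (displacement n \<omega>)"
  by (auto simp: V_def load_def displacement_def cluster_path_def intro!: sum.cong)

lemma a_nonneg: "i \<in> {1..m} \<Longrightarrow> 0 \<le> a i"
  using weights by (simp add: less_imp_le)

lemma V_nonneg: "0 \<le> V n t x \<omega>"
  unfolding V_def by (intro sum_nonneg mult_nonneg_nonneg a_nonneg \<psi>_nonneg)

lemma V_le: "V n t x \<omega> \<le> load_cap"
  unfolding V_def load_cap_def sum_distrib_right by (intro sum_mono mult_left_mono a_nonneg \<psi>_le)

lemma measurable_V [measurable (raw)]:
  assumes [measurable]: "f \<in> measurable N T" "h \<in> borel_measurable N" "g \<in> measurable N M"
  shows "(\<lambda>x. V n (f x) (h x) (g x)) \<in> borel_measurable N"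
  unfolding V_def by (intro borel_measurable_sum) measurable

lemma measurable_w [measurable (raw)]:
  assumes [measurable]: "h \<in> borel_measurable N" "g \<in> measurable N M"
  shows "(\<lambda>x. w n (h x) (g x)) \<in> borel_measurable N"
  unfolding w_def by measurable

lemma bounded_process_V: "bounded_process M T (\<lambda>t. V n t x) load_cap"
  by standard (auto simp: V_nonneg V_le split_beta')

lemma w_nonneg: "0 \<le> w n x \<omega>"
  unfolding w_def using V_nonneg by (intro Bochner_Integration.integral_nonneg) auto

lemma exp_w_integrable: "0 \<le> u \<Longrightarrow> integrable M (\<lambda>\<omega>. exp (- (u * w n x \<omega>)))"
  using w_nonneg by (intro integrable_bounded_real[where B=1]) auto

lemma measurable_load:
  assumes "0 \<le> t" "h \<in> borel_measurable N" "g \<in> measurable N (cluster_paths m)"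
  shows "(\<lambda>x. load t (h x) (g x)) \<in> borel_measurable N"
  unfolding load_def
proof (intro borel_measurable_sum borel_measurable_times)
  fix i assume "i \<in> {1..m}"
  then have "(\<lambda>y. y (i, t)) \<in> borel_measurable (cluster_paths m)"
    using assms(1) unfolding cluster_paths_def by (intro measurable_component_singleton) auto
  note [measurable] = measurable_compose[OF assms(3) this] assms(2)
  show "(\<lambda>x. \<psi> (h x + g x (i, t))) \<in> borel_measurable N" by measurable
qed auto

lemma displacement_measurable: "displacement n \<in> measurable M (cluster_paths m)"
proof -
  have "(\<lambda>\<omega>. X i t (\<xi> n \<omega>) \<omega>) \<in> borel_measurable M" if "i \<in> {1..m}" "0 \<le> t" for i t
  proof -
    have "(\<lambda>\<omega>. (t, \<omega>)) \<in> measurable M (restrict_space borel {0..} \<Otimes>\<^sub>M M)"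
      using that(2) by (intro measurable_Pair) (auto simp: space_restrict_space)
    from measurable_compose[OF this joint[OF that(1), of n]] show ?thesis by simp
  qed
  then show ?thesis
    unfolding displacement_def cluster_paths_def cluster_path_def[abs_def]
    by (intro measurable_restrict) (auto intro!: borel_measurable_diff)
qed

lemma law_of_displacement: "distr M (cluster_paths m) (displacement n) = distr M (cluster_paths m) (displacement 0)"
  using marks_law[of n] marks_law[of 0] by (simp add: cluster_law_def displacement_def)

definition L :: "real \<Rightarrow> real ^ 'n \<Rightarrow> real" where
  "L u x = (\<integral>\<omega>. exp (- (u * w 0 x \<omega>)) \<partial>M)"

lemma measurable_L [measurable]: "L u \<in> borel_measurable borel"
  unfolding L_def by measurable

lemma laplace_w: "(\<integral>\<omega>. exp (- (u * w n x \<omega>)) \<partial>M) = L u x"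
  unfolding L_def w_def
proof (rule laplace_eq_of_moments[OF bounded_process_V bounded_process_V])
  fix ts assume ts: "set ts \<subseteq> space T"
  have meas: "(\<lambda>y. \<Prod>t\<leftarrow>ts. load t x y) \<in> borel_measurable (cluster_paths m)"
    using ts by (intro borel_measurable_prod_list measurable_load) auto
  have eq: "(\<integral>\<omega>. (\<Prod>t\<leftarrow>ts. V k t x \<omega>) \<partial>M)
      = (\<integral>y. (\<Prod>t\<leftarrow>ts. load t x y) \<partial>distr M (cluster_paths m) (displacement k))" for k
  proof -
    have "(\<Prod>t\<leftarrow>ts. V k t x \<omega>) = (\<Prod>t\<leftarrow>ts. load t x (displacement k \<omega>))" for \<omega>
      by (rule arg_cong[where f=prod_list]) (use ts in \<open>auto simp: V_eq_load\<close>)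
    then show ?thesis
      using meas displacement_measurable by (simp add: integral_distr)
  qed
  show "(\<integral>\<omega>. (\<Prod>t\<leftarrow>ts. V n t x \<omega>) \<partial>M) = (\<integral>\<omega>. (\<Prod>t\<leftarrow>ts. V 0 t x \<omega>) \<partial>M)"
    unfolding eq law_of_displacement[of n] ..
qed

text \<open>
  The atoms and the clusters take values in different spaces. Independence is therefore used in the form
  of independent identity maps from \<open>M\<close> into coarser sigma-algebras on the same space, so that product
  measures of these maps make sense.
\<close>

definition mark_algebra :: "nat option \<Rightarrow> 'w measure" where
  "mark_algebra j = (case j of
      None \<Rightarrow> vimage_algebra (space M) (\<lambda>\<omega> n. \<xi> n \<omega>) (\<Pi>\<^sub>M n\<in>UNIV. borel)
    | Some n \<Rightarrow> vimage_algebra (space M) (displacement n) (cluster_paths m))"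

lemma space_mark_algebra: "space (mark_algebra j) = space M"
  by (simp add: mark_algebra_def split: option.split)

lemma sets_mark_algebra: "sets (mark_algebra j) =
    (case j of None \<Rightarrow> sequence_events M \<xi>
       | Some n \<Rightarrow> cluster_events M m (\<lambda>i t \<omega>. X i t (\<xi> n \<omega>) \<omega> - \<xi> n \<omega>))"
  by (simp add: mark_algebra_def sequence_events_def cluster_events_def displacement_def split: option.split)

lemma mark_algebra_measurable: "(\<lambda>\<omega>. \<omega>) \<in> measurable M (mark_algebra j)"
proof (rule measurableI)
  show "\<omega> \<in> space (mark_algebra j)" if "\<omega> \<in> space M" for \<omega>
    using that by (simp add: space_mark_algebra)
  fix A assume "A \<in> sets (mark_algebra j)"
  moreover have "sets (mark_algebra j) \<subseteq> events"
    using marks_indep unfolding indep_sets_def sets_mark_algebra by blast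
  ultimately have "A \<in> events" by blast
  then show "(\<lambda>\<omega>. \<omega>) -` A \<inter> space M \<in> events"
    unfolding vimage_ident by (simp only: sets.Int_space_eq2)
qed

lemma mark_algebra_indep: "indep_vars mark_algebra (\<lambda>_ \<omega>. \<omega>) UNIV"
  unfolding indep_vars_def
proof (intro conjI ballI mark_algebra_measurable)
  have "sigma_sets (space M) {(\<lambda>\<omega>. \<omega>) -` A \<inter> space M |A. A \<in> sets (mark_algebra j)} = sets (mark_algebra j)" for j
  proof -
    have "{(\<lambda>\<omega>. \<omega>) -` A \<inter> space M |A. A \<in> sets (mark_algebra j)} = sets (mark_algebra j)"
    proof -
      have "A \<inter> space M = A" if "A \<in> sets (mark_algebra j)" for A
        using sets.sets_into_space[OF that] by (auto simp: space_mark_algebra)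
      then have "(\<lambda>A. A \<inter> space M) ` sets (mark_algebra j) = (\<lambda>A. A) ` sets (mark_algebra j)"
        by (rule image_cong[OF refl])
      then show ?thesis unfolding vimage_ident by (simp only: image_ident Setcompr_eq_image)
    qed
    then show ?thesis
      using sets.sigma_sets_eq[of "mark_algebra j"] by (simp add: space_mark_algebra)
  qed
  then show "indep_sets (\<lambda>j. sigma_sets (space M) {(\<lambda>\<omega>. \<omega>) -` A \<inter> space M |A. A \<in> sets (mark_algebra j)}) UNIV"
    using marks_indep by (simp add: sets_mark_algebra)
qed

text \<open>
  Independence as decoupling: a function that sees each coordinate only through its own sigma-algebra has
  the same expectation on the diagonal as on independent copies of the whole space.
\<close>

lemma decoupling:
  fixes q :: "(nat option \<Rightarrow> 'w) \<Rightarrow> real"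
  assumes I: "finite I" "I \<noteq> {}" and q: "q \<in> borel_measurable (PiM I mark_algebra)"
  shows "(\<integral>\<omega>. q (\<lambda>j\<in>I. \<omega>) \<partial>M) = (\<integral>z. q z \<partial>PiM I (\<lambda>_. M))"
proof -
  define N where "N j = distr M (mark_algebra j) (\<lambda>\<omega>. \<omega>)" for j
  have N_prob: "prob_space (N j)" for j
    unfolding N_def by (rule prob_space_distr[OF mark_algebra_measurable])
  have sets_N: "sets (N j) = sets (mark_algebra j)" for j by (simp add: N_def)
  have N_meas: "(\<lambda>\<omega>. \<omega>) \<in> measurable M (N j)" for j
    using mark_algebra_measurable[of j] measurable_cong_sets[OF refl sets_N] by blast
  have sets_PiM_N: "sets (PiM I N) = sets (PiM I mark_algebra)"
    by (rule sets_PiM_cong) (auto simp: sets_N)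
  have qN: "q \<in> borel_measurable (PiM I N)"
    using q measurable_cong_sets[OF sets_PiM_N refl] by blast
  have ind: "indep_vars N (\<lambda>_ \<omega>. \<omega>) I"
    using indep_vars_subset[OF mark_algebra_indep subset_UNIV]
    unfolding indep_vars_def by (auto simp: sets_N N_meas)
  have meas1: "(\<lambda>\<omega>. \<lambda>j\<in>I. \<omega>) \<in> measurable M (PiM I N)"
    by (intro measurable_restrict N_meas)
  have meas2: "compose I (\<lambda>\<omega>. \<omega>) \<in> measurable (PiM I (\<lambda>_. M)) (PiM I N)"
    unfolding compose_def
  proof (rule measurable_restrict)
    show "(\<lambda>z. z j) \<in> measurable (PiM I (\<lambda>_. M)) (N j)" if "j \<in> I" for j
      using measurable_compose[OF measurable_component_singleton[OF that, of "\<lambda>_. M"] N_meas[of j]] .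
  qed
  have "(\<integral>\<omega>. q (\<lambda>j\<in>I. \<omega>) \<partial>M) = (\<integral>z. q z \<partial>distr M (PiM I N) (\<lambda>\<omega>. \<lambda>j\<in>I. \<omega>))"
    using meas1 qN by (subst integral_distr) auto
  also have "distr M (PiM I N) (\<lambda>\<omega>. \<lambda>j\<in>I. \<omega>) = PiM I (\<lambda>j. distr M (N j) (\<lambda>\<omega>. \<omega>))"
    using ind indep_vars_iff_distr_eq_PiM'[OF I(2), where M'=N and X="\<lambda>_ \<omega>. \<omega>"] N_meas by blast
  also have "\<dots> = distr (PiM I (\<lambda>_. M)) (PiM I N) (compose I (\<lambda>\<omega>. \<omega>))"
    by (rule distr_PiM_finite_prob_space'[symmetric, OF I(1) prob_space_axioms N_prob N_meas])
  also have "(\<integral>z. q z \<partial>\<dots>) = (\<integral>z. q (compose I (\<lambda>\<omega>. \<omega>) z) \<partial>PiM I (\<lambda>_. M))"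
    using meas2 qN by (subst integral_distr) auto
  also have "\<dots> = (\<integral>z. q z \<partial>PiM I (\<lambda>_. M))"
  proof (intro Bochner_Integration.integral_cong refl arg_cong[where f=q])
    fix z assume "z \<in> space (PiM I (\<lambda>_. M))"
    then have "z \<in> extensional I" by (auto simp: space_PiM PiE_def)
    then show "compose I (\<lambda>\<omega>. \<omega>) z = z"
      by (auto simp: compose_def fun_eq_iff extensional_def)
  qed
  finally show ?thesis .
qed

text \<open>
  A finite sum of the \<open>W\<^sub>n\<close> is the time integral of a single bounded process \<open>S\<close>. Decoupling its values at
  finitely many times gives a process \<open>S'\<close> on a product space with the same joint moments, in which the
  atoms and the clusters live on separate coordinates. There the expectation over the clusters factorizes
  by Fubini's theorem.
\<close>

lemma laplace_finite_sum:
  assumes u: "0 \<le> u"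
  shows "(\<integral>\<omega>. (\<Prod>n<N. exp (- (u * w n (\<xi> n \<omega>) \<omega>))) \<partial>M) = (\<integral>\<omega>. (\<Prod>n<N. L u (\<xi> n \<omega>)) \<partial>M)"
proof -
  define J where "J = Some ` {..<N}"
  define I where "I = insert None J"
  have I: "finite I" "I \<noteq> {}" "None \<in> I" "\<And>n. n < N \<Longrightarrow> Some n \<in> I"
    and J: "finite J" "None \<notin> J" by (auto simp: I_def J_def)
  define PM where "PM = PiM I (\<lambda>_. M)"
  have comp [measurable]: "(\<lambda>z. z j) \<in> measurable PM M" if "j \<in> I" for j
    using that unfolding PM_def by (rule measurable_component_singleton)
  interpret PM: prob_space PM
    unfolding PM_def by (rule prob_space_PiM) (rule prob_space_axioms)
  interpret F: product_sigma_finite "\<lambda>_ :: nat option. M"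
    by standard
  define S where "S t \<omega> = (\<Sum>n<N. V n t (\<xi> n \<omega>) \<omega>)" for t \<omega>
  define S' where "S' t z = (\<Sum>n<N. V n t (\<xi> n (z None)) (z (Some n)))" for t z
  have bS: "bounded_process M T S (real N * load_cap)"
  proof
    show "case_prod S \<in> borel_measurable (T \<Otimes>\<^sub>M M)"
      unfolding S_def split_beta' by measurable
    show "S t \<omega> \<le> real N * load_cap" for t \<omega>
      unfolding S_def using sum_mono[of "{..<N}" "\<lambda>n. V n t (\<xi> n \<omega>) \<omega>" "\<lambda>_. load_cap"] V_le by simp
  qed (auto simp: S_def V_nonneg intro: sum_nonneg)
  have bS': "bounded_process PM T S' (real N * load_cap)"
  proof
    have snd_comp: "(\<lambda>x. snd x j) \<in> measurable (T \<Otimes>\<^sub>M PM) M" if "j \<in> I" for j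
      using measurable_compose[OF measurable_snd comp[OF that]] .
    show "case_prod S' \<in> borel_measurable (T \<Otimes>\<^sub>M PM)"
      unfolding S'_def split_beta'
      by (intro borel_measurable_sum measurable_V measurable_fst measurable_compose[OF _ \<xi>_measurable] snd_comp)
        (use I in auto)
    show "S' t z \<le> real N * load_cap" for t z
      unfolding S'_def using sum_mono[of "{..<N}" "\<lambda>n. V n t (\<xi> n (z None)) (z (Some n))" "\<lambda>_. load_cap"] V_le by simp
  qed (auto simp: S'_def V_nonneg intro: sum_nonneg)
  have moments: "(\<integral>\<omega>. (\<Prod>t\<leftarrow>ts. S t \<omega>) \<partial>M) = (\<integral>z. (\<Prod>t\<leftarrow>ts. S' t z) \<partial>PM)" if ts: "set ts \<subseteq> space T" for ts
  proof -
    \<comment> \<open>At fixed times the loads are functions of the paths, hence of the coordinates in their own sigma-algebras.\<close>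
    define q where "q z = (\<Prod>t\<leftarrow>ts. \<Sum>n<N. load t (\<xi> n (z None)) (displacement n (z (Some n))))" for z
    have \<xi>_mark: "\<xi> n \<in> borel_measurable (mark_algebra None)" for n
    proof -
      have "(\<lambda>\<omega> n. \<xi> n \<omega>) \<in> measurable (mark_algebra None) (\<Pi>\<^sub>M n\<in>UNIV. borel)"
        unfolding mark_algebra_def by (auto intro!: measurable_vimage_algebra1 simp: space_PiM)
      from measurable_compose[OF this measurable_component_singleton[of n]] show ?thesis by simp
    qed
    have d_mark: "displacement n \<in> measurable (mark_algebra (Some n)) (cluster_paths m)" for n
      unfolding mark_algebra_def using measurable_space[OF displacement_measurable]
      by (auto intro!: measurable_vimage_algebra1)
    have load_mark: "(\<lambda>z. load t (\<xi> n (z None)) (displacement n (z (Some n)))) \<in> borel_measurable (PiM I mark_algebra)"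
      if "0 \<le> t" "n < N" for t n
      using measurable_compose[OF measurable_component_singleton[OF I(3), of mark_algebra] \<xi>_mark[of n]]
        measurable_compose[OF measurable_component_singleton[OF I(4)[OF that(2)], of mark_algebra] d_mark[of n]] that(1)
      by (intro measurable_load)
    have q_meas: "q \<in> borel_measurable (PiM I mark_algebra)"
      unfolding q_def using ts
      by (intro borel_measurable_prod_list borel_measurable_sum load_mark) auto
    have "(\<Prod>t\<leftarrow>ts. S t \<omega>) = q (\<lambda>j\<in>I. \<omega>)" for \<omega>
    proof -
      have "S t \<omega> = (\<Sum>n<N. load t (\<xi> n ((\<lambda>j\<in>I. \<omega>) None)) (displacement n ((\<lambda>j\<in>I. \<omega>) (Some n))))"
        if "t \<in> set ts" for t
        unfolding S_def using that ts I(3,4) by (intro sum.cong refl) (auto simp: V_eq_load)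
      then show ?thesis unfolding q_def by (intro arg_cong[where f=prod_list] map_cong[OF refl])
    qed
    moreover have "(\<Prod>t\<leftarrow>ts. S' t z) = q z" for z
    proof -
      have "S' t z = (\<Sum>n<N. load t (\<xi> n (z None)) (displacement n (z (Some n))))"
        if "t \<in> set ts" for t
        unfolding S'_def using that ts by (intro sum.cong refl) (auto simp: V_eq_load)
      then show ?thesis unfolding q_def by (intro arg_cong[where f=prod_list] map_cong[OF refl])
    qed
    ultimately show ?thesis
      using decoupling[OF I(1,2) q_meas] by (simp add: PM_def)
  qed
  have V_int: "integrable T (\<lambda>t. V n t x \<omega>)" if "\<omega> \<in> space M" for n x \<omega>
    by (rule bounded_process.integrable_Z[OF bounded_process_V that])
  have S_int: "(\<integral>t. S t \<omega> \<partial>T) = (\<Sum>n<N. w n (\<xi> n \<omega>) \<omega>)" if "\<omega> \<in> space M" for \<omega>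
    unfolding S_def w_def using that by (simp add: V_int)
  have S'_int: "(\<integral>t. S' t z \<partial>T) = (\<Sum>n<N. w n (\<xi> n (z None)) (z (Some n)))" if "z \<in> space PM" for z
  proof -
    have "z (Some n) \<in> space M" if "n < N" for n
      using \<open>z \<in> space PM\<close> I(4)[OF that] by (auto simp: PM_def space_PiM)
    then show ?thesis unfolding S'_def w_def by (simp add: V_int)
  qed
  have prod_exp: "(\<Prod>n<N. exp (- (u * c n))) = exp (- (u * (\<Sum>n<N. c n)))" for c :: "nat \<Rightarrow> real"
    unfolding sum_distrib_left sum_negf[symmetric] by (rule exp_sum[symmetric]) simp
  have wz [measurable]: "(\<lambda>z. w n (\<xi> n (z None)) (z (Some n))) \<in> borel_measurable PM" if "n < N" for n
    by (intro measurable_w measurable_compose[OF comp \<xi>_measurable] comp) (use I that in auto)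
  have "(\<integral>\<omega>. (\<Prod>n<N. exp (- (u * w n (\<xi> n \<omega>) \<omega>))) \<partial>M) = (\<integral>\<omega>. exp (- (u * (\<integral>t. S t \<omega> \<partial>T))) \<partial>M)"
    by (intro Bochner_Integration.integral_cong refl) (simp add: prod_exp S_int)
  also have "\<dots> = (\<integral>z. exp (- (u * (\<integral>t. S' t z \<partial>T))) \<partial>PM)"
    by (rule laplace_eq_of_moments[OF bS bS' moments])
  also have "\<dots> = (\<integral>z. (\<Prod>n<N. exp (- (u * w n (\<xi> n (z None)) (z (Some n))))) \<partial>PM)"
    by (intro Bochner_Integration.integral_cong refl) (simp add: prod_exp S'_int)
  also have "\<dots> = enn2real (\<integral>\<^sup>+z. (\<Prod>n<N. ennreal (exp (- (u * w n (\<xi> n (z None)) (z (Some n)))))) \<partial>PM)"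
  proof (subst integral_eq_nn_integral)
    show "(\<lambda>z. \<Prod>n<N. exp (- (u * w n (\<xi> n (z None)) (z (Some n))))) \<in> borel_measurable PM"
      by (intro borel_measurable_prod) simp
  qed (auto intro!: prod_nonneg simp: prod_ennreal)
  also have "(\<integral>\<^sup>+z. (\<Prod>n<N. ennreal (exp (- (u * w n (\<xi> n (z None)) (z (Some n)))))) \<partial>PM)
      = (\<integral>\<^sup>+y. (\<integral>\<^sup>+z. (\<Prod>n<N. ennreal (exp (- (u * w n (\<xi> n y) (z (Some n)))))) \<partial>PiM J (\<lambda>_. M)) \<partial>M)"
  proof -
    have "(\<lambda>z. \<Prod>n<N. ennreal (exp (- (u * w n (\<xi> n (z None)) (z (Some n)))))) \<in> borel_measurable PM"
      by (intro borel_measurable_prod_ennreal) simp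
    from F.product_nn_integral_insert_rev[OF J this[unfolded PM_def I_def]] J show ?thesis
      by (simp add: PM_def I_def)
  qed
  also have "\<dots> = (\<integral>\<^sup>+y. (\<Prod>n<N. ennreal (L u (\<xi> n y))) \<partial>M)"
  proof (intro nn_integral_cong)
    fix y
    define f where "f j \<omega> = ennreal (exp (- (u * w (the j) (\<xi> (the j) y) \<omega>)))" for j \<omega>
    have [measurable]: "f j \<in> borel_measurable M" for j unfolding f_def by measurable
    have "(\<integral>\<^sup>+z. (\<Prod>n<N. ennreal (exp (- (u * w n (\<xi> n y) (z (Some n)))))) \<partial>PiM J (\<lambda>_. M))
        = (\<integral>\<^sup>+z. (\<Prod>j\<in>J. f j (z j)) \<partial>PiM J (\<lambda>_. M))"
      unfolding J_def f_def by (simp add: prod.reindex)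
    also have "\<dots> = (\<Prod>j\<in>J. \<integral>\<^sup>+\<omega>. f j \<omega> \<partial>M)"
      using J by (intro F.product_nn_integral_prod) auto
    also have "\<dots> = (\<Prod>n<N. ennreal (L u (\<xi> n y)))"
      unfolding J_def f_def
      by (simp add: prod.reindex nn_integral_eq_integral exp_w_integrable u laplace_w)
    finally show "(\<integral>\<^sup>+z. (\<Prod>n<N. ennreal (exp (- (u * w n (\<xi> n y) (z (Some n)))))) \<partial>PiM J (\<lambda>_. M))
        = (\<Prod>n<N. ennreal (L u (\<xi> n y)))" .
  qed
  also have "enn2real (\<integral>\<^sup>+y. (\<Prod>n<N. ennreal (L u (\<xi> n y))) \<partial>M) = (\<integral>\<omega>. (\<Prod>n<N. L u (\<xi> n \<omega>)) \<partial>M)"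
  proof -
    have "0 \<le> L u x" for x unfolding L_def by (intro Bochner_Integration.integral_nonneg) auto
    then show ?thesis
      by (subst integral_eq_nn_integral) (auto intro!: prod_nonneg simp: prod_ennreal)
  qed
  finally show ?thesis .
qed

lemma sets_\<nu> [simp, measurable_cong]: "sets \<nu> = sets borel"
  using intensity by auto

lemma sigma_finite_\<nu>: "sigma_finite_measure \<nu>"
proof -
  obtain p c C where p: "p \<in> borel_measurable borel" "\<nu> = density lborel (\<lambda>x. ennreal (p x))"
    using intensity by auto
  show ?thesis
    unfolding p(2) using p(1) by (subst sigma_finite_measure.sigma_finite_iff_density_finite[OF sigma_finite_lborel]) auto
qed

text \<open>
  The upper bound on the intensity makes the mean mass that the whole system collects finite.
\<close>

lemma \<nu>_le_lebesgue:
  obtains C where "0 \<le> C"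
    "\<And>f. f \<in> borel_measurable borel \<Longrightarrow> (\<integral>\<^sup>+x. f x \<partial>\<nu>) \<le> ennreal C * (\<integral>\<^sup>+x. f x \<partial>lborel)"
proof -
  obtain p c C where p [measurable]: "p \<in> borel_measurable borel" and c: "0 < c"
    and bounds: "\<And>x. c \<le> p x \<and> p x \<le> C" and \<nu>: "\<nu> = density lborel (\<lambda>x. ennreal (p x))"
    using intensity by auto
  have "(\<integral>\<^sup>+x. f x \<partial>\<nu>) \<le> ennreal C * (\<integral>\<^sup>+x. f x \<partial>lborel)" if [measurable]: "f \<in> borel_measurable borel" for f
  proof -
    have "(\<integral>\<^sup>+x. f x \<partial>\<nu>) = (\<integral>\<^sup>+x. ennreal (p x) * f x \<partial>lborel)"
      unfolding \<nu> by (subst nn_integral_density) auto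
    also have "\<dots> \<le> (\<integral>\<^sup>+x. ennreal C * f x \<partial>lborel)"
      using bounds by (intro nn_integral_mono mult_right_mono ennreal_leI) auto
    finally show ?thesis by (simp add: nn_integral_cmult)
  qed
  moreover have "0 \<le> C" using bounds[of undefined] c by linarith
  ultimately show thesis by (rule that[rotated])
qed

sublocale \<nu>: sigma_finite_measure \<nu> by (rule sigma_finite_\<nu>)
sublocale \<nu>M: pair_sigma_finite \<nu> M ..
sublocale T\<nu>: pair_sigma_finite T \<nu> ..

abbreviation Q :: "((real ^ 'n) \<times> 'w) measure" where "Q \<equiv> \<nu> \<Otimes>\<^sub>M M"

definition wQ :: "(real ^ 'n) \<times> 'w \<Rightarrow> real" where "wQ q = w 0 (fst q) (snd q)"

definition total_load :: "'w \<Rightarrow> ennreal" where "total_load \<omega> = (\<Sum>n. ennreal (w n (\<xi> n \<omega>) \<omega>))"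

lemma w_le: "w n x \<omega> \<le> load_cap * measure T (space T)"
  using bounded_process.W_le[OF bounded_process_V, of n x \<omega>]
  by (simp add: bounded_process.W_def[OF bounded_process_V] w_def)

lemma w_nn: "\<omega> \<in> space M \<Longrightarrow> ennreal (w n x \<omega>) = (\<integral>\<^sup>+t. ennreal (V n t x \<omega>) \<partial>T)"
  using bounded_process.W_nn[OF bounded_process_V, of \<omega> n x]
  by (simp add: bounded_process.W_def[OF bounded_process_V] w_def)

lemma measurable_total_load [measurable]: "total_load \<in> borel_measurable M"
  unfolding total_load_def by measurable

lemma measurable_wQ [measurable]: "wQ \<in> borel_measurable Q"
  unfolding wQ_def by measurable

text \<open>
  Integrating the starting point first removes the displacement by translation invariance, and leaves
  \<open>\<integral> \<psi>\<close> for each particle and time.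
\<close>

lemma wQ_integrable: "integrable Q wQ"
proof (rule integrableI_nonneg)
  obtain C where C: "0 \<le> C"
    "\<And>f. f \<in> borel_measurable borel \<Longrightarrow> (\<integral>\<^sup>+x. f x \<partial>\<nu>) \<le> ennreal C * (\<integral>\<^sup>+x. f x \<partial>lborel)"
    using \<nu>_le_lebesgue by blast
  define D where "D = ennreal C * (\<Sum>i\<in>{1..m}. ennreal (a i) * (\<integral>\<^sup>+y. ennreal (\<psi> y) \<partial>lborel))"
  have D: "D < \<infinity>"
    using \<psi>_integrable by (simp add: D_def ennreal_mult_less_top)
  have V_bound: "(\<integral>\<^sup>+x. ennreal (V 0 t x \<omega>) \<partial>\<nu>) \<le> D" for t \<omega>
  proof -
    have "(\<integral>\<^sup>+x. ennreal (V 0 t x \<omega>) \<partial>lborel)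
        = (\<integral>\<^sup>+x. (\<Sum>i\<in>{1..m}. ennreal (a i) * ennreal (\<psi> (x + (X i t (\<xi> 0 \<omega>) \<omega> - \<xi> 0 \<omega>)))) \<partial>lborel)"
      unfolding V_def by (intro nn_integral_cong sum_ennreal_mult[symmetric] a_nonneg \<psi>_nonneg)
    also have "\<dots> = (\<Sum>i\<in>{1..m}. ennreal (a i) * (\<integral>\<^sup>+y. ennreal (\<psi> y) \<partial>lborel))"
      using nn_integral_lborel_translate[of "\<lambda>y. ennreal (\<psi> y)"]
      by (subst nn_integral_sum) (auto simp: nn_integral_cmult)
    finally have "ennreal C * (\<integral>\<^sup>+x. ennreal (V 0 t x \<omega>) \<partial>lborel) = D" by (simp add: D_def)
    moreover have "(\<lambda>x. ennreal (V 0 t x \<omega>)) \<in> borel_measurable borel" unfolding V_def by measurable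
    ultimately show ?thesis using C(2)[of "\<lambda>x. ennreal (V 0 t x \<omega>)"] by simp
  qed
  have "(\<integral>\<^sup>+q. ennreal (wQ q) \<partial>Q) = (\<integral>\<^sup>+\<omega>. (\<integral>\<^sup>+x. ennreal (w 0 x \<omega>) \<partial>\<nu>) \<partial>M)"
    by (subst \<nu>M.nn_integral_snd[symmetric]) (auto simp: wQ_def)
  also have "\<dots> = (\<integral>\<^sup>+\<omega>. (\<integral>\<^sup>+x. (\<integral>\<^sup>+t. ennreal (V 0 t x \<omega>) \<partial>T) \<partial>\<nu>) \<partial>M)"
    by (intro nn_integral_cong) (simp add: w_nn)
  also have "\<dots> = (\<integral>\<^sup>+\<omega>. (\<integral>\<^sup>+t. (\<integral>\<^sup>+x. ennreal (V 0 t x \<omega>) \<partial>\<nu>) \<partial>T) \<partial>M)"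
    by (intro nn_integral_cong T\<nu>.Fubini') measurable
  also have "\<dots> \<le> (\<integral>\<^sup>+\<omega>. (\<integral>\<^sup>+t. D \<partial>T) \<partial>M)"
    by (intro nn_integral_mono V_bound)
  also have "\<dots> = D * emeasure T (space T)"
    by (simp add: emeasure_space_1)
  also have "\<dots> < \<infinity>"
  proof -
    have "emeasure T (space T) < \<infinity>" using T.emeasure_finite by (simp only: less_top infinity_ennreal_def)
    with D show ?thesis by (simp only: ennreal_mult_less_top infinity_ennreal_def simp_thms)
  qed
  finally show "(\<integral>\<^sup>+q. ennreal (wQ q) \<partial>Q) < \<infinity>" .
qed (auto simp: wQ_def w_nonneg)

lemma L_le_1: "0 \<le> u \<Longrightarrow> L u x \<le> 1"
  unfolding L_def using w_nonneg by (intro integral_le_const exp_w_integrable) auto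

lemma L_pos:
  assumes "0 \<le> u"
  shows "0 < L u x"
proof -
  have "exp (- (u * (load_cap * measure T (space T)))) \<le> L u x"
    unfolding L_def using assms w_le
    by (intro integral_ge_const exp_w_integrable AE_I2) (auto intro: mult_left_mono)
  then show ?thesis using exp_gt_zero less_le_trans by blast
qed

lemma nn_integral_one_minus_L:
  assumes "0 < u"
  shows "(\<integral>\<^sup>+x. ennreal (1 - L u x) \<partial>\<nu>) = ennreal (\<integral>q. 1 - exp (- (u * wQ q)) \<partial>Q)"
proof -
  have int: "integrable Q (\<lambda>q. 1 - exp (- (u * wQ q)))"
  proof (rule Bochner_Integration.integrable_bound)
    show "integrable Q (\<lambda>q. u * wQ q)" using wQ_integrable by simp
    show "AE q in Q. norm (1 - exp (- (u * wQ q))) \<le> norm (u * wQ q)"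
      using one_minus_exp_bounds[of "u * wQ q" for q] w_nonneg assms by (simp add: wQ_def)
  qed measurable
  have "ennreal (1 - L u x) = (\<integral>\<^sup>+\<omega>. ennreal (1 - exp (- (u * w 0 x \<omega>))) \<partial>M)" for x
  proof -
    have "1 - L u x = (\<integral>\<omega>. 1 - exp (- (u * w 0 x \<omega>)) \<partial>M)"
      using exp_w_integrable[of u 0 x] assms by (simp add: L_def prob_space)
    also have "ennreal \<dots> = (\<integral>\<^sup>+\<omega>. ennreal (1 - exp (- (u * w 0 x \<omega>))) \<partial>M)"
      using exp_w_integrable[of u 0 x] assms w_nonneg
      by (intro nn_integral_eq_integral[symmetric]) auto
    finally show ?thesis .
  qed
  then have "(\<integral>\<^sup>+x. ennreal (1 - L u x) \<partial>\<nu>) = (\<integral>\<^sup>+x. (\<integral>\<^sup>+\<omega>. ennreal (1 - exp (- (u * wQ (x, \<omega>)))) \<partial>M) \<partial>\<nu>)"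
    by (simp add: wQ_def)
  also have "\<dots> = (\<integral>\<^sup>+q. ennreal (1 - exp (- (u * wQ q))) \<partial>Q)"
    by (rule nn_integral_fst) measurable
  also have "\<dots> = ennreal (\<integral>q. 1 - exp (- (u * wQ q)) \<partial>Q)"
    using assms w_nonneg by (intro nn_integral_eq_integral int) (auto simp: wQ_def)
  finally show ?thesis .
qed

lemma sets_\<eta>: "\<omega> \<in> space M \<Longrightarrow> sets (\<eta> \<omega>) = sets borel"
  using poisson by (simp add: poisson_random_measure_def)

text \<open>
  Conditionally on the atoms the product of the factors \<open>exp (- u W\<^sub>n)\<close> averages to the product of
  \<open>L u (\<xi>\<^sub>n) = exp (- G (\<xi>\<^sub>n))\<close>, which is \<open>exp (- \<integral> G d\<eta>)\<close>. The Laplace functional of \<open>\<eta>\<close> evaluates its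
  mean.
\<close>

lemma laplace_total_load:
  assumes u: "0 < u"
  shows "(\<integral>\<omega>. neg_exp (ennreal u * total_load \<omega>) \<partial>M) = exp (- (\<integral>q. 1 - exp (- (u * wQ q)) \<partial>Q))"
proof -
  define G where "G x = ennreal (- ln (L u x))" for x
  have u0: "0 \<le> u" using u by simp
  have [measurable]: "G \<in> borel_measurable borel" unfolding G_def by measurable
  have neg_exp_G: "neg_exp (G x) = L u x" for x
    using L_pos[OF u0, of x] L_le_1[OF u0, of x] by (simp add: G_def ln_le_zero_iff)
  have lim: "(\<lambda>N. \<integral>\<omega>. (\<Prod>n<N. neg_exp (c n \<omega>)) \<partial>M) \<longlonglongrightarrow> (\<integral>\<omega>. neg_exp (\<Sum>n. c n \<omega>) \<partial>M)"
    if c [measurable]: "\<And>n. c n \<in> borel_measurable M" for c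
  proof (rule integral_dominated_convergence[where w="\<lambda>_. 1"])
    have "(\<lambda>N. \<Sum>n<N. c n \<omega>) \<longlonglongrightarrow> (\<Sum>n. c n \<omega>)" for \<omega>
      by (rule summable_LIMSEQ) simp
    then have "(\<lambda>N. \<Prod>n<N. neg_exp (c n \<omega>)) \<longlonglongrightarrow> neg_exp (\<Sum>n. c n \<omega>)" for \<omega>
      unfolding neg_exp_sum[symmetric] by (rule tendsto_neg_exp)
    then show "AE \<omega> in M. (\<lambda>N. \<Prod>n<N. neg_exp (c n \<omega>)) \<longlonglongrightarrow> neg_exp (\<Sum>n. c n \<omega>)" by simp
    have "0 \<le> (\<Prod>n<N. neg_exp (c n \<omega>)) \<and> (\<Prod>n<N. neg_exp (c n \<omega>)) \<le> 1" for N \<omega>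
      by (auto intro!: prod_nonneg prod_le_1)
    then show "AE \<omega> in M. norm (\<Prod>n<N. neg_exp (c n \<omega>)) \<le> 1" for N by simp
  qed auto
  have "(\<lambda>N. \<integral>\<omega>. (\<Prod>n<N. neg_exp (ennreal (u * w n (\<xi> n \<omega>) \<omega>))) \<partial>M)
      \<longlonglongrightarrow> (\<integral>\<omega>. neg_exp (\<Sum>n. ennreal (u * w n (\<xi> n \<omega>) \<omega>)) \<partial>M)"
    by (rule lim) measurable
  moreover have "(\<lambda>N. \<integral>\<omega>. (\<Prod>n<N. neg_exp (G (\<xi> n \<omega>))) \<partial>M) \<longlonglongrightarrow> (\<integral>\<omega>. neg_exp (\<Sum>n. G (\<xi> n \<omega>)) \<partial>M)"
    by (rule lim) measurable
  moreover have "(\<integral>\<omega>. (\<Prod>n<N. neg_exp (ennreal (u * w n (\<xi> n \<omega>) \<omega>))) \<partial>M)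
      = (\<integral>\<omega>. (\<Prod>n<N. neg_exp (G (\<xi> n \<omega>))) \<partial>M)" for N
    using laplace_finite_sum[OF u0, of N] u0 w_nonneg by (simp add: neg_exp_G)
  ultimately have "(\<integral>\<omega>. neg_exp (\<Sum>n. ennreal (u * w n (\<xi> n \<omega>) \<omega>)) \<partial>M) = (\<integral>\<omega>. neg_exp (\<Sum>n. G (\<xi> n \<omega>)) \<partial>M)"
    using LIMSEQ_unique by simp
  moreover have "(\<Sum>n. ennreal (u * w n (\<xi> n \<omega>) \<omega>)) = ennreal u * total_load \<omega>" for \<omega>
    unfolding total_load_def using u0 w_nonneg by (simp add: ennreal_mult ennreal_suminf_cmult)
  moreover have "(\<integral>\<omega>. neg_exp (\<Sum>n. G (\<xi> n \<omega>)) \<partial>M) = (\<integral>\<omega>. neg_exp (\<integral>\<^sup>+x. G x \<partial>\<eta> \<omega>) \<partial>M)"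
  proof -
    have "AE \<omega> in M. (\<integral>\<^sup>+x. G x \<partial>\<eta> \<omega>) = (\<Sum>n. G (\<xi> n \<omega>))"
      using atoms AE_space
    proof eventually_elim
      case (elim \<omega>)
      then show ?case by (intro nn_integral_point_measure_sum sets_\<eta>) auto
    qed
    then have "AE \<omega> in M. neg_exp (\<Sum>n. G (\<xi> n \<omega>)) = neg_exp (\<integral>\<^sup>+x. G x \<partial>\<eta> \<omega>)"
      by eventually_elim simp
    moreover have [measurable]: "(\<lambda>\<omega>. \<integral>\<^sup>+x. G x \<partial>\<eta> \<omega>) \<in> borel_measurable M"
      by (rule poisson_laplace_functional[OF poisson sigma_finite_\<nu>]) measurable
    ultimately show ?thesis
      by (intro integral_cong_AE) measurable
  qed
  moreover have "(\<integral>\<omega>. neg_exp (\<integral>\<^sup>+x. G x \<partial>\<eta> \<omega>) \<partial>M) = neg_exp (\<integral>\<^sup>+x. ennreal (1 - neg_exp (G x)) \<partial>\<nu>)"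
    by (rule poisson_laplace_functional[OF poisson sigma_finite_\<nu>]) measurable
  moreover have "neg_exp (\<integral>\<^sup>+x. ennreal (1 - neg_exp (G x)) \<partial>\<nu>) = exp (- (\<integral>q. 1 - exp (- (u * wQ q)) \<partial>Q))"
    unfolding neg_exp_G nn_integral_one_minus_L[OF u]
    using u w_nonneg by (intro neg_exp_simps Bochner_Integration.integral_nonneg) (auto simp: wQ_def)
  ultimately show ?thesis by simp
qed

text \<open>
  As \<open>u\<close> tends to \<open>0\<close>, the Laplace transform tends to the probability that the sum is finite, and the
  right-hand side to \<open>1\<close>.
\<close>

lemma total_load_finite: "AE \<omega> in M. total_load \<omega> < \<top>"
proof -
  have le: "exp (- (u * (\<integral>q. wQ q \<partial>Q))) \<le> prob {\<omega>\<in>space M. total_load \<omega> < \<top>}" if u: "0 < u" for u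
  proof -
    have "(\<integral>q. 1 - exp (- (u * wQ q)) \<partial>Q) \<le> (\<integral>q. u * wQ q \<partial>Q)"
    proof (rule integral_mono_AE')
      show "integrable Q (\<lambda>q. u * wQ q)" using wQ_integrable by simp
    qed (use one_minus_exp_bounds[of "u * wQ q" for q] u w_nonneg in \<open>simp_all add: wQ_def\<close>)
    then have "exp (- (u * (\<integral>q. wQ q \<partial>Q))) \<le> (\<integral>\<omega>. neg_exp (ennreal u * total_load \<omega>) \<partial>M)"
      unfolding laplace_total_load[OF u] by simp
    also have "\<dots> \<le> (\<integral>\<omega>. indicator {\<omega>\<in>space M. total_load \<omega> < \<top>} \<omega> \<partial>M)"
    proof (rule integral_mono)
      show "integrable M (\<lambda>\<omega>. neg_exp (ennreal u * total_load \<omega>))"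
        by (rule integrable_bounded_real[where B=1]) auto
      show "neg_exp (ennreal u * total_load \<omega>) \<le> indicator {\<omega>\<in>space M. total_load \<omega> < \<top>} \<omega>" if "\<omega> \<in> space M" for \<omega>
        using that u by (cases "total_load \<omega> = \<top>") (auto simp: less_top ennreal_mult_top)
      show "integrable M (indicator {\<omega>\<in>space M. total_load \<omega> < \<top>} :: 'w \<Rightarrow> real)"
        by (rule integrable_bounded_real[where B=1]) (auto simp: indicator_def)
    qed
    finally show ?thesis by simp
  qed
  have "(\<lambda>k. exp (- (1 / real (Suc k) * (\<integral>q. wQ q \<partial>Q)))) \<longlonglongrightarrow> exp (- (0 * (\<integral>q. wQ q \<partial>Q)))"
    by (intro tendsto_intros LIMSEQ_Suc lim_1_over_n)
  then have "exp (- (0 * (\<integral>q. wQ q \<partial>Q))) \<le> prob {\<omega>\<in>space M. total_load \<omega> < \<top>}"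
    by (rule LIMSEQ_le_const2) (intro exI allI impI le, simp)
  then have "1 \<le> prob {\<omega>\<in>space M. total_load \<omega> < \<top>}" by simp
  then have "prob {\<omega>\<in>space M. total_load \<omega> < \<top>} = 1"
    using prob_le_1 by (intro antisym)
  then show ?thesis
    by (subst (asm) prob_Collect_eq_1) auto
qed

text \<open>
  Since the sum of the \<open>W\<^sub>n\<close> is finite, the instantaneous mass is finite at almost every time, and the
  real-valued integrals in the definition of the functional agree with the integrals in \<open>[0, \<infinity>]\<close>.
\<close>

lemma occupation_functional_eq_total_load:
  "AE \<omega> in M. occupation_functional m a \<eta> X \<psi> r \<omega> = enn2real (total_load \<omega>)"
  using atoms total_load_finite AE_space
proof eventually_elim
  case (elim \<omega>)
  define U where "U t = (\<Sum>n. ennreal (V n t (\<xi> n \<omega>) \<omega>))" for t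
  have [measurable]: "\<omega> \<in> space M" by fact
  have U_meas [measurable]: "U \<in> borel_measurable T" unfolding U_def by measurable
  have "(\<integral>y. \<psi> y \<partial>particle_measure m a \<eta> X t \<omega>) = enn2real (U t)" for t
    unfolding U_def V_def
    using integral_particle_measure[where \<eta>=\<eta> and \<omega>=\<omega> and p="\<lambda>n. \<xi> n \<omega>" and \<psi>=\<psi> and m=m and a=a and X=X and t=t]
      sets_\<eta>[OF elim(3)] elim(1) \<psi>_nonneg a_nonneg
    by simp
  then have "occupation_functional m a \<eta> X \<psi> r \<omega> = (\<integral>t. enn2real (U t) \<partial>T)"
    unfolding occupation_functional_def T_def set_lebesgue_integral_def
    by (simp add: integral_restrict_space)
  also have "\<dots> = enn2real (\<integral>\<^sup>+t. ennreal (enn2real (U t)) \<partial>T)"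
    by (rule integral_eq_nn_integral) auto
  also have "(\<integral>\<^sup>+t. ennreal (enn2real (U t)) \<partial>T) = (\<integral>\<^sup>+t. U t \<partial>T)"
  proof -
    have "(\<integral>\<^sup>+t. U t \<partial>T) = total_load \<omega>"
      unfolding U_def total_load_def using elim(3) by (simp add: nn_integral_suminf w_nn)
    then have "AE t in T. U t \<noteq> \<infinity>"
      using elim(2) by (intro nn_integral_noteq_infinite) auto
    then show ?thesis
      by (intro nn_integral_cong_AE) (auto elim!: eventually_mono simp: less_top)
  qed
  also have "\<dots> = total_load \<omega>"
    unfolding U_def total_load_def using elim(3) by (simp add: nn_integral_suminf w_nn)
  finally show ?case .
qed

text \<open>
  Measurability of the functional is inherited from its square, because the functional is nonnegative.
\<close>

lemma infinitely_divisible: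
  assumes A2: "integrable M (\<lambda>\<omega>. (occupation_functional m a \<eta> X \<psi> r \<omega>)\<^sup>2)"
  shows "infinitely_divisible_variable M Q (occupation_functional m a \<eta> X \<psi> r) wQ"
proof -
  let ?A = "occupation_functional m a \<eta> X \<psi> r"
  have A_nonneg: "0 \<le> ?A \<omega>" for \<omega>
    unfolding occupation_functional_def set_lebesgue_integral_def
    by (intro Bochner_Integration.integral_nonneg) (simp add: \<psi>_nonneg Bochner_Integration.integral_nonneg)
  have "(\<lambda>\<omega>. sqrt ((?A \<omega>)\<^sup>2)) \<in> borel_measurable M"
    using borel_measurable_integrable[OF A2] by measurable
  then have A_meas [measurable]: "?A \<in> borel_measurable M"
    using A_nonneg by simp
  define D where "D = load_cap * measure T (space T)"
  have wQ_le: "wQ q \<le> D" for q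
    unfolding wQ_def D_def by (rule w_le)
  have wQ_nonneg: "0 \<le> wQ q" for q unfolding wQ_def by (rule w_nonneg)
  have D_nonneg: "0 \<le> D" using wQ_nonneg wQ_le order_trans by blast
  have pow: "integrable Q (\<lambda>q. wQ q ^ Suc k)" for k
  proof (rule Bochner_Integration.integrable_bound)
    show "integrable Q (\<lambda>q. D ^ k * wQ q)" using wQ_integrable by simp
    have "norm (wQ q ^ Suc k) \<le> norm (D ^ k * wQ q)" for q
    proof -
      have "wQ q ^ k * wQ q \<le> D ^ k * wQ q"
        using wQ_nonneg wQ_le by (intro mult_right_mono power_mono) auto
      then show ?thesis
        using wQ_nonneg[of q] D_nonneg by (simp add: abs_mult power_abs mult.commute)
    qed
    then show "AE q in Q. norm (wQ q ^ Suc k) \<le> norm (D ^ k * wQ q)" by simp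
  qed measurable
  show ?thesis
  proof (unfold_locales)
    fix u :: real assume u: "0 < u"
    have "AE \<omega> in M. neg_exp (ennreal u * total_load \<omega>) = exp (- (u * ?A \<omega>))"
      using occupation_functional_eq_total_load total_load_finite
    proof eventually_elim
      case (elim \<omega>)
      then show ?case
        using u by (cases "total_load \<omega>") (auto simp: ennreal_mult[symmetric])
    qed
    then have "(\<integral>\<omega>. exp (- (u * ?A \<omega>)) \<partial>M) = (\<integral>\<omega>. neg_exp (ennreal u * total_load \<omega>) \<partial>M)"
      by (intro integral_cong_AE) (auto elim!: eventually_mono)
    then show "(\<integral>\<omega>. exp (- (u * ?A \<omega>)) \<partial>M) = exp (- (\<integral>q. 1 - exp (- (u * wQ q)) \<partial>Q))"
      by (simp add: laplace_total_load[OF u])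
  qed (use A_nonneg A2 A_meas wQ_nonneg wQ_integrable pow[of 1] pow[of 2] in \<open>simp_all add: numeral_2_eq_2 numeral_3_eq_3\<close>)
qed

section \<open>Third moments under condition (H)\<close>

text \<open>
  Values at three times are functions of the path, so the mark may be replaced by the cluster started at
  \<open>0\<close>, to which condition (H) refers. The starting point \<open>x\<close> only translates \<open>\<psi>\<close>.
\<close>

lemma nn_integral_V_triple_le:
  fixes \<kappa> \<beta> :: real
  assumes H: "conditional_density_bound M m X \<kappa> \<beta>" and \<kappa>: "0 < \<kappa>"
    and s: "0 < s1" "0 < s2" "s1 < s3" "s2 < s3" "s3 \<le> r" "s1 \<noteq> s2"
  shows "(\<integral>\<^sup>+\<omega>. ennreal (V 0 s1 x \<omega> * V 0 s2 x \<omega> * V 0 s3 x \<omega>) \<partial>M)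
    \<le> ennreal (\<kappa> * sum a {1..m} * enn2real (\<integral>\<^sup>+y. ennreal (\<psi> y) \<partial>lborel)
          * (s3 - max s1 s2) powr (- (\<beta> * real CARD('n))))
      * (\<integral>\<^sup>+\<omega>. ennreal (V 0 s1 x \<omega> * V 0 s2 x \<omega>) \<partial>M)"
proof -
  let ?K = "\<kappa> * (s3 - max s1 s2) powr (- (\<beta> * real CARD('n)))"
  let ?\<Psi> = "\<integral>\<^sup>+y. ennreal (\<psi> y) \<partial>lborel"
  define h where "h y = ennreal (\<psi> (y + x))" for y
  have [measurable]: "h \<in> borel_measurable borel" unfolding h_def by measurable
  have h_int: "(\<integral>\<^sup>+y. h y \<partial>lborel) = ?\<Psi>"
    unfolding h_def using nn_integral_lborel_translate[of "\<lambda>y. ennreal (\<psi> y)" x] by simp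
  define path where "path = cluster_path m (\<lambda>i t. X i t 0)"
  have path_meas: "path \<in> measurable M (cluster_paths m)"
    unfolding path_def cluster_paths_def cluster_path_def[abs_def]
    by (intro measurable_restrict) (auto intro: process)
  have law: "distr M (cluster_paths m) (displacement 0) = distr M (cluster_paths m) path"
    using marks_law[of 0] by (simp add: cluster_law_def displacement_def path_def)
  have transfer: "(\<integral>\<^sup>+\<omega>. f (displacement 0 \<omega>) \<partial>M) = (\<integral>\<^sup>+\<omega>. f (path \<omega>) \<partial>M)"
    if "f \<in> borel_measurable (cluster_paths m)" for f
    using nn_integral_distr[OF displacement_measurable, of f 0] nn_integral_distr[OF path_meas, of f] that law
    by simp
  have load_path: "ennreal (load s x (path \<omega>)) = (\<Sum>i\<in>{1..m}. ennreal (a i) * h (X i s 0 \<omega>))" if "0 < s" for s \<omega>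
  proof -
    have "load s x (path \<omega>) = (\<Sum>i\<in>{1..m}. a i * \<psi> (X i s 0 \<omega> + x))"
      using that by (auto simp: load_def path_def cluster_path_def add.commute intro!: sum.cong)
    also have "ennreal \<dots> = (\<Sum>i\<in>{1..m}. ennreal (a i) * h (X i s 0 \<omega>))"
      unfolding h_def by (intro sum_ennreal_mult[symmetric] a_nonneg \<psi>_nonneg)
    finally show ?thesis .
  qed
  have load_nonneg: "0 \<le> load s x y" for s y
    unfolding load_def by (intro sum_nonneg mult_nonneg_nonneg a_nonneg \<psi>_nonneg)
  have load_meas [measurable]: "(\<lambda>y. load s x y) \<in> borel_measurable (cluster_paths m)" if "0 < s" for s
    using that by (intro measurable_load) auto
  have s3_pos: "0 < s3" using s by simp
  have in_T: "s1 \<in> {0..r}" "s2 \<in> {0..r}" "s3 \<in> {0..r}" using s by auto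
  have "\<bar>s3 - max s1 s2\<bar> = s3 - max s1 s2" using s by simp
  with H s s3_pos have "\<exists>f3 f2. \<forall>i1\<in>{1..m}. \<forall>i2\<in>{1..m}. \<forall>i3\<in>{1..m}.
      (\<forall>z. 0 \<le> f3 (i1, i2, i3) z) \<and> (\<forall>z. 0 \<le> f2 (i1, i2) z) \<and>
      distributed M lborel (\<lambda>\<omega>. (X i1 s1 0 \<omega>, X i2 s2 0 \<omega>, X i3 s3 0 \<omega>)) (\<lambda>z. ennreal (f3 (i1, i2, i3) z)) \<and>
      distributed M lborel (\<lambda>\<omega>. (X i1 s1 0 \<omega>, X i2 s2 0 \<omega>)) (\<lambda>z. ennreal (f2 (i1, i2) z)) \<and>
      (\<forall>x b c. f3 (i1, i2, i3) (b, c, x) / f2 (i1, i2) (b, c) \<le> ?K)"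
    unfolding conditional_density_bound_def
    apply (elim exE)
    subgoal for f3 f2
      by (rule exI[of _ "\<lambda>i. f3 i (s1, s2, s3)"], rule exI[of _ "\<lambda>i. f2 i (s1, s2)"], intro ballI)
        (drule bspec, assumption, drule bspec, assumption, drule bspec, assumption,
          drule spec[of _ s1], drule mp, assumption, drule spec[of _ s2], drule mp, assumption,
          drule spec[of _ s3], simp)
    done
  then obtain f3 f2 where f: "\<And>i1 i2 i3. i1 \<in> {1..m} \<Longrightarrow> i2 \<in> {1..m} \<Longrightarrow> i3 \<in> {1..m} \<Longrightarrow>
      (\<forall>z. 0 \<le> f3 (i1, i2, i3) z) \<and> (\<forall>z. 0 \<le> f2 (i1, i2) z) \<and>
      distributed M lborel (\<lambda>\<omega>. (X i1 s1 0 \<omega>, X i2 s2 0 \<omega>, X i3 s3 0 \<omega>)) (\<lambda>z. ennreal (f3 (i1, i2, i3) z)) \<and>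
      distributed M lborel (\<lambda>\<omega>. (X i1 s1 0 \<omega>, X i2 s2 0 \<omega>)) (\<lambda>z. ennreal (f2 (i1, i2) z)) \<and>
      (\<forall>x b c. f3 (i1, i2, i3) (b, c, x) / f2 (i1, i2) (b, c) \<le> ?K)"
    by blast
  have X_meas: "(\<lambda>\<omega>. h (X i s 0 \<omega>)) \<in> borel_measurable M" if "i \<in> {1..m}" "0 < s" for i s
    using process[of i s 0] that by (intro measurable_compose[of _ M borel h]) auto
  have "(\<integral>\<^sup>+\<omega>. ennreal (V 0 s1 x \<omega> * V 0 s2 x \<omega> * V 0 s3 x \<omega>) \<partial>M)
      = (\<integral>\<^sup>+\<omega>. (\<Sum>i\<in>{1..m}. ennreal (a i) * h (X i s1 0 \<omega>)) * (\<Sum>i\<in>{1..m}. ennreal (a i) * h (X i s2 0 \<omega>))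
          * (\<Sum>i\<in>{1..m}. ennreal (a i) * h (X i s3 0 \<omega>)) \<partial>M)"
    using in_T s s3_pos transfer[of "\<lambda>y. ennreal (load s1 x y * load s2 x y * load s3 x y)"]
    by (simp add: V_eq_load load_path ennreal_mult load_nonneg del: One_nat_def)
  also have "\<dots> \<le> (ennreal ?K * ?\<Psi>) * (\<Sum>i\<in>{1..m}. ennreal (a i))
      * (\<integral>\<^sup>+\<omega>. (\<Sum>i\<in>{1..m}. ennreal (a i) * h (X i s1 0 \<omega>)) * (\<Sum>i\<in>{1..m}. ennreal (a i) * h (X i s2 0 \<omega>)) \<partial>M)"
  proof (rule nn_integral_weighted_triple_le)
    fix i j k assume ijk: "i \<in> {1..m}" "j \<in> {1..m}" "k \<in> {1..m}"
    have "(\<integral>\<^sup>+\<omega>. h (X i s1 0 \<omega>) * h (X j s2 0 \<omega>) * h (X k s3 0 \<omega>) \<partial>M)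
        \<le> ennreal ?K * (\<integral>\<^sup>+y. h y \<partial>lborel) * (\<integral>\<^sup>+\<omega>. h (X i s1 0 \<omega>) * h (X j s2 0 \<omega>) \<partial>M)"
      by (rule nn_integral_conditional_density_bound[of _ _ _ "f3 (i, j, k)" "f2 (i, j)"])
        (use f[OF ijk] \<kappa> in \<open>auto intro!: mult_nonneg_nonneg\<close>)
    then show "(\<integral>\<^sup>+\<omega>. h (X i s1 0 \<omega>) * h (X j s2 0 \<omega>) * h (X k s3 0 \<omega>) \<partial>M)
        \<le> ennreal ?K * ?\<Psi> * (\<integral>\<^sup>+\<omega>. h (X i s1 0 \<omega>) * h (X j s2 0 \<omega>) \<partial>M)"
      by (simp add: h_int)
  qed (use X_meas s s3_pos in auto)
  also have "(\<integral>\<^sup>+\<omega>. (\<Sum>i\<in>{1..m}. ennreal (a i) * h (X i s1 0 \<omega>)) * (\<Sum>i\<in>{1..m}. ennreal (a i) * h (X i s2 0 \<omega>)) \<partial>M)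
      = (\<integral>\<^sup>+\<omega>. ennreal (V 0 s1 x \<omega> * V 0 s2 x \<omega>) \<partial>M)"
    using in_T s transfer[of "\<lambda>y. ennreal (load s1 x y * load s2 x y)"]
    by (simp add: V_eq_load load_path ennreal_mult load_nonneg del: One_nat_def)
  also have "(ennreal ?K * ?\<Psi>) * (\<Sum>i\<in>{1..m}. ennreal (a i))
      = ennreal (\<kappa> * sum a {1..m} * enn2real ?\<Psi> * (s3 - max s1 s2) powr (- (\<beta> * real CARD('n))))"
  proof -
    have \<Psi>: "?\<Psi> = ennreal (enn2real ?\<Psi>)" using \<psi>_integrable by simp
    have "(\<Sum>i\<in>{1..m}. ennreal (a i)) = ennreal (sum a {1..m})"
      using a_nonneg by (intro sum_ennreal) auto
    moreover have "0 \<le> sum a {1..m}" using a_nonneg by (intro sum_nonneg) auto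
    moreover have "0 \<le> ?K" using \<kappa> by simp
    ultimately have "(ennreal ?K * ?\<Psi>) * (\<Sum>i\<in>{1..m}. ennreal (a i)) = ennreal (?K * enn2real ?\<Psi> * sum a {1..m})"
      by (subst \<Psi>) (simp only: ennreal_mult mult_nonneg_nonneg enn2real_nonneg)
    then show ?thesis by (simp only: mult_ac)
  qed
  finally show ?thesis .
qed

text \<open>
  The comparison of third and second moments holds for every starting point separately, with a constant
  that does not depend on it.
\<close>

lemma integral_wQ_cube_le:
  fixes \<kappa> \<beta> :: real
  assumes H: "conditional_density_bound M m X \<kappa> \<beta>" and \<kappa>: "0 < \<kappa>" and \<beta>: "\<beta> * real CARD('n) < 1"
    and int: "integrable Q (\<lambda>q. (wQ q)\<^sup>2)" "integrable Q (\<lambda>q. wQ q ^ 3)"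
  shows "(\<integral>q. wQ q ^ 3 \<partial>Q) \<le> 3 * (\<kappa> * sum a {1..m} * enn2real (\<integral>\<^sup>+y. ennreal (\<psi> y) \<partial>lborel))
      * (r powr (1 - \<beta> * real CARD('n)) / (1 - \<beta> * real CARD('n))) * (\<integral>q. (wQ q)\<^sup>2 \<partial>Q)"
proof -
  let ?b = "\<kappa> * sum a {1..m} * enn2real (\<integral>\<^sup>+y. ennreal (\<psi> y) \<partial>lborel)"
  let ?c = "3 * ?b * (r powr (1 - \<beta> * real CARD('n)) / (1 - \<beta> * real CARD('n)))"
  have b: "0 \<le> ?b" using \<kappa> a_nonneg by (intro mult_nonneg_nonneg sum_nonneg) auto
  have c: "0 \<le> ?c" using \<beta> by (intro mult_nonneg_nonneg[OF mult_nonneg_nonneg[OF _ b] divide_nonneg_nonneg]) auto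
  have wQ_nonneg: "0 \<le> wQ q" for q unfolding wQ_def by (rule w_nonneg)
  have inner: "(\<integral>\<^sup>+\<omega>. ennreal (wQ (x, \<omega>) ^ 3) \<partial>M) \<le> ennreal ?c * (\<integral>\<^sup>+\<omega>. ennreal ((wQ (x, \<omega>))\<^sup>2) \<partial>M)" for x
    unfolding wQ_def w_def T_def fst_conv snd_conv
    by (rule third_moment_time_integral[OF bounded_process_V[unfolded T_def] \<beta> b])
      (rule nn_integral_V_triple_le[OF H \<kappa>])
  have "ennreal (\<integral>q. wQ q ^ 3 \<partial>Q) = (\<integral>\<^sup>+q. ennreal (wQ q ^ 3) \<partial>Q)"
    using int(2) wQ_nonneg by (intro nn_integral_eq_integral[symmetric]) auto
  also have "\<dots> = (\<integral>\<^sup>+x. (\<integral>\<^sup>+\<omega>. ennreal (wQ (x, \<omega>) ^ 3) \<partial>M) \<partial>\<nu>)"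
    by (rule nn_integral_fst[symmetric]) measurable
  also have "\<dots> \<le> (\<integral>\<^sup>+x. ennreal ?c * (\<integral>\<^sup>+\<omega>. ennreal ((wQ (x, \<omega>))\<^sup>2) \<partial>M) \<partial>\<nu>)"
    by (intro nn_integral_mono inner)
  also have "\<dots> = ennreal ?c * (\<integral>\<^sup>+x. (\<integral>\<^sup>+\<omega>. ennreal ((wQ (x, \<omega>))\<^sup>2) \<partial>M) \<partial>\<nu>)"
    by (rule nn_integral_cmult) measurable
  also have "(\<integral>\<^sup>+x. (\<integral>\<^sup>+\<omega>. ennreal ((wQ (x, \<omega>))\<^sup>2) \<partial>M) \<partial>\<nu>) = (\<integral>\<^sup>+q. ennreal ((wQ q)\<^sup>2) \<partial>Q)"
    by (rule nn_integral_fst) measurable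
  also have "\<dots> = ennreal (\<integral>q. (wQ q)\<^sup>2 \<partial>Q)"
    using int(1) by (intro nn_integral_eq_integral) auto
  also have "ennreal ?c * \<dots> = ennreal (?c * (\<integral>q. (wQ q)\<^sup>2 \<partial>Q))"
    using c by (intro ennreal_mult[symmetric]) auto
  finally show ?thesis
    by (rule ennreal_le_iff[THEN iffD1, rotated]) (rule mult_nonneg_nonneg[OF c], simp)
qed

end

section \<open>The Wasserstein bound\<close>

text \<open>
  The constants \<open>c\<close> and hence \<open>K\<close> contain no \<open>r\<close>. The summand \<open>1\<close> in \<open>K\<close> makes it positive also
  when \<open>c = 0\<close>.
\<close>

theorem theorem2:
  fixes M :: "'w measure"
    and m :: nat
    and a :: "nat \<Rightarrow> real"
    and \<nu> :: "(real ^ 'n) measure"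
    and \<eta> :: "'w \<Rightarrow> (real ^ 'n) measure"
    and X :: "nat \<Rightarrow> real \<Rightarrow> real ^ 'n \<Rightarrow> 'w \<Rightarrow> real ^ 'n"
    and \<psi> :: "real ^ 'n \<Rightarrow> real"
    and \<kappa> \<beta> :: real
  defines "A \<equiv> occupation_functional m a \<eta> X \<psi>"
  defines "\<sigma> \<equiv> (\<lambda>r. standard_deviation M (A r))"
  assumes "poisson_cluster_system M m a \<nu> \<eta> X"
    and "\<psi> \<in> borel_measurable borel"
    and "bounded (range \<psi>)"
    and "compact (closure {y. \<psi> y \<noteq> 0})"
    and "\<And>y. 0 \<le> \<psi> y"
    and "0 < \<kappa>" and "0 < \<beta>" and "\<beta> * real CARD('n) < 1"
    and "conditional_density_bound M m X \<kappa> \<beta>"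
    and "\<And>r. 0 < r \<Longrightarrow> integrable M (\<lambda>\<omega>. (A r \<omega>)\<^sup>2)"
    and "\<And>r. 0 < r \<Longrightarrow> 0 < \<sigma> r"
  shows "\<exists>K>0. \<forall>r>0. wasserstein_dist (standardized_law M (A r)) std_normal_distribution
           \<le> ennreal (K * (r powr (1 - \<beta> * real CARD('n)) / \<sigma> r))"
proof -
  let ?\<gamma> = "\<beta> * real CARD('n)"
  interpret poisson_cluster_system M m a \<nu> \<eta> X by fact
  note [measurable] = assms(4)
  obtain b where b: "\<And>y. \<psi> y \<le> b"
    using assms(5) by (auto simp: bounded_iff intro: order_trans[OF abs_ge_self])
  have \<psi>_int: "(\<integral>\<^sup>+y. ennreal (\<psi> y) \<partial>lborel) < \<infinity>"
  proof -
    let ?S = "closure {y. \<psi> y \<noteq> 0}"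
    have "(\<integral>\<^sup>+y. ennreal (\<psi> y) \<partial>lborel) \<le> (\<integral>\<^sup>+y. ennreal b * indicator ?S y \<partial>lborel)"
    proof (rule nn_integral_mono)
      fix y
      have "\<psi> y = 0" if "y \<notin> ?S" using that closure_subset[of "{y. \<psi> y \<noteq> 0}"] by auto
      then show "ennreal (\<psi> y) \<le> ennreal b * indicator ?S y"
        using b[of y] by (cases "y \<in> ?S") (auto intro: ennreal_leI)
    qed
    also have "\<dots> = ennreal b * emeasure lborel ?S"
      by (rule nn_integral_cmult_indicator) simp
    also have "\<dots> < \<infinity>"
      using emeasure_bounded_finite[OF compact_imp_bounded[OF assms(6)]]
      by (simp add: ennreal_mult_less_top)
    finally show ?thesis .
  qed
  obtain \<xi> where \<xi>: "\<forall>n. \<xi> n \<in> borel_measurable M"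
    "AE \<omega> in M. \<forall>B\<in>sets borel. emeasure (\<eta> \<omega>) B = (\<Sum>n. indicator B (\<xi> n \<omega>))"
    "\<forall>n. \<forall>i\<in>{1..m}. (\<lambda>(t, \<omega>). X i t (\<xi> n \<omega>) \<omega>) \<in> borel_measurable (restrict_space borel {0..} \<Otimes>\<^sub>M M)"
    "indep_sets (\<lambda>j. case j of None \<Rightarrow> sequence_events M \<xi>
        | Some n \<Rightarrow> cluster_events M m (\<lambda>i t \<omega>. X i t (\<xi> n \<omega>) \<omega> - \<xi> n \<omega>)) UNIV"
    "\<forall>n. cluster_law M m (\<lambda>i t \<omega>. X i t (\<xi> n \<omega>) \<omega> - \<xi> n \<omega>) = cluster_law M m (\<lambda>i t. X i t 0)"
    using marking by blast
  define c where "c = 3 * (\<kappa> * sum a {1..m} * enn2real (\<integral>\<^sup>+y. ennreal (\<psi> y) \<partial>lborel)) / (1 - ?\<gamma>)"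
  have c: "0 \<le> c"
    unfolding c_def using assms(8,10) weights
    by (intro divide_nonneg_nonneg mult_nonneg_nonneg sum_nonneg) (auto simp: less_imp_le)
  have bound: "wasserstein_dist (standardized_law M (A r)) std_normal_distribution
      \<le> ennreal ((18 * c + 1) * (r powr (1 - ?\<gamma>) / \<sigma> r))" if r: "0 < r" for r
  proof -
    interpret MC: marked_cluster_system M m a \<nu> \<eta> X \<xi> \<psi> r b
      by unfold_locales (use \<xi> assms(4,7) b \<psi>_int r in auto)
    interpret ID: infinitely_divisible_variable M MC.Q "A r" MC.wQ
      using MC.infinitely_divisible assms(12)[OF r] by (simp add: A_def)
    have \<sigma>_pos: "0 < \<sigma> r" by (rule assms(13)[OF r])
    have \<sigma>2: "(\<integral>q. (MC.wQ q)\<^sup>2 \<partial>MC.Q) = (\<sigma> r)\<^sup>2"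
      using \<sigma>_pos ID.variance_eq_integral_square by (simp add: \<sigma>_def standard_deviation_def)
    have "(\<integral>q. MC.wQ q ^ 3 \<partial>MC.Q) \<le> c * r powr (1 - ?\<gamma>) * (\<sigma> r)\<^sup>2"
      using MC.integral_wQ_cube_le[OF assms(11,8,10) ID.w_square ID.w_cube] by (simp add: \<sigma>2 c_def)
    then have "18 * (\<integral>q. MC.wQ q ^ 3 \<partial>MC.Q) / \<sigma> r ^ 3 \<le> 18 * (c * r powr (1 - ?\<gamma>) * (\<sigma> r)\<^sup>2) / \<sigma> r ^ 3"
      using \<sigma>_pos by (intro divide_right_mono) auto
    also have "\<dots> = 18 * c * (r powr (1 - ?\<gamma>) / \<sigma> r)"
      using \<sigma>_pos by (simp add: power2_eq_square power3_eq_cube)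
    also have "\<dots> \<le> (18 * c + 1) * (r powr (1 - ?\<gamma>) / \<sigma> r)"
      using \<sigma>_pos by (intro mult_right_mono) auto
    finally show ?thesis
      using ID.wasserstein_bound \<sigma>_pos
      by (auto simp: \<sigma>_def intro: order_trans ennreal_leI)
  qed
  show ?thesis
    using bound c by (intro exI[of _ "18 * c + 1"]) auto
qed

end
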